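(* Let $H$ be a complex Hilbert space and let $\pi:\mathscr{A}\to B(H)$ be a unital contractive representation. Then $\pi$ is completely contractive if and only if there is a Hilbert space $K\supset H$ and a unitary operator $U\in B(K)$ such that for all integers $n\ge 0$, $n\ne 1$, $$\pi(z^n)=P_H U^n|_H .$$
   Context: $\mathbb D$ is the open unit disk in $\mathbb C$. The disk algebra $\mathbb A(\mathbb D)$ is the closure of the analytic polynomials in $C(\overline{\mathbb D})$ with the supremum norm. The Neil algebra is $\mathscr{A}=\{f\in\mathbb A(\mathbb D): f'(0)=0\}=\mathbb C+z^2\mathbb A(\mathbb D)$, with the supremum norm. A unital representation (unital algebra homomorphism) $\pi:\mathscr{A}\to B(H)$ is contractive if $\|\pi(f)\|\le\|f\|$ for all $f\in\mathscr{A}$, and completely contractive if for every $n$ and every $F=(f_{j,\ell})\in M_n(\mathscr{A})$ one has $\|(\pi(f_{j,\ell}))_{j,\ell}\|\le\|F\|$, where $\|F\|=\sup_{z\in\mathbb D}\|F(z)\|$ (operator norm of the matrix $F(z)$). For $H\subset K$, $P_H$ is the orthogonal projection of $K$ onto $H$ and $|_H$ denotes restriction to $H$. *)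

theory Defs
  imports "HOL-Analysis.Analysis" "HOL-Library.Function_Algebras"
begin

text \<open>Complex Hilbert spaces as a type class. The real inner product of the superclass is the real part
  of the complex one, so the norm is \<open>sqrt (Re (cinner x x))\<close>; positive definiteness and
  completeness are inherited from the superclasses. \<open>cinner\<close> is linear in its first argument.\<close>

class complex_hilbert_space = real_inner + complete_space +
  fixes scaleC :: "complex \<Rightarrow> 'a \<Rightarrow> 'a" (infixr "*\<^sub>C" 75)
    and cinner :: "'a \<Rightarrow> 'a \<Rightarrow> complex"
  assumes scaleC_add_right: "a *\<^sub>C (x + y) = a *\<^sub>C x + a *\<^sub>C y"
    and scaleC_add_left: "(a + b) *\<^sub>C x = a *\<^sub>C x + b *\<^sub>C x"
    and scaleC_scaleC: "a *\<^sub>C (b *\<^sub>C x) = (a * b) *\<^sub>C x"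
    and scaleR_scaleC: "r *\<^sub>R x = of_real r *\<^sub>C x"
    and cinner_commute: "cinner x y = cnj (cinner y x)"
    and cinner_add_left: "cinner (x + y) z = cinner x z + cinner y z"
    and cinner_scaleC_left: "cinner (a *\<^sub>C x) y = a * cinner x y"
    and inner_eq_Re_cinner: "inner x y = Re (cinner x y)"

instantiation complex :: complex_hilbert_space
begin
definition scaleC_complex :: "complex \<Rightarrow> complex \<Rightarrow> complex"
  where "scaleC_complex a x = a * x"
definition cinner_complex :: "complex \<Rightarrow> complex \<Rightarrow> complex"
  where "cinner_complex x y = x * cnj y"
instance
  by standard
    (simp_all add: scaleC_complex_def cinner_complex_def algebra_simps inner_complex_def
      scaleR_conv_of_real)
end

text \<open>Complex Hilbert spaces on a carrier set \<open>K\<close>, a linear subspace of some ambient complex vector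
  space. This form can be quantified existentially inside a formula, which a type cannot.\<close>

locale hilbert_space_on = vector_space scl
  for scl :: "complex \<Rightarrow> 'k::ab_group_add \<Rightarrow> 'k" +
  fixes K :: "'k set" and ip :: "'k \<Rightarrow> 'k \<Rightarrow> complex"
  assumes subspace_K: "subspace K"
    and ip_commute: "\<lbrakk>x \<in> K; y \<in> K\<rbrakk> \<Longrightarrow> ip x y = cnj (ip y x)"
    and ip_add_left: "\<lbrakk>x \<in> K; y \<in> K; z \<in> K\<rbrakk> \<Longrightarrow> ip (x + y) z = ip x z + ip y z"
    and ip_scale_left: "\<lbrakk>x \<in> K; y \<in> K\<rbrakk> \<Longrightarrow> ip (scl a x) y = a * ip x y"
    and ip_ge_zero: "x \<in> K \<Longrightarrow> 0 \<le> Re (ip x x)"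
    and ip_eq_zero: "\<lbrakk>x \<in> K; ip x x = 0\<rbrakk> \<Longrightarrow> x = 0"
    and mcomplete_K: "Metric_space.mcomplete K (\<lambda>x y. sqrt (Re (ip (x - y) (x - y))))"

lemma hilbert_space_on_UNIV:
  "hilbert_space_on (scaleC :: complex \<Rightarrow> 'a::complex_hilbert_space \<Rightarrow> 'a) UNIV cinner"
proof -
  have one: "1 *\<^sub>C x = x" for x :: 'a
    using scaleR_scaleC[of 1 x] by simp
  interpret vector_space "scaleC :: complex \<Rightarrow> 'a \<Rightarrow> 'a"
    by standard (simp_all add: scaleC_add_right scaleC_add_left scaleC_scaleC one)
  have d: "(\<lambda>x y :: 'a. sqrt (Re (cinner (x - y) (x - y)))) = dist"
    by (intro ext) (simp add: dist_norm norm_eq_sqrt_inner inner_eq_Re_cinner)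
  show ?thesis
  proof
    show "Metric_space.mcomplete UNIV (\<lambda>x y :: 'a. sqrt (Re (cinner (x - y) (x - y))))"
      unfolding d using mcomplete_iff_complete complete_UNIV by blast
    show "x = 0" if "cinner x x = 0" for x :: 'a
      using that inner_eq_Re_cinner[of x x] by simp
    show "0 \<le> Re (cinner x x)" for x :: 'a
      using inner_eq_Re_cinner[of x x] by (metis inner_ge_zero)
  qed (use cinner_commute in \<open>auto simp: cinner_add_left cinner_scaleC_left subspace_UNIV\<close>)
qed

text \<open>Elements of \<open>C(cball 0 1)\<close> are represented by functions on the whole plane, whose values
  outside the closed unit disk are irrelevant.\<close>

definition disk_algebra :: "(complex \<Rightarrow> complex) set" where
  "disk_algebra =
    {f. \<exists>p :: nat \<Rightarrow> complex poly. uniform_limit (cball 0 1) (\<lambda>n. poly (p n)) f sequentially}"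

definition neil_algebra :: "(complex \<Rightarrow> complex) set" where
  "neil_algebra = {f \<in> disk_algebra. deriv f 0 = 0}"

definition sup_norm :: "(complex \<Rightarrow> complex) \<Rightarrow> real" where
  "sup_norm f = (SUP z\<in>cball 0 1. cmod (f z))"

text \<open>\<open>blinfun\<close> only provides real-linear operators, so complex linearity of \<open>\<pi> f\<close> is required
  explicitly. The first condition says that \<open>\<pi> f\<close> depends only on \<open>f\<close> on the closed disk.\<close>

definition unital_representation ::
    "((complex \<Rightarrow> complex) \<Rightarrow> ('h::complex_hilbert_space \<Rightarrow>\<^sub>L 'h)) \<Rightarrow> bool" where
  "unital_representation \<pi> \<longleftrightarrow>
    (\<forall>f\<in>neil_algebra. \<forall>g\<in>neil_algebra. (\<forall>z\<in>cball 0 1. f z = g z) \<longrightarrow> \<pi> f = \<pi> g) \<and>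
    (\<forall>f\<in>neil_algebra. \<forall>c x. blinfun_apply (\<pi> f) (c *\<^sub>C x) = c *\<^sub>C blinfun_apply (\<pi> f) x) \<and>
    (\<forall>f\<in>neil_algebra. \<forall>g\<in>neil_algebra. \<pi> (\<lambda>z. f z + g z) = \<pi> f + \<pi> g) \<and>
    (\<forall>f\<in>neil_algebra. \<forall>c x. blinfun_apply (\<pi> (\<lambda>z. c * f z)) x = c *\<^sub>C blinfun_apply (\<pi> f) x) \<and>
    (\<forall>f\<in>neil_algebra. \<forall>g\<in>neil_algebra. \<pi> (\<lambda>z. f z * g z) = \<pi> f o\<^sub>L \<pi> g) \<and>
    \<pi> (\<lambda>z. 1) = id_blinfun"

definition contractive ::
    "((complex \<Rightarrow> complex) \<Rightarrow> ('h::complex_hilbert_space \<Rightarrow>\<^sub>L 'h)) \<Rightarrow> bool" where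
  "contractive \<pi> \<longleftrightarrow> (\<forall>f\<in>neil_algebra. norm (\<pi> f) \<le> sup_norm f)"

text \<open>Operator norm of an \<open>n \<times> n\<close> matrix of operators acting on the \<open>n\<close>-fold Hilbert direct sum;
  only the entries \<open>x l\<close> with \<open>l < n\<close> of a vector \<open>x\<close> matter.\<close>

definition matrix_norm ::
    "nat \<Rightarrow> (nat \<Rightarrow> nat \<Rightarrow> 'h::real_normed_vector \<Rightarrow> 'h) \<Rightarrow> real" where
  "matrix_norm n T =
    (SUP x\<in>{x. L2_set (\<lambda>l. norm (x l)) {..<n} \<le> 1}.
      L2_set (\<lambda>j. norm (\<Sum>l<n. T j l (x l))) {..<n})"

definition completely_contractive ::
    "((complex \<Rightarrow> complex) \<Rightarrow> ('h::complex_hilbert_space \<Rightarrow>\<^sub>L 'h)) \<Rightarrow> bool" where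
  "completely_contractive \<pi> \<longleftrightarrow>
    (\<forall>n. \<forall>F :: nat \<Rightarrow> nat \<Rightarrow> complex \<Rightarrow> complex.
      (\<forall>j<n. \<forall>l<n. F j l \<in> neil_algebra) \<longrightarrow>
      matrix_norm n (\<lambda>j l. blinfun_apply (\<pi> (F j l)))
        \<le> (SUP z\<in>ball 0 1. matrix_norm n (\<lambda>j l w. F j l z * w)))"

definition unitary_on ::
    "(complex \<Rightarrow> 'k::ab_group_add \<Rightarrow> 'k) \<Rightarrow> 'k set \<Rightarrow> ('k \<Rightarrow> 'k \<Rightarrow> complex) \<Rightarrow> ('k \<Rightarrow> 'k) \<Rightarrow> bool" where
  "unitary_on scl K ip U \<longleftrightarrow>
    bij_betw U K K \<and>
    (\<forall>x\<in>K. \<forall>y\<in>K. U (x + y) = U x + U y) \<and>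
    (\<forall>c. \<forall>x\<in>K. U (scl c x) = scl c (U x)) \<and>
    (\<forall>x\<in>K. \<forall>y\<in>K. ip (U x) (U y) = ip x y)"

definition isometric_embedding ::
    "(complex \<Rightarrow> 'k::ab_group_add \<Rightarrow> 'k) \<Rightarrow> 'k set \<Rightarrow> ('k \<Rightarrow> 'k \<Rightarrow> complex)
      \<Rightarrow> ('h::complex_hilbert_space \<Rightarrow> 'k) \<Rightarrow> bool" where
  "isometric_embedding scl K ip J \<longleftrightarrow>
    range J \<subseteq> K \<and>
    (\<forall>x y. J (x + y) = J x + J y) \<and>
    (\<forall>c x. J (c *\<^sub>C x) = scl c (J x)) \<and>
    (\<forall>x y. ip (J x) (J y) = cinner x y)"

definition orthogonal_projection ::
    "('k::ab_group_add \<Rightarrow> 'k \<Rightarrow> complex) \<Rightarrow> 'k set \<Rightarrow> 'k \<Rightarrow> 'k" where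
  "orthogonal_projection ip M x = (THE y. y \<in> M \<and> (\<forall>m\<in>M. ip (x - y) m = 0))"

text \<open>The inclusion of \<open>H\<close> in \<open>K\<close> is rendered by the isometric embedding \<open>J\<close>, and \<open>H\<close> is
  identified with \<open>range J\<close>.\<close>

definition unitary_dilation ::
    "(complex \<Rightarrow> 'k::ab_group_add \<Rightarrow> 'k) \<Rightarrow> 'k set \<Rightarrow> ('k \<Rightarrow> 'k \<Rightarrow> complex)
      \<Rightarrow> ('h::complex_hilbert_space \<Rightarrow> 'k) \<Rightarrow> ('k \<Rightarrow> 'k)
      \<Rightarrow> ((complex \<Rightarrow> complex) \<Rightarrow> ('h \<Rightarrow>\<^sub>L 'h)) \<Rightarrow> bool" where
  "unitary_dilation scl K ip J U \<pi> \<longleftrightarrow>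
    hilbert_space_on scl K ip \<and>
    isometric_embedding scl K ip J \<and>
    unitary_on scl K ip U \<and>
    (\<forall>n::nat. n \<noteq> 1 \<longrightarrow>
      (\<forall>h. J (blinfun_apply (\<pi> (\<lambda>z. z ^ n)) h)
        = orthogonal_projection ip (range J) ((U ^^ n) (J h))))"

end

theory Submission
  imports Defs "HOL-Complex_Analysis.Complex_Analysis" "HOL-Analysis.Finite_Function_Topology"
begin

text \<open>Suppose first that \<open>\<pi> (z ^ n)\<close> is the compression of \<open>U ^ n\<close> for all \<open>n \<noteq> 1\<close>. Elements of the Neil
algebra are uniform limits of polynomials without linear term, and for a matrix \<open>F\<close> of such polynomials
\<open>(\<pi> (F j l))\<close> is the compression of \<open>(F j l (U))\<close>. So everything comes down to the matrix version of
von Neumann's inequality for a unitary, \<open>unitary_matrix_von_Neumann\<close>. For this,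
let \<open>F (U)\<close> act along the orbit segment \<open>x, U x, \<dots>, U ^ N x\<close>. This is a finite Toeplitz section of
\<open>F\<close>; as a matrix of scalars its norm is at most the supremum of \<open>\<parallel>F\<parallel>\<close> on the circle, by Parseval's
identity for the discrete Fourier transform, and a bound for a matrix of scalars persists when
the matrix acts on tuples of vectors. The contribution of the ends of the segment becomes negligible as
\<open>N \<rightarrow> \<infinity>\<close>.

Conversely, let \<open>\<pi>\<close> be completely contractive. What is missing is an operator in the place of \<open>\<pi> (z)\<close>:
numbers \<open>\<tau> 1 a b\<close> that, together with \<open>\<tau> m a b = \<langle>\<pi> (z ^ m) a, b\<rangle>\<close> for \<open>m \<noteq> 1\<close>, make the Toeplitz
kernel \<open>((i, a), (j, b)) \<mapsto> \<tau> (i - j) a b\<close> on \<open>\<int> \<times> H\<close>, extended from \<open>i \<ge> j\<close> to \<open>i < j\<close> by Hermitian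
symmetry, positive semidefinite. Complete contractivity,
applied to \<open>1 - t F\<close> with \<open>t \<rightarrow> 0\<close>, shows that matrices over the Neil algebra with nonnegative real part
on the disk go to operator matrices with nonnegative real part. In other words, the real-linear functional
\<open>c z ^ m (a \<otimes> b) \<mapsto> Re (c \<langle>\<pi> (z ^ m) a, b\<rangle>)\<close>, on formal sums in which \<open>m = 1\<close> does not occur, is
nonnegative on sums whose symbol has nonnegative real part. By M. Riesz's extension theorem
(\<open>positive_functional_extension\<close>) it extends to a positive functional on all formal sums, and its
values at \<open>m = 1\<close> are the missing numbers. The kernel is positive semidefinite because the symbols of
Toeplitz quadratic forms have nonnegative real part, which is the positivity of the Szego kernel
\<open>(i, j) \<mapsto> z ^ (i - j)\<close> (conjugated for \<open>i < j\<close>) at each point of the disk.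

Symbols are tested on arbitrary functions \<open>H \<rightarrow> \<complex>\<close>, as if the vectors of \<open>H\<close> were linearly
independent. So a free vector space takes the place of the tensor product of \<open>H\<close> with its conjugate, and
nothing is lost: since \<open>\<tau> 0 a b = \<langle>a, b\<rangle>\<close>, the map \<open>a \<mapsto> (n, a)\<close> into the Hilbert space of the kernel preserves inner
products, and such a map is automatically linear (\<open>isometric_imp_embedding\<close>). The dilation space is the
reproducing kernel Hilbert space of the kernel, the unitary is the translation of \<open>\<int>\<close>, and
\<open>f \<mapsto> (n \<mapsto> P U ^ (- n) f)\<close>, with \<open>P\<close> the compression to \<open>H\<close>, moves this space into the functions
\<open>\<int> \<rightarrow> H\<close>.\<close>

section \<open>Extension of positive functionals\<close>

definition sublinear :: "('v::real_vector \<Rightarrow> real) \<Rightarrow> bool" where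
  "sublinear p \<longleftrightarrow> (\<forall>x y. p (x + y) \<le> p x + p y) \<and> (\<forall>r>0. \<forall>x. p (r *\<^sub>R x) \<le> r * p x)"

lemma sublinearD:
  assumes "sublinear p"
  shows "p (x + y) \<le> p x + p y" and "r > 0 \<Longrightarrow> p (r *\<^sub>R x) = r * p x"
    and "p 0 = 0" and "- p (- x) \<le> p x"
proof -
  have h: "p (r *\<^sub>R x) \<le> r * p x" if "r > 0" for r x
    using assms that by (auto simp: sublinear_def)
  show a: "p (x + y) \<le> p x + p y" for x y
    using assms by (auto simp: sublinear_def)
  show "p (r *\<^sub>R x) = r * p x" if "r > 0"
  proof (rule antisym[OF h[OF that]])
    show "r * p x \<le> p (r *\<^sub>R x)"
      using h[of "inverse r" "r *\<^sub>R x"] that by (simp add: field_simps)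
  qed
  show z: "p 0 = 0"
    using h[of "1/2" 0] h[of 2 0] by simp
  show "- p (- x) \<le> p x"
    using a[of x "-x"] z by simp
qed

text \<open>The Hahn-Banach theorem in the form: a pointwise minimal sublinear functional is linear. By Zorn's lemma
there is a minimal \<open>q\<close> below \<open>p\<close>. For each \<open>y\<close>, the functional
\<open>x \<mapsto> inf\<^bsub>t \<ge> 0\<^esub> q (x + t y) - t q y\<close> is sublinear and below \<open>q\<close>, hence equal to \<open>q\<close>, and its definition
at \<open>t = 1\<close> reads \<open>q x + q y \<le> q (x + y)\<close>.\<close>

lemma sublinear_dominates_linear:
  fixes p :: "'v::real_vector \<Rightarrow> real"
  assumes p: "sublinear p"
  shows "\<exists>f. linear f \<and> (\<forall>x. f x \<le> p x)"
proof -
  define A where "A = {q. sublinear q \<and> (\<forall>x. q x \<le> p x)}"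
  define P where "P = (\<lambda>q r :: 'v \<Rightarrow> real. \<forall>x. r x \<le> q x)"
  have lower: "- p (- x) \<le> q x" if "q \<in> A" for q x
    using sublinearD(4)[of q x] that unfolding A_def by (smt (verit) mem_Collect_eq)
  have "\<exists>m\<in>A. \<forall>a\<in>A. P m a \<longrightarrow> a = m"
  proof (rule predicate_Zorn)
    show "partial_order_on A (relation_of P A)"
      unfolding partial_order_on_def preorder_on_def refl_on_def trans_def antisym_def
        relation_of_def P_def
      by (auto intro: order_trans antisym intro!: ext)
  next
    fix C assume C: "C \<in> Chains (relation_of P A)"
    then have CA: "C \<subseteq> A" and tot: "\<And>q r. q \<in> C \<Longrightarrow> r \<in> C \<Longrightarrow> P q r \<or> P r q"
      by (auto simp: Chains_def relation_of_def)
    show "\<exists>u\<in>A. \<forall>a\<in>C. P a u"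
    proof (cases "C = {}")
      case True
      then show ?thesis using p by (auto simp: A_def)
    next
      case False
      define u where "u = (\<lambda>x. INF q\<in>C. q x)"
      have bdd: "bdd_below ((\<lambda>q. q x) ` C)" for x
        using lower CA by (intro bdd_belowI[of _ "- p (- x)"]) auto
      have ule: "u x \<le> q x" if "q \<in> C" for q x
        unfolding u_def using bdd that by (rule cINF_lower)
      have "u (x + y) \<le> u x + u y" for x y
      proof -
        have "u (x + y) \<le> q x + r y" if qr: "q \<in> C" "r \<in> C" for q r
        proof -
          obtain m where m: "m \<in> C" "\<forall>x. m x \<le> q x" "\<forall>x. m x \<le> r x"
            using tot[OF qr] qr unfolding P_def by blast
          have "u (x + y) \<le> m (x + y)" using ule m by blast
          also have "\<dots> \<le> m x + m y" using m(1) CA sublinearD(1) unfolding A_def by blast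
          also have "\<dots> \<le> q x + r y" using m by (simp add: add_mono)
          finally show ?thesis .
        qed
        note le = this
        have le': "u (x + y) - q x \<le> u y" if "q \<in> C" for q
          unfolding u_def[THEN fun_cong, of y]
        proof (rule cINF_greatest[OF False])
          show "u (x + y) - q x \<le> r y" if "r \<in> C" for r
            using le[OF \<open>q \<in> C\<close> that] by simp
        qed
        have "u (x + y) - u y \<le> u x"
          unfolding u_def[THEN fun_cong, of x]
        proof (rule cINF_greatest[OF False])
          show "u (x + y) - u y \<le> q x" if "q \<in> C" for q
            using le'[OF that] by simp
        qed
        then show ?thesis by simp
      qed
      moreover have "u (r *\<^sub>R x) \<le> r * u x" if r: "r > 0" for r x
      proof -
        have "u (r *\<^sub>R x) / r \<le> q x" if "q \<in> C" for q
          using ule[OF that, of "r *\<^sub>R x"] sublinearD(2)[of q r x] r that CA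
          unfolding A_def by (auto simp: field_simps)
        then have "u (r *\<^sub>R x) / r \<le> u x"
          unfolding u_def[THEN fun_cong, of x] using False by (intro cINF_greatest) auto
        then show ?thesis using r by (simp add: field_simps)
      qed
      moreover have "u x \<le> p x" for x
        using False ule CA unfolding A_def by (smt (verit, ccfv_SIG) ex_in_conv mem_Collect_eq subset_iff)
      ultimately have "u \<in> A" by (simp add: A_def sublinear_def)
      then show ?thesis using ule unfolding P_def by blast
    qed
  qed
  then obtain q where qA: "q \<in> A" and qmin: "\<And>a. a \<in> A \<Longrightarrow> P q a \<Longrightarrow> a = q" by blast
  then have q: "sublinear q" by (simp add: A_def)
  have superadd: "q x + q y \<le> q (x + y)" for x y
  proof -
    \<comment> \<open>The competitor for \<open>q\<close> in the direction of \<open>y\<close>.\<close>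
    define qy where "qy = (\<lambda>x. INF t\<in>{0..}. q (x + t *\<^sub>R y) - t * q y)"
    have tq: "q (t *\<^sub>R y) = t * q y" if "t \<ge> 0" for t
      using that sublinearD(2,3)[OF q] by (cases "t = 0") auto
    have "- q (- x) \<le> q (x + t *\<^sub>R y) - t * q y" if "t \<ge> 0" for t x
      using sublinearD(1)[OF q, of "x + t *\<^sub>R y" "- x"] tq[OF that] by simp
    then have bdd: "bdd_below ((\<lambda>t. q (x + t *\<^sub>R y) - t * q y) ` {0..})" for x
      by (intro bdd_belowI[of _ "- q (- x)"]) auto
    have qyle: "qy x \<le> q (x + t *\<^sub>R y) - t * q y" if "t \<ge> 0" for t x
      unfolding qy_def by (rule cINF_lower[OF bdd]) (use that in auto)
    have "qy (x + x') \<le> qy x + qy x'" for x x'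
    proof -
      have "qy (x + x') \<le> (q (x + t *\<^sub>R y) - t * q y) + (q (x' + t' *\<^sub>R y) - t' * q y)"
        if "t \<ge> 0" "t' \<ge> 0" for t t'
        using qyle[of "t + t'" "x + x'"] that
          sublinearD(1)[OF q, of "x + t *\<^sub>R y" "x' + t' *\<^sub>R y"]
        by (simp add: algebra_simps)
      note le = this
      have le': "qy (x + x') - (q (x + t *\<^sub>R y) - t * q y) \<le> qy x'" if "t \<ge> 0" for t
        unfolding qy_def[THEN fun_cong, of x']
      proof (rule cINF_greatest)
        fix t' :: real assume "t' \<in> {0..}"
        then show "qy (x + x') - (q (x + t *\<^sub>R y) - t * q y) \<le> q (x' + t' *\<^sub>R y) - t' * q y"
          using le[OF that, of t'] by simp
      qed simp
      have "qy (x + x') - qy x' \<le> qy x"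
        unfolding qy_def[THEN fun_cong, of x]
      proof (rule cINF_greatest)
        fix t :: real assume "t \<in> {0..}"
        then show "qy (x + x') - qy x' \<le> q (x + t *\<^sub>R y) - t * q y"
          using le'[of t] by simp
      qed simp
      then show ?thesis by simp
    qed
    moreover have "qy (r *\<^sub>R x) \<le> r * qy x" if r: "r > 0" for r x
    proof -
      have "qy (r *\<^sub>R x) / r \<le> q (x + t *\<^sub>R y) - t * q y" if "t \<ge> 0" for t
        using qyle[of "r * t" "r *\<^sub>R x"] sublinearD(2)[OF q r, of "x + t *\<^sub>R y"] r that
        by (simp add: field_simps scaleR_add_right)
      then have "qy (r *\<^sub>R x) / r \<le> qy x"
        unfolding qy_def[THEN fun_cong, of x] by (intro cINF_greatest) auto
      then show ?thesis using r by (simp add: field_simps)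
    qed
    ultimately have "sublinear qy" by (simp add: sublinear_def)
    moreover have qyq: "qy x \<le> q x" for x using qyle[of 0 x] by simp
    moreover have "q x \<le> p x" for x using qA by (simp add: A_def)
    ultimately have "qy \<in> A" unfolding A_def using order_trans by blast
    then have "qy = q" using qmin qyq unfolding P_def by blast
    then show ?thesis using qyle[of 1 x] by simp
  qed
  have add: "q (x + y) = q x + q y" for x y
    using superadd sublinearD(1)[OF q] by (metis antisym)
  have neg: "q (- x) = - q x" for x
    using add[of x "- x"] sublinearD(3)[OF q] by simp
  have "q (r *\<^sub>R x) = r * q x" for r x
  proof (cases r "0::real" rule: linorder_cases)
    case less
    then show ?thesis using sublinearD(2)[OF q, of "- r" x] neg[of "r *\<^sub>R x"] by simp
  qed (use sublinearD(2,3)[OF q] in auto)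
  then have "linear q" using add by (intro linearI) auto
  then show ?thesis using qA by (auto simp: A_def)
qed

text \<open>M. Riesz's extension theorem. The sublinear functional to apply Hahn-Banach to is
\<open>p v = inf {s w | w \<in> S, w - v \<in> C}\<close>; it is finite by cofinality of \<open>S\<close> and positivity of \<open>s\<close>. A linear functional below \<open>p\<close>
agrees with \<open>s\<close> on \<open>S\<close>, since \<open>p \<le> s\<close> there, and is nonnegative on \<open>C\<close>, since \<open>p (- v) \<le> s 0 = 0\<close> for
\<open>v \<in> C\<close>.\<close>

lemma positive_functional_extension:
  fixes s :: "'v::real_vector \<Rightarrow> real"
  assumes s: "linear s" and S: "subspace S" and C: "convex_cone C"
    and pos: "\<And>w. w \<in> S \<inter> C \<Longrightarrow> s w \<ge> 0"
    and cofinal: "\<And>v. \<exists>w\<in>S. w - v \<in> C"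
  shows "\<exists>f. linear f \<and> (\<forall>w\<in>S. f w = s w) \<and> (\<forall>v\<in>C. f v \<ge> 0)"
proof -
  have Cadd: "x + y \<in> C" if "x \<in> C" "y \<in> C" for x y
    using C that by (simp add: convex_cone_def convex_cone_add)
  have Cscale: "r *\<^sub>R x \<in> C" if "x \<in> C" "r \<ge> 0" for x r
    using C that by (simp add: convex_cone_def conicD)
  have C0: "0 \<in> C" using C by (metis Cscale convex_cone_nonempty ex_in_conv order_refl scaleR_zero_left)
  define p where "p = (\<lambda>v. INF w\<in>{w \<in> S. w - v \<in> C}. s w)"
  have ne: "{w \<in> S. w - v \<in> C} \<noteq> {}" for v using cofinal by blast
  have bdd: "bdd_below (s ` {w \<in> S. w - v \<in> C})" for v
  proof -
    obtain w' where w': "w' \<in> S" "w' - (- v) \<in> C" using cofinal by blast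
    have "- s w' \<le> s w" if "w \<in> S" "w - v \<in> C" for w
    proof -
      have "w + w' \<in> S \<inter> C"
        using Cadd[OF that(2) w'(2)] subspace_add[OF S that(1) w'(1)] by (simp add: algebra_simps)
      then show ?thesis using pos[of "w + w'"] linear_add[OF s] by fastforce
    qed
    then show ?thesis by (intro bdd_belowI[of _ "- s w'"]) auto
  qed
  have ple: "p v \<le> s w" if "w \<in> S" "w - v \<in> C" for v w
    unfolding p_def using bdd that by (auto intro!: cINF_lower)
  have pge: "b \<le> p v" if "\<And>w. w \<in> S \<Longrightarrow> w - v \<in> C \<Longrightarrow> b \<le> s w" for b v
    unfolding p_def using ne that by (intro cINF_greatest) auto
  have "sublinear p"
    unfolding sublinear_def
  proof (intro conjI allI impI)
    fix x y
    have "p (x + y) \<le> s w + s w'" if "w \<in> S" "w - x \<in> C" "w' \<in> S" "w' - y \<in> C" for w w'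
      using ple[of "w + w'" "x + y"] Cadd[OF that(2,4)] subspace_add[OF S that(1,3)] linear_add[OF s]
      by (simp add: algebra_simps)
    note le = this
    have le': "p (x + y) - s w \<le> p y" if "w \<in> S" "w - x \<in> C" for w
    proof (rule pge)
      show "p (x + y) - s w \<le> s w'" if "w' \<in> S" "w' - y \<in> C" for w'
        using le[OF \<open>w \<in> S\<close> \<open>w - x \<in> C\<close> that] by simp
    qed
    have "p (x + y) - p y \<le> p x"
    proof (rule pge)
      show "p (x + y) - p y \<le> s w" if "w \<in> S" "w - x \<in> C" for w
        using le'[OF that] by simp
    qed
    then show "p (x + y) \<le> p x + p y" by simp
  next
    fix r :: real and x assume r: "r > 0"
    have "p (r *\<^sub>R x) / r \<le> s w" if "w \<in> S" "w - x \<in> C" for w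
      using ple[of "r *\<^sub>R w" "r *\<^sub>R x"] Cscale[OF that(2), of r] subspace_scale[OF S that(1)] r
        linear_scale[OF s, of r w]
      by (simp add: scaleR_diff_right field_simps)
    then have "p (r *\<^sub>R x) / r \<le> p x" by (intro pge)
    then show "p (r *\<^sub>R x) \<le> r * p x" using r by (simp add: field_simps)
  qed
  then obtain f where f: "linear f" and fp: "\<And>x. f x \<le> p x"
    using sublinear_dominates_linear by blast
  have fs: "f w \<le> s w" if "w \<in> S" for w
    using ple[of w w] C0 that fp[of w] by simp
  have "f w = s w" if "w \<in> S" for w
    using fs[OF that] fs[OF subspace_neg[OF S that]] linear_neg[OF f] linear_neg[OF s]
    by fastforce
  moreover have "f v \<ge> 0" if "v \<in> C" for v
    using ple[of 0 "- v"] that subspace_0[OF S] fp[of "- v"] linear_neg[OF f, of v] linear_0[OF s] by simp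
  ultimately show ?thesis using f by blast
qed

section \<open>Formal sums\<close>

text \<open>The extension of \<open>\<phi>\<close> from points to formal complex combinations of points.\<close>

definition lin :: "('x \<Rightarrow> complex) \<Rightarrow> ('x \<Rightarrow>\<^sub>0 complex) \<Rightarrow> complex" where
  "lin \<phi> d = (\<Sum>p\<in>Poly_Mapping.keys d. Poly_Mapping.lookup d p * \<phi> p)"

lemma lin_superset:
  assumes "finite I" "Poly_Mapping.keys d \<subseteq> I"
  shows "lin \<phi> d = (\<Sum>p\<in>I. Poly_Mapping.lookup d p * \<phi> p)"
  unfolding lin_def using assms
  by (intro sum.mono_neutral_left) (auto simp: in_keys_iff)

lemma lin_zero [simp]: "lin \<phi> 0 = 0"
  by (simp add: lin_def)

lemma lin_single [simp]: "lin \<phi> (Poly_Mapping.single p c) = c * \<phi> p"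
  by (subst lin_superset[of "{p}"]) auto

lemma lin_add: "lin \<phi> (d + e) = lin \<phi> d + lin \<phi> e"
proof -
  let ?I = "Poly_Mapping.keys d \<union> Poly_Mapping.keys e"
  have "Poly_Mapping.keys (d + e) \<subseteq> ?I" by (rule keys_add)
  then show ?thesis
    by (subst (1 2 3) lin_superset[of ?I]) (auto simp: lookup_add algebra_simps sum.distrib)
qed

lemma lookup_scaleR: "Poly_Mapping.lookup (r *\<^sub>R d) p = r *\<^sub>R Poly_Mapping.lookup d p"
  by (simp add: scaleR_poly_mapping_def)

lemma lin_scaleR: "lin \<phi> (r *\<^sub>R d) = r *\<^sub>R lin \<phi> d"
  by (subst (1 2) lin_superset[of "Poly_Mapping.keys d"])
    (auto simp: lookup_scaleR scaleR_sum_right in_keys_iff)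

lemma linear_lin: "linear (lin \<phi>)"
  by (intro linearI lin_add lin_scaleR)

lemmas lin_simps = linear_add[OF linear_lin] linear_diff[OF linear_lin] linear_neg[OF linear_lin]
  linear_sum[OF linear_lin] linear_cmul[OF linear_lin]

section \<open>Positive semidefinite matrices\<close>

definition psd_on :: "'i set \<Rightarrow> ('i \<Rightarrow> 'i \<Rightarrow> complex) \<Rightarrow> bool" where
  "psd_on I g \<longleftrightarrow> (\<forall>i\<in>I. \<forall>j\<in>I. g i j = cnj (g j i)) \<and>
    (\<forall>x. 0 \<le> Re (\<Sum>i\<in>I. \<Sum>j\<in>I. x i * cnj (x j) * g i j))"

lemma psd_on_hermitian: "psd_on I g \<Longrightarrow> i \<in> I \<Longrightarrow> j \<in> I \<Longrightarrow> g i j = cnj (g j i)"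
  unfolding psd_on_def by blast

lemma psd_on_form: "psd_on I g \<Longrightarrow> 0 \<le> Re (\<Sum>i\<in>I. \<Sum>j\<in>I. x i * cnj (x j) * g i j)"
  unfolding psd_on_def by blast

text \<open>Cholesky factorization, by induction on the index set: the matrix splits into the rank one matrix of the
column of the new index and the Schur complement, which is positive semidefinite because it is the
minimum of the quadratic form over the new coordinate.\<close>

lemma psd_on_factor:
  assumes "finite I" "psd_on I g"
  shows "\<exists>c. \<forall>i\<in>I. \<forall>j\<in>I. g i j = (\<Sum>k\<in>I. c i k * cnj (c j k))"
  using assms
proof (induction I arbitrary: g rule: finite_induct)
  case empty
  then show ?case by simp
next
  case (insert a I g)
  note fin = \<open>finite I\<close> and aI = \<open>a \<notin> I\<close>
  note herm = psd_on_hermitian[OF insert.prems]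
  define G where "G = Re (g a a)"
  define S where "S = (\<lambda>x. \<Sum>i\<in>I. x i * g i a)"
  define X where "X = (\<lambda>x. \<Sum>i\<in>I. \<Sum>j\<in>I. x i * cnj (x j) * g i j)"
  have gaa: "g a a = of_real G"
    using herm[of a a, THEN arg_cong[of _ _ Im]] by (simp add: G_def complex_eq_iff)
  have ga: "g a j = cnj (g j a)" if "j \<in> I" for j
    by (rule herm) (use that in auto)
  have form: "0 \<le> Re (X x + S x * cnj w + w * cnj (S x) + w * cnj w * of_real G)" for x w
  proof -
    let ?y = "x(a := w)"
    have y: "?y i = x i" if "i \<in> I" for i using that aI by auto
    have "0 \<le> Re (\<Sum>i\<in>insert a I. \<Sum>j\<in>insert a I. ?y i * cnj (?y j) * g i j)"
      using psd_on_form[OF insert.prems] .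
    also have "(\<Sum>i\<in>insert a I. \<Sum>j\<in>insert a I. ?y i * cnj (?y j) * g i j)
      = w * cnj w * g a a + (\<Sum>j\<in>I. w * cnj (x j) * g a j)
        + (\<Sum>i\<in>I. x i * cnj w * g i a + (\<Sum>j\<in>I. x i * cnj (x j) * g i j))"
      using fin aI y by (simp cong: sum.cong)
    also have "(\<Sum>j\<in>I. w * cnj (x j) * g a j) = w * cnj (S x)"
      unfolding S_def cnj_sum sum_distrib_left by (intro sum.cong) (simp_all add: ga)
    also have "(\<Sum>i\<in>I. x i * cnj w * g i a + (\<Sum>j\<in>I. x i * cnj (x j) * g i j)) = S x * cnj w + X x"
      unfolding S_def X_def sum.distrib sum_distrib_right by (simp add: mult_ac)
    finally show ?thesis by (simp add: gaa algebra_simps)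
  qed
  have G0: "G \<ge> 0"
    using form[of "\<lambda>_. 0" 1] by (simp add: X_def S_def)
  \<comment> \<open>The Schur complement of the entry at \<open>a\<close>; when that entry is \<open>0\<close>, division by
    zero makes \<open>g'\<close> the restriction of \<open>g\<close>.\<close>
  define g' where "g' = (\<lambda>i j. g i j - g i a * cnj (g j a) / of_real G)"
  have "psd_on I g'"
    unfolding psd_on_def
  proof (intro conjI ballI allI)
    fix i j assume "i \<in> I" "j \<in> I"
    then show "g' i j = cnj (g' j i)" using herm[of i j] by (simp add: g'_def mult.commute)
  next
    fix x
    have "(\<Sum>i\<in>I. \<Sum>j\<in>I. x i * cnj (x j) * g' i j)
       = X x - (\<Sum>i\<in>I. \<Sum>j\<in>I. (x i * g i a) * cnj (x j * g j a) / of_real G)"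
      unfolding X_def g'_def sum_subtractf[symmetric]
      by (intro sum.cong) (auto simp: algebra_simps)
    also have "(\<Sum>i\<in>I. \<Sum>j\<in>I. (x i * g i a) * cnj (x j * g j a) / of_real G)
       = S x * cnj (S x) / of_real G"
      unfolding S_def cnj_sum sum_product sum_divide_distrib ..
    finally have eq: "(\<Sum>i\<in>I. \<Sum>j\<in>I. x i * cnj (x j) * g' i j) = X x - S x * cnj (S x) / of_real G" .
    have "0 \<le> Re (X x - S x * cnj (S x) / of_real G)"
    proof (cases "G = 0")
      case True
      then show ?thesis using form[of x 0] by simp
    next
      case False
      then have "X x + S x * cnj w + w * cnj (S x) + w * cnj w * of_real G
          = X x - S x * cnj (S x) / of_real G" if "w = - S x / of_real G" for w
      proof -
        have w: "w * of_real G = - S x" "cnj w = - cnj (S x) / of_real G"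
          using that False by auto
        have "w * cnj w * of_real G = (w * of_real G) * cnj w" by (simp only: mult_ac)
        then have "w * cnj w * of_real G = - S x * cnj w" by (simp only: w(1))
        then show ?thesis using that by (simp add: mult.commute)
      qed
      from this[OF refl] show ?thesis using form[of x "- S x / of_real G"] by (simp only:)
    qed
    then show "0 \<le> Re (\<Sum>i\<in>I. \<Sum>j\<in>I. x i * cnj (x j) * g' i j)" using eq by simp
  qed
  then obtain c where c: "\<And>i j. i \<in> I \<Longrightarrow> j \<in> I \<Longrightarrow> g' i j = (\<Sum>k\<in>I. c i k * cnj (c j k))"
    using insert.IH by blast
  have null: "g i a = 0" if "i \<in> I" "G = 0" for i
  proof (rule ccontr)
    assume ne: "g i a \<noteq> 0"
    let ?x = "\<lambda>k. if k = i then 1 else 0 :: complex"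
    have S: "S ?x = g i a" unfolding S_def
      using that(1) fin by (simp add: if_distrib[of "\<lambda>v. v * _"] sum.delta cong: if_cong)
    \<comment> \<open>With vanishing diagonal entry at \<open>a\<close> the form is affine in \<open>t\<close>; this \<open>t\<close> makes it negative.\<close>
    define t where "t = (Re (X ?x) + 1) / (cmod (g i a))\<^sup>2"
    have "0 \<le> Re (X ?x) - t * (cmod (g i a))\<^sup>2 * 2"
      using form[of ?x "- of_real t * g i a"] that(2)
      unfolding cmod_power2 by (simp add: S power2_eq_square algebra_simps)
    moreover have "t * (cmod (g i a))\<^sup>2 = Re (X ?x) + 1" using ne by (simp add: t_def)
    moreover have "0 \<le> Re (X ?x)" using form[of ?x 0] by simp
    ultimately show False by linarith
  qed
  define c' where "c' = (\<lambda>i k. if k = a then (if i = a then of_real (sqrt G) else g i a / of_real (sqrt G))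
    else (if i = a then 0 else c i k))"
  have sq: "complex_of_real (sqrt G) * complex_of_real (sqrt G) = of_real G"
    using G0 by (simp flip: of_real_mult)
  have "g i j = (\<Sum>k\<in>insert a I. c' i k * cnj (c' j k))" if "i \<in> insert a I" "j \<in> insert a I" for i j
  proof -
    have sumI: "(\<Sum>k\<in>I. c' i k * cnj (c' j k)) = (if i = a \<or> j = a then 0 else g' i j)"
    proof (cases "i = a \<or> j = a")
      case True
      then show ?thesis using aI by (auto simp: c'_def intro!: sum.neutral)
    next
      case False
      then have "(\<Sum>k\<in>I. c' i k * cnj (c' j k)) = (\<Sum>k\<in>I. c i k * cnj (c j k))"
        using aI by (intro sum.cong) (auto simp: c'_def)
      then show ?thesis using False c that by auto
    qed
    have "(\<Sum>k\<in>insert a I. c' i k * cnj (c' j k))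
        = c' i a * cnj (c' j a) + (if i = a \<or> j = a then 0 else g' i j)"
      using fin aI sumI by simp
    also have "\<dots> = g i j"
    proof (cases "G = 0")
      case True
      then have "g i a = 0" "g a j = 0" "g j a = 0" if "i \<noteq> a" "j \<noteq> a"
        using that \<open>i \<in> insert a I\<close> \<open>j \<in> insert a I\<close> null herm[of a j] by auto
      then show ?thesis
        using True gaa null that herm[of a j] by (auto simp: c'_def g'_def)
    next
      case False
      then show ?thesis
        using that gaa herm[of a j] sq by (auto simp: c'_def g'_def field_simps)
    qed
    finally show ?thesis by simp
  qed
  then show ?case by blast
qed

section \<open>Hilbert spaces on a carrier\<close>

context hilbert_space_on
begin

lemma K_add: "x \<in> K \<Longrightarrow> y \<in> K \<Longrightarrow> x + y \<in> K" using subspace_K by (rule subspace_add)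
lemma K_diff: "x \<in> K \<Longrightarrow> y \<in> K \<Longrightarrow> x - y \<in> K" using subspace_K by (rule subspace_diff)
lemma K_scale: "x \<in> K \<Longrightarrow> scl a x \<in> K" using subspace_K by (rule subspace_scale)
lemma K_0: "0 \<in> K" using subspace_K by (rule subspace_0)
lemma K_sum: "(\<And>i. i \<in> I \<Longrightarrow> f i \<in> K) \<Longrightarrow> sum f I \<in> K" using subspace_K by (rule subspace_sum)

lemma ip_add_right: "x \<in> K \<Longrightarrow> y \<in> K \<Longrightarrow> z \<in> K \<Longrightarrow> ip z (x + y) = ip z x + ip z y"
  using ip_commute[of z] ip_add_left K_add by simp

lemma ip_scale_right: "x \<in> K \<Longrightarrow> y \<in> K \<Longrightarrow> ip y (scl a x) = cnj a * ip y x"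
  using ip_commute[of y] ip_scale_left K_scale by simp

lemma ip_diff_left: "x \<in> K \<Longrightarrow> y \<in> K \<Longrightarrow> z \<in> K \<Longrightarrow> ip (x - y) z = ip x z - ip y z"
  using ip_add_left[of "x - y" y z] K_diff by simp

lemma ip_diff_right: "x \<in> K \<Longrightarrow> y \<in> K \<Longrightarrow> z \<in> K \<Longrightarrow> ip z (x - y) = ip z x - ip z y"
  using ip_add_right[of "x - y" y z] K_diff by simp

lemma ip_zero_left: "z \<in> K \<Longrightarrow> ip 0 z = 0"
  using ip_add_left[of 0 0 z] K_0 by simp

lemma ip_zero_right: "z \<in> K \<Longrightarrow> ip z 0 = 0"
  using ip_add_right[of 0 0 z] K_0 by simp

lemma ip_sum_left: "(\<And>i. i \<in> I \<Longrightarrow> f i \<in> K) \<Longrightarrow> z \<in> K \<Longrightarrow> ip (sum f I) z = (\<Sum>i\<in>I. ip (f i) z)"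
  by (induction I rule: infinite_finite_induct) (auto simp: ip_zero_left ip_add_left K_sum)

lemma ip_sum_right: "(\<And>i. i \<in> I \<Longrightarrow> f i \<in> K) \<Longrightarrow> z \<in> K \<Longrightarrow> ip z (sum f I) = (\<Sum>i\<in>I. ip z (f i))"
  by (induction I rule: infinite_finite_induct) (auto simp: ip_zero_right ip_add_right K_sum)

lemma ip_lincomb:
  assumes "\<And>i. i \<in> I \<Longrightarrow> y i \<in> K"
  shows "ip (\<Sum>i\<in>I. scl (a i) (y i)) (\<Sum>i\<in>I. scl (b i) (y i))
    = (\<Sum>i\<in>I. \<Sum>j\<in>I. a i * cnj (b j) * ip (y i) (y j))"
  using assms
  by (auto simp: ip_sum_left ip_sum_right K_sum K_scale ip_scale_left ip_scale_right mult_ac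
      sum_distrib_left intro!: sum.swap)

lemma ip_self: "x \<in> K \<Longrightarrow> ip x x = of_real (Re (ip x x))"
  using ip_commute[of x x, THEN arg_cong[of _ _ Im]] by (simp add: complex_eq_iff)

lemma Cauchy_Schwarz:
  assumes x: "x \<in> K" and y: "y \<in> K"
  shows "(cmod (ip x y))\<^sup>2 \<le> Re (ip x x) * Re (ip y y)"
proof (cases "y = 0")
  case True
  then show ?thesis using x y by (simp add: ip_zero_right)
next
  case False
  define n where "n = Re (ip y y)"
  have n: "n > 0" "ip y y = of_real n"
    using False ip_ge_zero[OF y] ip_eq_zero[OF y] ip_self[OF y] unfolding n_def
    by (metis of_real_0 order_less_le) (use ip_self[OF y] in simp)
  define a where "a = ip x y / of_real n"
  have "0 \<le> Re (ip (x - scl a y) (x - scl a y))"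
    using x y by (intro ip_ge_zero K_diff K_scale)
  also have "ip (x - scl a y) (x - scl a y)
      = ip x x - cnj a * ip x y - (a * cnj (ip x y) - a * cnj a * of_real n)"
    using x y n ip_commute[of y x]
    by (simp add: ip_diff_left ip_diff_right ip_scale_left ip_scale_right K_diff K_scale algebra_simps)
  also have "\<dots> = ip x x - of_real ((cmod (ip x y))\<^sup>2 / n)"
    using n(1) by (simp add: a_def field_simps flip: complex_norm_square)
  finally show ?thesis using n(1) by (simp add: n_def field_simps)
qed

lemma gram_psd:
  assumes "\<And>i. i \<in> I \<Longrightarrow> y i \<in> K"
  shows "psd_on I (\<lambda>i j. ip (y i) (y j))"
  unfolding psd_on_def
proof (intro conjI ballI allI)
  fix x
  show "0 \<le> Re (\<Sum>i\<in>I. \<Sum>j\<in>I. x i * cnj (x j) * ip (y i) (y j))"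
    using assms by (subst ip_lincomb[symmetric]) (auto intro!: ip_ge_zero K_sum K_scale)
qed (rule ip_commute[OF assms assms])

text \<open>Amplification: the norm of a scalar matrix does not grow when it acts on vectors of a Hilbert space
instead of numbers. Only the Gram matrix of the vectors matters, and factoring it turns the claim into a
sum of instances of the scalar bound.\<close>

lemma scalar_matrix_bound_lifts:
  assumes I: "finite I" and y: "\<And>i. i \<in> I \<Longrightarrow> y i \<in> K"
    and bound: "\<And>c. (\<Sum>j\<in>J. (cmod (\<Sum>i\<in>I. a j i * c i))\<^sup>2) \<le> B * (\<Sum>i\<in>I. (cmod (c i))\<^sup>2)"
  shows "(\<Sum>j\<in>J. Re (ip (\<Sum>i\<in>I. scl (a j i) (y i)) (\<Sum>i\<in>I. scl (a j i) (y i))))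
    \<le> B * (\<Sum>i\<in>I. Re (ip (y i) (y i)))"
proof -
  have "\<exists>c. \<forall>i\<in>I. \<forall>j\<in>I. ip (y i) (y j) = (\<Sum>k\<in>I. c i k * cnj (c j k))"
    by (rule psd_on_factor[OF I gram_psd]) (rule y)
  then obtain c where c: "\<And>i j. i \<in> I \<Longrightarrow> j \<in> I \<Longrightarrow> ip (y i) (y j) = (\<Sum>k\<in>I. c i k * cnj (c j k))"
    by blast
  have "Re (ip (\<Sum>i\<in>I. scl (b i) (y i)) (\<Sum>i\<in>I. scl (b i) (y i))) = (\<Sum>k\<in>I. (cmod (\<Sum>i\<in>I. b i * c i k))\<^sup>2)" for b
  proof -
    have "ip (\<Sum>i\<in>I. scl (b i) (y i)) (\<Sum>i\<in>I. scl (b i) (y i))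
       = (\<Sum>i\<in>I. \<Sum>j\<in>I. \<Sum>k\<in>I. (b i * c i k) * cnj (b j * c j k))"
      using y by (auto simp: ip_lincomb c sum_distrib_left mult_ac intro!: sum.cong)
    also have "\<dots> = (\<Sum>i\<in>I. \<Sum>k\<in>I. \<Sum>j\<in>I. (b i * c i k) * cnj (b j * c j k))"
      by (intro sum.cong refl sum.swap)
    also have "\<dots> = (\<Sum>k\<in>I. \<Sum>i\<in>I. \<Sum>j\<in>I. (b i * c i k) * cnj (b j * c j k))"
      by (rule sum.swap)
    also have "\<dots> = (\<Sum>k\<in>I. of_real ((cmod (\<Sum>i\<in>I. b i * c i k))\<^sup>2))"
      by (simp only: complex_norm_square cnj_sum sum_product)
    finally show ?thesis by simp
  qed
  moreover have swap: "(\<Sum>k\<in>I. \<Sum>i\<in>I. (cmod (c i k))\<^sup>2) = (\<Sum>i\<in>I. \<Sum>k\<in>I. (cmod (c i k))\<^sup>2)"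
    by (rule sum.swap)
  ultimately have "(\<Sum>j\<in>J. Re (ip (\<Sum>i\<in>I. scl (a j i) (y i)) (\<Sum>i\<in>I. scl (a j i) (y i))))
     = (\<Sum>k\<in>I. \<Sum>j\<in>J. (cmod (\<Sum>i\<in>I. a j i * c i k))\<^sup>2)"
    by (simp add: sum.swap[of _ I J])
  also have "\<dots> \<le> (\<Sum>k\<in>I. B * (\<Sum>i\<in>I. (cmod (c i k))\<^sup>2))"
    by (intro sum_mono bound)
  also have "\<dots> = B * (\<Sum>i\<in>I. \<Sum>k\<in>I. (cmod (c i k))\<^sup>2)"
    unfolding swap[symmetric] by (simp add: sum_distrib_left)
  also have "(\<Sum>i\<in>I. \<Sum>k\<in>I. (cmod (c i k))\<^sup>2) = (\<Sum>i\<in>I. Re (ip (y i) (y i)))"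
    by (intro sum.cong) (auto simp: c simp flip: complex_norm_square)
  finally show ?thesis .
qed

end

section \<open>Functionals, compressions and dilations\<close>

interpretation hilbert: hilbert_space_on "scaleC :: complex \<Rightarrow> 'a::complex_hilbert_space \<Rightarrow> 'a" UNIV cinner
  by (rule hilbert_space_on_UNIV)

lemma cinner_self: "cinner x x = of_real ((norm x)\<^sup>2)"
  using hilbert.ip_self[of x] by (simp flip: inner_eq_Re_cinner add: power2_norm_eq_inner)

text \<open>Riesz representation: the representing vector maximizes \<open>g x = 2 \<psi> x - \<parallel>x\<parallel>\<^sup>2\<close>. A maximizing sequence is
Cauchy by the parallelogram law, and the first order condition at the maximum says that it represents
\<open>\<psi>\<close>.\<close>

lemma real_functional_represented:
  fixes \<psi> :: "'a::{real_inner, complete_space} \<Rightarrow> real"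
  assumes "bounded_linear \<psi>"
  shows "\<exists>y. \<forall>x. \<psi> x = inner y x"
proof -
  interpret bounded_linear \<psi> by fact
  define g where "g = (\<lambda>x. 2 * \<psi> x - inner x x)"
  obtain B where B: "\<And>x. norm (\<psi> x) \<le> norm x * B" using bounded by blast
  have gB: "g x \<le> B\<^sup>2" for x
  proof -
    have "g x \<le> 2 * (norm x * B) - (norm x)\<^sup>2"
      using B[of x] by (simp add: g_def power2_norm_eq_inner)
    also have "\<dots> = B\<^sup>2 - (norm x - B)\<^sup>2" by (simp add: power2_eq_square algebra_simps)
    finally show ?thesis by (smt (verit) zero_le_power2)
  qed
  define m where "m = (SUP x. g x)"
  have bdd: "bdd_above (range g)" using gB by (intro bdd_aboveI) auto
  have gm: "g x \<le> m" for x unfolding m_def using bdd by (intro cSUP_upper) auto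
  define r where "r = (\<lambda>k. 1 / (real k + 1))"
  have "\<exists>x. g x > m - r k" for k
    using less_cSUP_iff[OF _ bdd, of "m - r k"] by (auto simp: m_def r_def)
  then obtain X where X: "\<And>k. g (X k) > m - r k" by metis
  have par: "g x + g y = 2 * g ((1/2) *\<^sub>R (x + y)) - (norm (x - y))\<^sup>2 / 2" for x y
    by (simp add: g_def power2_norm_eq_inner inner_simps scaleR add scale inner_commute[of y x] field_simps)
  have dist: "(dist (X k) (X l))\<^sup>2 \<le> 2 * (r k + r l)" for k l
    using par[of "X k" "X l"] gm[of "(1/2) *\<^sub>R (X k + X l)"] X[of k] X[of l]
    unfolding dist_norm by (simp add: algebra_simps)
  have "Cauchy X"
  proof (rule metric_CauchyI)
    fix e :: real assume e: "e > 0"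
    obtain M :: nat where M: "real M > 4 / e\<^sup>2" using reals_Archimedean2 by blast
    have "dist (X k) (X l) < e" if "k \<ge> M" "l \<ge> M" for k l
    proof -
      have le: "r k \<le> 1 / (real M + 1)" "r l \<le> 1 / (real M + 1)"
        using that by (auto simp: r_def frac_le)
      have "(dist (X k) (X l))\<^sup>2 \<le> 4 / (real M + 1)"
        using dist[of k l] le by simp
      also have "\<dots> < e\<^sup>2" using M e by (simp add: field_simps add_pos_nonneg)
         (smt (verit) zero_less_power)
      finally show ?thesis using e power2_less_imp_less by fastforce
    qed
    then show "\<exists>M. \<forall>k\<ge>M. \<forall>l\<ge>M. dist (X k) (X l) < e" by blast
  qed
  then obtain y where y: "X \<longlonglongrightarrow> y" using Cauchy_convergent convergent_def by blast
  have "(\<lambda>k. g (X k)) \<longlonglongrightarrow> g y"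
    unfolding g_def by (intro tendsto_intros tendsto y)
  moreover have "(\<lambda>k. m - r k) \<longlonglongrightarrow> m - 0"
    unfolding r_def
    by (intro tendsto_intros) (use LIMSEQ_inverse_real_of_nat in \<open>simp add: inverse_eq_divide add.commute\<close>)
  ultimately have "m - 0 \<le> g y"
    using X by (intro LIMSEQ_le[of "\<lambda>k. m - r k" _ "\<lambda>k. g (X k)"]) (auto intro: less_imp_le)
  then have max: "g x \<le> g y" for x using gm[of x] by simp
  have "\<psi> x = inner y x" for x
  proof (rule ccontr)
    assume ne: "\<psi> x \<noteq> inner y x"
    define c where "c = \<psi> x - inner y x"
    define N where "N = inner x x"
    have N: "N \<ge> 0" by (simp add: N_def)
    define t where "t = c / (N + 1)"
    have "2 * t * c \<le> t\<^sup>2 * N"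
      using max[of "y + t *\<^sub>R x"]
      by (simp add: g_def inner_simps add scale c_def N_def inner_commute[of x y] power2_eq_square algebra_simps)
    moreover have "t\<^sup>2 * N \<le> t\<^sup>2 * (N + 1)" by (simp add: mult_left_mono)
    moreover have "t\<^sup>2 * (N + 1) = t * c" using N by (simp add: t_def power2_eq_square)
    moreover have "t * c > 0"
      using ne N by (simp add: t_def c_def flip: power2_eq_square)
    ultimately show False by simp
  qed
  then show ?thesis by blast
qed

lemma conjugate_linear_functional_represented:
  fixes \<phi> :: "'h::complex_hilbert_space \<Rightarrow> complex"
  assumes add: "\<And>x y. \<phi> (x + y) = \<phi> x + \<phi> y"
    and scale: "\<And>c x. \<phi> (c *\<^sub>C x) = cnj c * \<phi> x"
    and bound: "\<And>x. cmod (\<phi> x) \<le> B * norm x"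
  shows "\<exists>y. \<forall>x. \<phi> x = cinner y x"
proof -
  have "bounded_linear (\<lambda>x. Re (\<phi> x))"
    using abs_Re_le_cmod bound
    by (intro bounded_linear_intro[where K = B])
      (auto simp: add scale scaleR_scaleC mult.commute[of _ B] intro: order_trans)
  then obtain y where y: "\<And>x. Re (\<phi> x) = inner y x"
    using real_functional_represented by blast
  have "\<phi> x = cinner y x" for x
  proof (rule complex_eqI)
    show "Re (\<phi> x) = Re (cinner y x)" using y inner_eq_Re_cinner by metis
    have "Im (\<phi> x) = Re (\<phi> (\<i> *\<^sub>C x))" by (simp add: scale)
    also have "\<dots> = Re (cinner y (\<i> *\<^sub>C x))" using y inner_eq_Re_cinner by metis
    also have "\<dots> = Im (cinner y x)" by (simp add: hilbert.ip_scale_right)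
    finally show "Im (\<phi> x) = Im (cinner y x)" .
  qed
  then show ?thesis by blast
qed

text \<open>The orthogonal projection of \<open>x\<close> to \<open>range J\<close> is \<open>J v\<close>. It exists by the Riesz
representation theorem in \<open>'h\<close>, applied to \<open>k \<mapsto> \<langle>x, J k\<rangle>\<close>.\<close>

lemma compression_exists:
  fixes J :: "'h::complex_hilbert_space \<Rightarrow> 'k::ab_group_add"
  assumes "hilbert_space_on scl K ip" and J: "isometric_embedding scl K ip J" and x: "x \<in> K"
  shows "\<exists>v. \<forall>k. ip x (J k) = cinner v k"
proof -
  interpret hilbert_space_on scl K ip by fact
  have JK: "J k \<in> K" for k using J by (auto simp: isometric_embedding_def)
  have "cmod (ip x (J k)) \<le> sqrt (Re (ip x x)) * norm k" for k
  proof -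
    have "(cmod (ip x (J k)))\<^sup>2 \<le> (sqrt (Re (ip x x)) * norm k)\<^sup>2"
      using Cauchy_Schwarz[OF x JK[of k]] J ip_ge_zero[OF x]
      by (simp add: isometric_embedding_def cinner_self power_mult_distrib)
    then show ?thesis by (rule power2_le_imp_le) (use ip_ge_zero[OF x] in simp)
  qed
  then show ?thesis
    using J x JK by (intro conjugate_linear_functional_represented[where B = "sqrt (Re (ip x x))"])
      (auto simp: isometric_embedding_def ip_add_right ip_scale_right)
qed

lemma orthogonal_projection_eq:
  fixes J :: "'h::complex_hilbert_space \<Rightarrow> 'k::ab_group_add"
  assumes "hilbert_space_on scl K ip" and J: "isometric_embedding scl K ip J" and x: "x \<in> K"
    and v: "\<And>k. ip x (J k) = cinner v k"
  shows "orthogonal_projection ip (range J) x = J v"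
proof -
  interpret hilbert_space_on scl K ip by fact
  have JK: "J k \<in> K" for k using J by (auto simp: isometric_embedding_def)
  have JJ: "ip (J h) (J k) = cinner h k" for h k using J by (auto simp: isometric_embedding_def)
  have Jd: "J (h - k) = J h - J k" for h k
  proof -
    have "J (h - k + k) = J (h - k) + J k" using J by (simp only: isometric_embedding_def)
    then show ?thesis by simp
  qed
  show ?thesis unfolding orthogonal_projection_def
  proof (rule the_equality)
    show "J v \<in> range J \<and> (\<forall>m\<in>range J. ip (x - J v) m = 0)"
      using x JK JJ v by (auto simp: ip_diff_left)
  next
    fix y assume y: "y \<in> range J \<and> (\<forall>m\<in>range J. ip (x - y) m = 0)"
    then obtain u where u: "y = J u" by blast
    have "ip (x - J u) (J (v - u)) = 0" using y[unfolded u] by blast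
    then have "cinner (v - u) (v - u) = 0"
      using x JK JJ v by (simp add: ip_diff_left hilbert.ip_diff_left)
    then show "y = J v" using u by (simp add: cinner_self)
  qed
qed

lemma unitary_on_funpow:
  assumes "unitary_on scl K ip U" "x \<in> K"
  shows "(U ^^ n) x \<in> K"
  using assms by (induction n) (auto simp: unitary_on_def bij_betw_def)

text \<open>This removes the projections from the definition of a dilation: only the inner products
\<open>\<langle>U ^ n J h, J k\<rangle>\<close> matter.\<close>

lemma unitary_dilation_iff_moments:
  fixes J :: "'h::complex_hilbert_space \<Rightarrow> 'k::ab_group_add"
  assumes K: "hilbert_space_on scl K ip" and J: "isometric_embedding scl K ip J"
    and U: "unitary_on scl K ip U"
  shows "unitary_dilation scl K ip J U \<pi> \<longleftrightarrow>
    (\<forall>n. n \<noteq> 1 \<longrightarrow> (\<forall>h k. ip ((U ^^ n) (J h)) (J k) = cinner (blinfun_apply (\<pi> (\<lambda>z. z ^ n)) h) k))"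
proof -
  have JK: "J k \<in> K" for k using J by (auto simp: isometric_embedding_def)
  have JJ: "ip (J h) (J k) = cinner h k" for h k using J by (auto simp: isometric_embedding_def)
  have "J u = orthogonal_projection ip (range J) x \<longleftrightarrow> (\<forall>k. ip x (J k) = cinner u k)"
    if x: "x \<in> K" for x u
  proof
    assume eq: "J u = orthogonal_projection ip (range J) x"
    obtain v where v: "\<And>k. ip x (J k) = cinner v k" using compression_exists[OF K J x] by blast
    then show "\<forall>k. ip x (J k) = cinner u k"
      using orthogonal_projection_eq[OF K J x v] eq JJ by metis
  qed (use orthogonal_projection_eq[OF K J x] in simp)
  then show ?thesis
    using K J U unitary_on_funpow[OF U JK] unfolding unitary_dilation_def by simp
qed

section \<open>The Neil algebra and its representations\<close>

lemma disk_algebra_continuous_on: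
  assumes "f \<in> disk_algebra"
  shows "continuous_on (cball 0 1) f"
proof -
  obtain p where p: "uniform_limit (cball 0 1) (\<lambda>n. poly (p n)) f sequentially"
    using assms by (auto simp: disk_algebra_def)
  then show ?thesis
    by (rule uniform_limit_theorem[rotated]) (auto intro!: always_eventually continuous_intros)
qed

lemma disk_algebra_cmod_le_sup_norm:
  assumes "f \<in> disk_algebra" "z \<in> cball 0 1"
  shows "cmod (f z) \<le> sup_norm f"
  unfolding sup_norm_def
proof (rule cSUP_upper)
  have "compact ((\<lambda>z. cmod (f z)) ` cball 0 1)"
    by (intro compact_continuous_image continuous_intros disk_algebra_continuous_on assms compact_cball)
  then show "bdd_above ((\<lambda>z. cmod (f z)) ` cball 0 1)"
    by (intro bounded_imp_bdd_above compact_imp_bounded)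
qed fact

lemma sup_norm_le: "(\<And>z. z \<in> cball 0 1 \<Longrightarrow> cmod (f z) \<le> b) \<Longrightarrow> sup_norm f \<le> b"
  unfolding sup_norm_def by (rule cSUP_least) auto

lemma deriv_poly: "deriv (poly p) z = poly (pderiv p) z"
  by (intro DERIV_imp_deriv poly_DERIV)

lemma poly_in_neil_algebra:
  assumes "coeff p 1 = 0"
  shows "poly p \<in> neil_algebra"
proof -
  have "poly p \<in> disk_algebra"
    unfolding disk_algebra_def by (intro CollectI exI[of _ "\<lambda>_. p"] uniform_limit_const)
  moreover have "deriv (poly p) 0 = 0"
    using assms by (simp add: deriv_poly poly_0_coeff_0 coeff_pderiv)
  ultimately show ?thesis by (simp add: neil_algebra_def)
qed

lemma disk_algebra_holomorphic_on:
  assumes "f \<in> disk_algebra"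
  shows "f holomorphic_on ball 0 1"
proof -
  obtain p where p: "uniform_limit (cball 0 1) (\<lambda>n. poly (p n)) f sequentially"
    using assms by (auto simp: disk_algebra_def)
  show ?thesis
  proof (rule holomorphic_uniform_sequence[where f = "\<lambda>n. poly (p n)"])
    fix x :: complex assume "x \<in> ball 0 1"
    then obtain d where "d > 0" "cball x d \<subseteq> ball 0 1"
      using open_ball unfolding open_contains_cball by blast
    then show "\<exists>d. 0 < d \<and> cball x d \<subseteq> ball 0 1 \<and> uniform_limit (cball x d) (\<lambda>n. poly (p n)) f sequentially"
      using uniform_limit_on_subset[OF p] ball_subset_cball by blast
  qed (auto intro: holomorphic_intros)
qed

lemma neil_algebra_diff_poly:
  assumes f: "f \<in> neil_algebra" and q: "coeff q 1 = 0"
  shows "(\<lambda>z. f z - poly q z) \<in> neil_algebra"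
proof -
  have fd: "f \<in> disk_algebra" using f by (simp add: neil_algebra_def)
  then obtain p where p: "uniform_limit (cball 0 1) (\<lambda>n. poly (p n)) f sequentially"
    by (auto simp: disk_algebra_def)
  have "uniform_limit (cball 0 1) (\<lambda>n. poly (p n - q)) (\<lambda>z. f z - poly q z) sequentially"
    unfolding poly_diff by (intro uniform_limit_intros p)
  then have "(\<lambda>z. f z - poly q z) \<in> disk_algebra"
    unfolding disk_algebra_def by (intro CollectI exI[of _ "\<lambda>n. p n - q"])
  moreover have "f field_differentiable at 0"
    using disk_algebra_holomorphic_on[OF fd] by (auto intro: holomorphic_on_imp_differentiable_at)
  then have "deriv (\<lambda>z. f z - poly q z) 0 = deriv f 0 - deriv (poly q) 0"
    by (intro deriv_diff) (auto intro: field_differentiable_at_within poly_DERIV simp: field_differentiable_def)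
  ultimately show ?thesis
    using f poly_in_neil_algebra[OF q] by (simp add: neil_algebra_def)
qed

text \<open>Polynomials converging uniformly to \<open>f\<close> on the disk have linear coefficients converging to \<open>deriv f 0 = 0\<close>,
so the linear terms can be dropped from them.\<close>

lemma neil_algebra_approx:
  assumes f: "f \<in> neil_algebra" and e: "e > 0"
  shows "\<exists>q. coeff q 1 = 0 \<and> (\<forall>z\<in>cball 0 1. cmod (f z - poly q z) \<le> e)"
proof -
  obtain p where p: "uniform_limit (cball 0 1) (\<lambda>n. poly (p n)) f sequentially"
    using f by (auto simp: neil_algebra_def disk_algebra_def)
  have "(\<lambda>n. deriv (poly (p n)) 0) \<longlonglongrightarrow> deriv f 0"
    using uniform_limit_on_subset[OF p ball_subset_cball]
    by (rule deriv_complex_uniform_limit) (auto intro!: always_eventually holomorphic_intros)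
  then have "(\<lambda>n. coeff (p n) 1) \<longlonglongrightarrow> 0"
    using f by (simp add: neil_algebra_def deriv_poly poly_0_coeff_0 coeff_pderiv)
  then have "\<forall>\<^sub>F n in sequentially. cmod (coeff (p n) 1) < e / 2"
    using e by (auto dest: tendstoD[of _ 0 sequentially "e / 2"] simp: dist_norm)
  moreover have "\<forall>\<^sub>F n in sequentially. \<forall>z\<in>cball 0 1. dist (poly (p n) z) (f z) < e / 2"
    by (rule uniform_limitD[OF p]) (use e in simp)
  ultimately have "\<exists>n. cmod (coeff (p n) 1) < e / 2 \<and> (\<forall>z\<in>cball 0 1. dist (poly (p n) z) (f z) < e / 2)"
    by (intro eventually_happens'[OF sequentially_bot] eventually_conj)
  then obtain n where n: "cmod (coeff (p n) 1) < e / 2"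
    "\<And>z. z \<in> cball 0 1 \<Longrightarrow> dist (poly (p n) z) (f z) < e / 2" by blast
  define q where "q = p n - monom (coeff (p n) 1) 1"
  have "cmod (f z - poly q z) \<le> e" if z: "z \<in> cball 0 1" for z
  proof -
    have "f z - poly q z = (f z - poly (p n) z) + coeff (p n) 1 * z"
      by (simp add: q_def poly_monom)
    also have "cmod \<dots> \<le> cmod (f z - poly (p n) z) + cmod (coeff (p n) 1) * cmod z"
      by (metis norm_mult norm_triangle_ineq)
    also have "cmod (coeff (p n) 1) * cmod z \<le> cmod (coeff (p n) 1)"
      using z by (simp add: mult_left_le)
    finally show ?thesis using n(1) n(2)[OF z] by (simp add: dist_norm norm_minus_commute)
  qed
  then show ?thesis by (intro exI[of _ q]) (simp add: q_def)
qed

lemma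
  assumes "unital_representation \<pi>" "f \<in> neil_algebra"
  shows representation_scale: "blinfun_apply (\<pi> (\<lambda>z. c * f z)) x = c *\<^sub>C blinfun_apply (\<pi> f) x"
    and representation_add: "g \<in> neil_algebra \<Longrightarrow> \<pi> (\<lambda>z. f z + g z) = \<pi> f + \<pi> g"
proof -
  note * = assms(1)[unfolded unital_representation_def]
  show "blinfun_apply (\<pi> (\<lambda>z. c * f z)) x = c *\<^sub>C blinfun_apply (\<pi> f) x"
    using *[THEN conjunct2, THEN conjunct2, THEN conjunct2, THEN conjunct1] assms(2) by blast
  show "\<pi> (\<lambda>z. f z + g z) = \<pi> f + \<pi> g" if "g \<in> neil_algebra"
    using *[THEN conjunct2, THEN conjunct2, THEN conjunct1] assms(2) that by blast
qed

text \<open>The case \<open>m = 1\<close>, \<open>c = 0\<close> is included although \<open>z\<close> is not in the Neil algebra and \<open>\<pi> z\<close> is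
an arbitrary operator; it lets sums over all coefficients of a polynomial be written without an exception.\<close>

lemma representation_monom:
  assumes rep: "unital_representation \<pi>" and m: "m = 1 \<Longrightarrow> c = 0"
  shows "blinfun_apply (\<pi> (poly (monom c m))) x = c *\<^sub>C blinfun_apply (\<pi> (\<lambda>z. z ^ m)) x"
proof (cases "m = 1")
  case True
  have "poly (0 :: complex poly) \<in> neil_algebra" by (rule poly_in_neil_algebra) simp
  have "poly (monom c m) = (\<lambda>z. 0 * poly 0 z)" using True m by auto
  then show ?thesis
    using representation_scale[OF rep \<open>poly 0 \<in> neil_algebra\<close>, of 0] True m by simp
next
  case False
  then have "poly (monom 1 m) \<in> neil_algebra" by (intro poly_in_neil_algebra) simp
  then have "(\<lambda>z. z ^ m) \<in> neil_algebra" by (simp add: poly_monom[abs_def])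
  from representation_scale[OF rep this, of c] show ?thesis by (simp add: poly_monom[abs_def])
qed

lemma representation_poly:
  assumes rep: "unital_representation \<pi>" and p: "coeff p 1 = 0" and N: "degree p \<le> N"
  shows "blinfun_apply (\<pi> (poly p)) x = (\<Sum>d\<le>N. coeff p d *\<^sub>C blinfun_apply (\<pi> (\<lambda>z. z ^ d)) x)"
proof -
  have "blinfun_apply (\<pi> (poly (\<Sum>d\<le>k. monom (coeff p d) d))) x
      = (\<Sum>d\<le>k. coeff p d *\<^sub>C blinfun_apply (\<pi> (\<lambda>z. z ^ d)) x)" for k
  proof (induction k)
    case 0
    then show ?case using representation_monom[OF rep, of 0 "coeff p 0"] by simp
  next
    case (Suc k)
    have "poly (\<Sum>d\<le>k. monom (coeff p d) d) \<in> neil_algebra"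
      by (rule poly_in_neil_algebra) (auto simp: coeff_sum coeff_monom p[simplified] intro!: sum.neutral)
    moreover have "poly (monom (coeff p (Suc k)) (Suc k)) \<in> neil_algebra"
      by (rule poly_in_neil_algebra) (auto simp: coeff_monom p[simplified])
    ultimately have "\<pi> (poly (\<Sum>d\<le>Suc k. monom (coeff p d) d))
        = \<pi> (poly (\<Sum>d\<le>k. monom (coeff p d) d)) + \<pi> (poly (monom (coeff p (Suc k)) (Suc k)))"
      by (simp only: sum.atMost_Suc poly_add[abs_def] representation_add[OF rep])
    moreover have "Suc k = 1 \<Longrightarrow> coeff p (Suc k) = 0" using p by simp
    ultimately show ?case
      using representation_monom[OF rep, of "Suc k" "coeff p (Suc k)"] Suc.IH
      by (simp only: blinfun.add_left sum.atMost_Suc)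
  qed
  moreover have "(\<Sum>d\<le>N. monom (coeff p d) d) = p"
    using N by (intro poly_eqI) (auto simp: coeff_sum coeff_monom coeff_eq_0)
  ultimately show ?thesis by metis
qed

lemma contractive_norm_diff:
  assumes rep: "unital_representation \<pi>" and contr: "contractive \<pi>"
    and f: "f \<in> neil_algebra" and q: "coeff q 1 = 0"
    and le: "\<And>z. z \<in> cball 0 1 \<Longrightarrow> cmod (f z - poly q z) \<le> e"
  shows "norm (\<pi> f - \<pi> (poly q)) \<le> e"
proof -
  note d = neil_algebra_diff_poly[OF f q]
  have "\<pi> (\<lambda>z. (f z - poly q z) + poly q z) = \<pi> (\<lambda>z. f z - poly q z) + \<pi> (poly q)"
    by (rule representation_add[OF rep d poly_in_neil_algebra[OF q]])
  then have "\<pi> f - \<pi> (poly q) = \<pi> (\<lambda>z. f z - poly q z)" by simp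
  also have "norm \<dots> \<le> sup_norm (\<lambda>z. f z - poly q z)"
    using contr d by (simp add: contractive_def)
  also have "\<dots> \<le> e" using le by (rule sup_norm_le)
  finally show ?thesis .
qed

section \<open>Norms of operator matrices\<close>

text \<open>The second bound shows that the supremum in \<open>matrix_norm\<close> is taken over a bounded set, without which the
first one would say nothing: the supremum of an unbounded set of reals is arbitrary.\<close>

lemma matrix_norm_upper:
  fixes T :: "nat \<Rightarrow> nat \<Rightarrow> 'h::real_normed_vector \<Rightarrow> 'h"
  assumes T: "\<And>j l. j < n \<Longrightarrow> l < n \<Longrightarrow> bounded_linear (T j l)"
    and x: "L2_set (\<lambda>l. norm (x l)) {..<n} \<le> 1"
  shows "L2_set (\<lambda>j. norm (\<Sum>l<n. T j l (x l))) {..<n} \<le> matrix_norm n T"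
    and "L2_set (\<lambda>j. norm (\<Sum>l<n. T j l (x l))) {..<n} \<le> (\<Sum>j<n. \<Sum>l<n. onorm (T j l))"
proof -
  have bound: "L2_set (\<lambda>j. norm (\<Sum>l<n. T j l (x l))) {..<n} \<le> (\<Sum>j<n. \<Sum>l<n. onorm (T j l))"
    if x: "L2_set (\<lambda>l. norm (x l)) {..<n} \<le> 1" for x
  proof -
    have "L2_set (\<lambda>j. norm (\<Sum>l<n. T j l (x l))) {..<n} \<le> (\<Sum>j<n. norm (\<Sum>l<n. T j l (x l)))"
      by (intro L2_set_le_sum) auto
    also have "\<dots> \<le> (\<Sum>j<n. \<Sum>l<n. onorm (T j l))"
    proof (intro sum_mono sum_norm_le)
      fix j l assume jl: "j \<in> {..<n}" "l \<in> {..<n}"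
      then have T': "bounded_linear (T j l)" using T by auto
      have "norm (x l) \<le> 1"
        using member_le_L2_set[of "{..<n}" l "\<lambda>l. norm (x l)"] jl x by simp
      then have "onorm (T j l) * norm (x l) \<le> onorm (T j l)"
        using onorm_pos_le[OF T'] by (simp add: mult_left_le)
      then show "norm (T j l (x l)) \<le> onorm (T j l)"
        using onorm[OF T', of "x l"] by linarith
    qed
    finally show ?thesis .
  qed
  then show "L2_set (\<lambda>j. norm (\<Sum>l<n. T j l (x l))) {..<n} \<le> (\<Sum>j<n. \<Sum>l<n. onorm (T j l))"
    using x .
  show "L2_set (\<lambda>j. norm (\<Sum>l<n. T j l (x l))) {..<n} \<le> matrix_norm n T"
    unfolding matrix_norm_def
    by (rule cSUP_upper) (use x bound in \<open>auto intro!: bdd_aboveI\<close>)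
qed

lemma matrix_norm_least:
  assumes "\<And>x. L2_set (\<lambda>l. norm (x l)) {..<n} \<le> 1 \<Longrightarrow> L2_set (\<lambda>j. norm (\<Sum>l<n. T j l (x l))) {..<n} \<le> b"
  shows "matrix_norm n T \<le> b"
  unfolding matrix_norm_def
proof (rule cSUP_least)
  have "(\<lambda>_. 0) \<in> {x. L2_set (\<lambda>l. norm (x l)) {..<n} \<le> 1}" by (simp add: L2_set_0')
  then show "{x. L2_set (\<lambda>l. norm (x l)) {..<n} \<le> 1} \<noteq> {}"
    by (rule ex_in_conv[THEN iffD1, OF exI])
qed (use assms in auto)

lemma matrix_norm_bound:
  fixes T :: "nat \<Rightarrow> nat \<Rightarrow> 'h::real_normed_vector \<Rightarrow> 'h"
  assumes T: "\<And>j l. j < n \<Longrightarrow> l < n \<Longrightarrow> bounded_linear (T j l)"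
  shows "L2_set (\<lambda>j. norm (\<Sum>l<n. T j l (x l))) {..<n} \<le> matrix_norm n T * L2_set (\<lambda>l. norm (x l)) {..<n}"
proof -
  define r where "r = L2_set (\<lambda>l. norm (x l)) {..<n}"
  have r0: "r \<ge> 0" by (simp add: r_def)
  show ?thesis
  proof (cases "r = 0")
    case True
    then have "x l = 0" if "l < n" for l using that by (simp add: r_def L2_set_eq_0_iff)
    then have "(\<Sum>l<n. T j l (x l)) = 0" if "j < n" for j
      using T[OF that] by (auto intro!: sum.neutral simp: linear_simps(3))
    then show ?thesis using True by (simp add: r_def L2_set_0')
  next
    case False
    let ?x = "\<lambda>l. inverse r *\<^sub>R x l"
    have "L2_set (\<lambda>l. norm (?x l)) {..<n} = inverse r * r"
      using r0 L2_set_right_distrib[of "inverse r" "\<lambda>l. norm (x l)" "{..<n}"]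
      unfolding r_def[symmetric] by simp
    then have le: "L2_set (\<lambda>j. norm (\<Sum>l<n. T j l (?x l))) {..<n} \<le> matrix_norm n T"
      using False by (intro matrix_norm_upper(1) T) auto
    have "L2_set (\<lambda>j. norm (\<Sum>l<n. T j l (?x l))) {..<n}
        = L2_set (\<lambda>j. inverse r * norm (\<Sum>l<n. T j l (x l))) {..<n}"
    proof (rule L2_set_cong[OF refl])
      fix j assume "j \<in> {..<n}"
      then have "(\<Sum>l<n. T j l (?x l)) = inverse r *\<^sub>R (\<Sum>l<n. T j l (x l))"
        using T unfolding scaleR_sum_right by (intro sum.cong) (auto simp: linear_simps(5))
      then show "norm (\<Sum>l<n. T j l (?x l)) = inverse r * norm (\<Sum>l<n. T j l (x l))"
        using r0 by simp
    qed
    also have "\<dots> = inverse r * L2_set (\<lambda>j. norm (\<Sum>l<n. T j l (x l))) {..<n}"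
      using r0 by (simp add: L2_set_right_distrib)
    finally have "L2_set (\<lambda>j. norm (\<Sum>l<n. T j l (x l))) {..<n}
        = L2_set (\<lambda>j. norm (\<Sum>l<n. T j l (?x l))) {..<n} * r"
      using False by simp
    also have "\<dots> \<le> matrix_norm n T * r" using le r0 by (rule mult_right_mono)
    finally show ?thesis unfolding r_def .
  qed
qed

lemma scalar_matrix_norm_le:
  "matrix_norm n (\<lambda>j l w. A j l * w) \<le> (\<Sum>j<n. \<Sum>l<n. cmod (A j l))" for A :: "nat \<Rightarrow> nat \<Rightarrow> complex"
proof (rule matrix_norm_least)
  fix x :: "nat \<Rightarrow> complex" assume "L2_set (\<lambda>l. norm (x l)) {..<n} \<le> 1"
  then have "L2_set (\<lambda>j. norm (\<Sum>l<n. A j l * x l)) {..<n} \<le> (\<Sum>j<n. \<Sum>l<n. onorm (\<lambda>w. A j l * w))"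
    by (intro matrix_norm_upper(2) bounded_linear_mult_right)
  also have "\<dots> \<le> (\<Sum>j<n. \<Sum>l<n. cmod (A j l))"
    by (intro sum_mono onorm_bound) (auto simp: norm_mult)
  finally show "L2_set (\<lambda>j. norm (\<Sum>l<n. A j l * x l)) {..<n} \<le> (\<Sum>j<n. \<Sum>l<n. cmod (A j l))" .
qed

lemma matrix_norm_le_SUP:
  assumes F: "\<And>j l. j < n \<Longrightarrow> l < n \<Longrightarrow> F j l \<in> neil_algebra" and z: "z \<in> ball 0 1"
  shows "matrix_norm n (\<lambda>j l w. F j l z * w) \<le> (SUP z\<in>ball 0 1. matrix_norm n (\<lambda>j l w. F j l z * w))"
proof -
  have "matrix_norm n (\<lambda>j l w. F j l z * w) \<le> (\<Sum>j<n. \<Sum>l<n. sup_norm (F j l))" if "z \<in> ball 0 1" for z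
  proof -
    have c: "cmod (F j l z) \<le> sup_norm (F j l)" if "j < n" "l < n" for j l
    proof (rule disk_algebra_cmod_le_sup_norm)
      show "F j l \<in> disk_algebra" using F[OF that] by (simp add: neil_algebra_def)
      show "z \<in> cball 0 1" using \<open>z \<in> ball 0 1\<close> by simp
    qed
    have "(\<Sum>j<n. \<Sum>l<n. cmod (F j l z)) \<le> (\<Sum>j<n. \<Sum>l<n. sup_norm (F j l))"
      by (rule sum_mono, rule sum_mono) (simp add: c)
    then show ?thesis by (rule order_trans[OF scalar_matrix_norm_le])
  qed
  then have "bdd_above ((\<lambda>z. matrix_norm n (\<lambda>j l w. F j l z * w)) ` ball 0 1)"
    by (intro bdd_aboveI2)
  from cSUP_upper[where f = "\<lambda>z. matrix_norm n (\<lambda>j l w. F j l z * w)", OF z this]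
  show ?thesis .
qed

section \<open>Von Neumann's inequality for matrices of polynomials in a unitary\<close>

lemma poly_Parseval:
  fixes P :: "complex poly"
  assumes deg: "degree P < M"
  defines "\<omega> \<equiv> \<lambda>r. exp (2 * of_real pi * \<i> * of_nat r / of_nat M) :: complex"
  shows "(\<Sum>r<M. (cmod (poly P (\<omega> r)))\<^sup>2) = real M * (\<Sum>i<M. (cmod (coeff P i))\<^sup>2)"
proof -
  have M: "M \<ge> 1" using deg by simp
  have om1: "\<omega> r = \<omega> 1 ^ r" for r
    unfolding \<omega>_def by (subst exp_of_nat_mult[symmetric]) (simp add: mult_ac)
  have cm: "cmod (\<omega> r) = 1" for r
    using norm_exp_i_times[of "2 * pi * real r / real M"] by (simp add: \<omega>_def mult_ac)
  then have inv: "\<omega> r * cnj (\<omega> r) = 1" for r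
    by (simp add: complex_norm_square[symmetric] del: of_real_power)
  have root: "\<omega> 1 ^ M = 1"
    using complex_root_unity[of M 1] M by (simp add: \<omega>_def)
  have orth: "(\<Sum>r<M. \<omega> r ^ i * cnj (\<omega> r ^ j)) = (if i = j then of_nat M else 0)"
    if ij: "i < M" "j < M" for i j
  proof (cases "i = j")
    case True
    then show ?thesis by (simp add: inv flip: power_mult_distrib)
  next
    case False
    define q where "q = \<omega> i * cnj (\<omega> j)"
    have "q \<noteq> 1"
    proof
      assume "q = 1"
      then have "q * \<omega> j = \<omega> j" by simp
      then have "\<omega> i = \<omega> j" using inv[of j] by (simp add: q_def mult_ac)
      then show False
        using complex_root_unity_eq[OF M, of i j] ij False by (simp add: \<omega>_def)
    qed
    moreover have "q ^ M = 1"
    proof -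
      have "\<omega> k ^ M = 1" for k by (metis om1 root power_mult mult.commute power_one)
      then show ?thesis by (simp add: q_def power_mult_distrib flip: complex_cnj_power)
    qed
    moreover have "(\<Sum>r<M. \<omega> r ^ i * cnj (\<omega> r ^ j)) = (\<Sum>r<M. q ^ r)"
    proof (intro sum.cong refl)
      fix r
      have "\<omega> r ^ k = \<omega> k ^ r" for k by (metis om1 power_mult mult.commute)
      then show "\<omega> r ^ i * cnj (\<omega> r ^ j) = q ^ r" by (simp add: q_def power_mult_distrib)
    qed
    ultimately show ?thesis using False by (simp add: geometric_sum)
  qed
  have P: "poly P z = (\<Sum>i<M. coeff P i * z ^ i)" for z
    unfolding poly_altdef using deg
    by (intro sum.mono_neutral_left) (auto simp: coeff_eq_0)
  have "complex_of_real (\<Sum>r<M. (cmod (poly P (\<omega> r)))\<^sup>2)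
      = (\<Sum>r<M. \<Sum>i<M. \<Sum>j<M. (coeff P i * cnj (coeff P j)) * (\<omega> r ^ i * cnj (\<omega> r ^ j)))"
    unfolding of_real_sum complex_norm_square P cnj_sum sum_product
    by (intro sum.cong refl) (simp add: mult_ac)
  also have "\<dots> = (\<Sum>i<M. \<Sum>r<M. \<Sum>j<M. (coeff P i * cnj (coeff P j)) * (\<omega> r ^ i * cnj (\<omega> r ^ j)))"
    by (rule sum.swap)
  also have "\<dots> = (\<Sum>i<M. \<Sum>j<M. \<Sum>r<M. (coeff P i * cnj (coeff P j)) * (\<omega> r ^ i * cnj (\<omega> r ^ j)))"
    by (intro sum.cong refl sum.swap)
  also have "\<dots> = (\<Sum>i<M. \<Sum>j<M. (coeff P i * cnj (coeff P j)) * (if i = j then of_nat M else 0))"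
    by (intro sum.cong refl) (simp add: sum_distrib_left[symmetric] orth del: complex_cnj_power)
  also have "\<dots> = (\<Sum>i<M. (coeff P i * cnj (coeff P i)) * of_nat M)"
    by (intro sum.cong refl) (simp add: if_distrib[of "\<lambda>v. _ * v"] sum.delta' cong: if_cong)
  also have "\<dots> = complex_of_real (real M * (\<Sum>i<M. (cmod (coeff P i))\<^sup>2))"
    unfolding of_real_mult of_real_sum complex_norm_square by (simp add: sum_distrib_left mult.commute)
  finally show ?thesis by (simp only: of_real_eq_iff)
qed

text \<open>Read \<open>c (l, k)\<close> as the coefficients of a polynomial \<open>g l\<close>. Then the block Toeplitz matrix computes
coefficients of \<open>\<Sum>l. F j l * g l\<close>, and Parseval's identity on sufficiently many roots of unity translates the
pointwise bound for \<open>F\<close> on the circle into a bound for coefficients.\<close>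

lemma scalar_Toeplitz_bound:
  fixes F :: "nat \<Rightarrow> nat \<Rightarrow> complex poly" and c :: "nat \<times> nat \<Rightarrow> complex"
  assumes deg: "\<And>j l. j < n \<Longrightarrow> l < n \<Longrightarrow> degree (F j l) \<le> D"
    and bound: "\<And>z c. cmod z = 1 \<Longrightarrow>
      (\<Sum>j<n. (cmod (\<Sum>l<n. poly (F j l) z * c l))\<^sup>2) \<le> B * (\<Sum>l<n. (cmod (c l))\<^sup>2)"
  shows "(\<Sum>(j, p)\<in>{..<n} \<times> {D..N}. (cmod (\<Sum>(l, k)\<in>{..<n} \<times> {..N}.
        (if k \<le> p then coeff (F j l) (p - k) else 0) * c (l, k)))\<^sup>2)
    \<le> B * (\<Sum>i\<in>{..<n} \<times> {..N}. (cmod (c i))\<^sup>2)"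
proof -
  \<comment> \<open>More roots of unity than the degree of any \<open>P j\<close>, as Parseval requires.\<close>
  define M where "M = Suc (N + D)"
  define \<omega> where "\<omega> = (\<lambda>r. exp (2 * of_real pi * \<i> * of_nat r / of_nat M) :: complex)"
  have cm: "cmod (\<omega> r) = 1" for r
    using norm_exp_i_times[of "2 * pi * real r / real M"] by (simp add: \<omega>_def mult_ac)
  define g where "g = (\<lambda>l. \<Sum>k\<le>N. monom (c (l, k)) k)"
  have cg: "coeff (g l) k = (if k \<le> N then c (l, k) else 0)" for l k
    by (simp add: g_def coeff_sum coeff_monom)
  have dg: "degree (g l) \<le> N" for l
    by (rule degree_le) (simp add: cg)
  define P where "P = (\<lambda>j. \<Sum>l<n. g l * F j l)"
  have dP: "degree (P j) < M" if "j < n" for j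
  proof -
    have "degree (P j) \<le> N + D"
      unfolding P_def
    proof (rule degree_sum_le)
      fix l assume "l \<in> {..<n}"
      then show "degree (g l * F j l) \<le> N + D"
        using degree_mult_le[of "g l" "F j l"] dg[of l] deg[OF that, of l] by simp
    qed simp
    then show ?thesis by (simp add: M_def)
  qed
  have cP: "(\<Sum>(l, k)\<in>{..<n} \<times> {..N}. (if k \<le> p then coeff (F j l) (p - k) else 0) * c (l, k))
      = coeff (P j) p" if "p \<le> N" for j p
  proof -
    have "(\<Sum>k\<le>N. (if k \<le> p then coeff (F j l) (p - k) else 0) * c (l, k))
        = (\<Sum>k\<le>p. coeff (g l) k * coeff (F j l) (p - k))" for l
      using that by (intro sum.mono_neutral_cong_right) (auto simp: cg)
    then show ?thesis
      unfolding P_def coeff_sum coeff_mult by (simp flip: sum.cartesian_product)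
  qed
  have "(\<Sum>(j, p)\<in>{..<n} \<times> {D..N}. (cmod (\<Sum>(l, k)\<in>{..<n} \<times> {..N}.
        (if k \<le> p then coeff (F j l) (p - k) else 0) * c (l, k)))\<^sup>2)
      = (\<Sum>j<n. \<Sum>p\<in>{D..N}. (cmod (coeff (P j) p))\<^sup>2)"
    unfolding sum.cartesian_product by (intro sum.cong) (auto simp: cP)
  also have "\<dots> \<le> (\<Sum>j<n. \<Sum>p<M. (cmod (coeff (P j) p))\<^sup>2)"
    by (intro sum_mono sum_mono2) (auto simp: M_def)
  finally have 1: "(\<Sum>(j, p)\<in>{..<n} \<times> {D..N}. (cmod (\<Sum>(l, k)\<in>{..<n} \<times> {..N}.
        (if k \<le> p then coeff (F j l) (p - k) else 0) * c (l, k)))\<^sup>2)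
      \<le> (\<Sum>j<n. \<Sum>p<M. (cmod (coeff (P j) p))\<^sup>2)" .
  have "real M * (\<Sum>j<n. \<Sum>p<M. (cmod (coeff (P j) p))\<^sup>2) = (\<Sum>j<n. \<Sum>r<M. (cmod (poly (P j) (\<omega> r)))\<^sup>2)"
    unfolding sum_distrib_left[of _ _ "{..<n}"] \<omega>_def
    by (intro sum.cong refl poly_Parseval[symmetric] dP) auto
  also have "\<dots> = (\<Sum>r<M. \<Sum>j<n. (cmod (poly (P j) (\<omega> r)))\<^sup>2)"
    by (rule sum.swap)
  also have "\<dots> \<le> (\<Sum>r<M. B * (\<Sum>l<n. (cmod (poly (g l) (\<omega> r)))\<^sup>2))"
  proof (rule sum_mono)
    fix r
    show "(\<Sum>j<n. (cmod (poly (P j) (\<omega> r)))\<^sup>2) \<le> B * (\<Sum>l<n. (cmod (poly (g l) (\<omega> r)))\<^sup>2)"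
      using bound[OF cm[of r], of "\<lambda>l. poly (g l) (\<omega> r)"]
      by (simp add: P_def poly_sum mult.commute)
  qed
  also have "\<dots> = B * (\<Sum>r<M. \<Sum>l<n. (cmod (poly (g l) (\<omega> r)))\<^sup>2)"
    by (simp add: sum_distrib_left)
  also have "(\<Sum>r<M. \<Sum>l<n. (cmod (poly (g l) (\<omega> r)))\<^sup>2) = (\<Sum>l<n. \<Sum>r<M. (cmod (poly (g l) (\<omega> r)))\<^sup>2)"
    by (rule sum.swap)
  also have "\<dots> = (\<Sum>l<n. real M * (\<Sum>k<M. (cmod (coeff (g l) k))\<^sup>2))"
    unfolding \<omega>_def using dg
    by (intro sum.cong refl poly_Parseval) (auto simp: M_def less_Suc_eq_le intro: trans_le_add1)
  also have "\<dots> = real M * (\<Sum>l<n. \<Sum>k\<le>N. (cmod (c (l, k)))\<^sup>2)"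
  proof -
    have "(\<Sum>k<M. (cmod (coeff (g l) k))\<^sup>2) = (\<Sum>k\<le>N. (cmod (c (l, k)))\<^sup>2)" for l
      by (intro sum.mono_neutral_cong_right) (auto simp: cg M_def)
    then show ?thesis by (simp add: sum_distrib_left)
  qed
  finally have "real M * (\<Sum>j<n. \<Sum>p<M. (cmod (coeff (P j) p))\<^sup>2)
      \<le> real M * (B * (\<Sum>l<n. \<Sum>k\<le>N. (cmod (c (l, k)))\<^sup>2))"
    by (simp add: mult_ac)
  moreover have "real M > 0" by (simp add: M_def)
  ultimately have "(\<Sum>j<n. \<Sum>p<M. (cmod (coeff (P j) p))\<^sup>2)
      \<le> B * (\<Sum>l<n. \<Sum>k\<le>N. (cmod (c (l, k)))\<^sup>2)"
    by (simp only: mult_le_cancel_left_pos)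
  with 1 show ?thesis by (simp add: sum.cartesian_product)
qed

context hilbert_space_on
begin

lemma unitary_on_lincomb:
  assumes U: "unitary_on scl K ip U" and y: "\<And>i. i \<in> I \<Longrightarrow> y i \<in> K"
  shows "U (\<Sum>i\<in>I. scl (a i) (y i)) = (\<Sum>i\<in>I. scl (a i) (U (y i)))"
proof -
  have add: "U (x + y) = U x + U y" if "x \<in> K" "y \<in> K" for x y
    using U that by (simp add: unitary_on_def)
  have scale: "U (scl c x) = scl c (U x)" if "x \<in> K" for c x
    using U that by (simp add: unitary_on_def)
  have "U 0 = 0" using scale[OF K_0, of 0] by simp
  then show ?thesis using y
    by (induction I rule: infinite_finite_induct) (auto simp: add scale K_sum K_scale)
qed

lemma unitary_on_comp:
  assumes "unitary_on scl K ip U" "unitary_on scl K ip V"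
  shows "unitary_on scl K ip (U \<circ> V)"
  using assms bij_betw_trans[of V K K U K]
  by (auto simp: unitary_on_def bij_betw_apply)

lemma unitary_on_power:
  assumes "unitary_on scl K ip U"
  shows "unitary_on scl K ip (U ^^ m)"
proof (induction m)
  case 0
  then show ?case using bij_betw_id[of K] by (auto simp: unitary_on_def id_def)
next
  case (Suc m)
  then show ?case using unitary_on_comp[OF assms Suc.IH] by (simp only: funpow.simps)
qed

text \<open>The Toeplitz section acts on the vectors \<open>U ^ (N - k) x l\<close> with \<open>k \<le> N\<close>. In each block row
\<open>p \<in> {D..N}\<close> the result is \<open>U ^ (N - p) w j\<close>, which has the norm of \<open>w j\<close>. With \<open>N = D + t\<close> there
are \<open>t + 1\<close> such rows against \<open>D + t + 1\<close> columns, and the quotient of these numbers tends to \<open>1\<close>.\<close>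

lemma unitary_matrix_von_Neumann:
  fixes F :: "nat \<Rightarrow> nat \<Rightarrow> complex poly"
  assumes U: "unitary_on scl K ip U" and x: "\<And>l. l < n \<Longrightarrow> x l \<in> K"
    and deg: "\<And>j l. j < n \<Longrightarrow> l < n \<Longrightarrow> degree (F j l) \<le> D"
    and bound: "\<And>z c. cmod z = 1 \<Longrightarrow>
      (\<Sum>j<n. (cmod (\<Sum>l<n. poly (F j l) z * c l))\<^sup>2) \<le> B * (\<Sum>l<n. (cmod (c l))\<^sup>2)"
  defines "w \<equiv> \<lambda>j. \<Sum>l<n. \<Sum>i\<le>D. scl (coeff (F j l) i) ((U ^^ i) (x l))"
  shows "(\<Sum>j<n. Re (ip (w j) (w j))) \<le> B * (\<Sum>l<n. Re (ip (x l) (x l)))"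
proof -
  define X where "X = (\<Sum>l<n. Re (ip (x l) (x l)))"
  define W where "W = (\<Sum>j<n. Re (ip (w j) (w j)))"
  have UK: "(U ^^ m) y \<in> K" if "y \<in> K" for m y
    using unitary_on_power[OF U, of m] that by (auto simp: unitary_on_def bij_betw_def)
  have isom: "ip ((U ^^ m) y) ((U ^^ m) y) = ip y y" if "y \<in> K" for m y
    using unitary_on_power[OF U, of m] that by (auto simp: unitary_on_def)
  have w_pairs: "w j = (\<Sum>(l, i)\<in>{..<n} \<times> {..D}. scl (coeff (F j l) i) ((U ^^ i) (x l)))" for j
    by (simp add: w_def sum.cartesian_product)
  have wK: "w j \<in> K" for j
    unfolding w_def by (intro K_sum K_scale UK x) auto
  \<comment> \<open>The inequality for the segment of length \<open>N = D + t\<close>.\<close>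
  have step: "real (Suc t) * W \<le> B * (real (Suc (D + t)) * X)" for t
  proof -
    define N where "N = D + t"
    define y where "y = (\<lambda>(l, k). (U ^^ (N - k)) (x l))"
    have yK: "y i \<in> K" if "i \<in> {..<n} \<times> {..N}" for i
      using that UK x by (auto simp: y_def)
    define a where "a = (\<lambda>(j, p) (l, k). if k \<le> p then coeff (F j l) (p - k) else 0 :: complex)"
    have lin: "(\<Sum>i\<in>{..<n} \<times> {..N}. scl (a (j, p) i) (y i)) = (U ^^ (N - p)) (w j)"
      if j: "j < n" and p: "p \<in> {D..N}" for j p
    proof -
      have inner: "(\<Sum>k\<le>N. scl (a (j, p) (l, k)) (y (l, k)))
          = (\<Sum>i\<le>D. scl (coeff (F j l) i) ((U ^^ (N - p)) ((U ^^ i) (x l))))" if l: "l < n" for l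
      proof -
        have "(\<Sum>k\<le>N. scl (a (j, p) (l, k)) (y (l, k)))
            = (\<Sum>k\<le>p. scl (coeff (F j l) (p - k)) ((U ^^ (N - k)) (x l)))"
          using p by (intro sum.mono_neutral_cong_right) (auto simp: a_def y_def)
        also have "\<dots> = (\<Sum>i\<le>p. scl (coeff (F j l) i) ((U ^^ (N - p)) ((U ^^ i) (x l))))"
        proof (rule sum.reindex_bij_witness[of _ "\<lambda>i. p - i" "\<lambda>i. p - i"])
          fix k assume k: "k \<in> {..p}"
          have "N - p + (p - k) = N - k" using k p by auto
          then show "scl (coeff (F j l) (p - k)) ((U ^^ (N - p)) ((U ^^ (p - k)) (x l)))
              = scl (coeff (F j l) (p - k)) ((U ^^ (N - k)) (x l))"
            by (metis comp_apply funpow_add)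
        qed auto
        also have "\<dots> = (\<Sum>i\<le>D. scl (coeff (F j l) i) ((U ^^ (N - p)) ((U ^^ i) (x l))))"
        proof (rule sum.mono_neutral_right)
          show "\<forall>i\<in>{..p} - {..D}. scl (coeff (F j l) i) ((U ^^ (N - p)) ((U ^^ i) (x l))) = 0"
            using deg[OF j l] by (auto simp: coeff_eq_0)
        qed (use p in auto)
        finally show ?thesis .
      qed
      have "(\<Sum>i\<in>{..<n} \<times> {..N}. scl (a (j, p) i) (y i))
          = (\<Sum>l<n. \<Sum>k\<le>N. scl (a (j, p) (l, k)) (y (l, k)))"
        by (simp add: sum.cartesian_product case_prod_unfold)
      also have "\<dots> = (\<Sum>l<n. \<Sum>i\<le>D. scl (coeff (F j l) i) ((U ^^ (N - p)) ((U ^^ i) (x l))))"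
        by (intro sum.cong refl inner) auto
      also have "\<dots> = (\<Sum>li\<in>{..<n} \<times> {..D}. scl (coeff (F j (fst li)) (snd li))
          ((U ^^ (N - p)) ((U ^^ snd li) (x (fst li)))))"
        by (simp add: sum.cartesian_product case_prod_unfold)
      also have "\<dots> = (U ^^ (N - p)) (\<Sum>li\<in>{..<n} \<times> {..D}. scl (coeff (F j (fst li)) (snd li))
          ((U ^^ snd li) (x (fst li))))"
        by (rule unitary_on_lincomb[OF unitary_on_power[OF U], symmetric])
          (use x in \<open>auto intro!: UK\<close>)
      finally show ?thesis by (simp add: w_pairs case_prod_unfold)
    qed
    have "(\<Sum>jp\<in>{..<n} \<times> {D..N}. Re (ip (\<Sum>i\<in>{..<n} \<times> {..N}. scl (a jp i) (y i))
          (\<Sum>i\<in>{..<n} \<times> {..N}. scl (a jp i) (y i))))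
        \<le> B * (\<Sum>i\<in>{..<n} \<times> {..N}. Re (ip (y i) (y i)))"
    proof (rule scalar_matrix_bound_lifts)
      fix c :: "nat \<times> nat \<Rightarrow> complex"
      show "(\<Sum>jp\<in>{..<n} \<times> {D..N}. (cmod (\<Sum>i\<in>{..<n} \<times> {..N}. a jp i * c i))\<^sup>2)
          \<le> B * (\<Sum>i\<in>{..<n} \<times> {..N}. (cmod (c i))\<^sup>2)"
        using scalar_Toeplitz_bound[OF deg bound, of c N]
        by (simp add: a_def case_prod_unfold)
    qed (use yK in auto)
    moreover have "(\<Sum>jp\<in>{..<n} \<times> {D..N}. Re (ip (\<Sum>i\<in>{..<n} \<times> {..N}. scl (a jp i) (y i))
          (\<Sum>i\<in>{..<n} \<times> {..N}. scl (a jp i) (y i)))) = (\<Sum>jp\<in>{..<n} \<times> {D..N}. Re (ip (w (fst jp)) (w (fst jp))))"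
    proof (rule sum.cong[OF refl])
      fix jp assume "jp \<in> {..<n} \<times> {D..N}"
      then obtain j p where jp: "jp = (j, p)" "j < n" "p \<in> {D..N}" by auto
      show "Re (ip (\<Sum>i\<in>{..<n} \<times> {..N}. scl (a jp i) (y i)) (\<Sum>i\<in>{..<n} \<times> {..N}. scl (a jp i) (y i)))
          = Re (ip (w (fst jp)) (w (fst jp)))"
        unfolding jp(1) lin[OF jp(2,3)] by (simp add: isom[OF wK])
    qed
    moreover have "(\<Sum>jp\<in>{..<n} \<times> {D..N}. Re (ip (w (fst jp)) (w (fst jp)))) = real (Suc t) * W"
      unfolding W_def N_def
      by (subst sum.cartesian_product') (simp add: sum_distrib_left del: of_nat_Suc)
    moreover have "(\<Sum>i\<in>{..<n} \<times> {..N}. Re (ip (y i) (y i))) = (\<Sum>i\<in>{..<n} \<times> {..N}. Re (ip (x (fst i)) (x (fst i))))"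
      using x by (intro sum.cong) (auto simp: y_def isom)
    moreover have "(\<Sum>i\<in>{..<n} \<times> {..N}. Re (ip (x (fst i)) (x (fst i)))) = real (Suc (D + t)) * X"
      unfolding X_def N_def
      by (subst sum.cartesian_product') (simp add: sum_distrib_left del: of_nat_Suc)
    ultimately show ?thesis by simp
  qed
  have "W \<le> B * X"
  proof (rule ccontr)
    assume "\<not> W \<le> B * X"
    then have pos: "W - B * X > 0" by simp
    obtain t :: nat where t: "real D * (B * X) < real t * (W - B * X)"
      using reals_Archimedean3[OF pos] by blast
    have "real t * (W - B * X) + (W - B * X) \<le> real D * (B * X)"
      using step[of t] by (simp add: algebra_simps)
    then show False using t pos by linarith
  qed
  then show ?thesis by (simp add: W_def X_def)
qed

end

section \<open>Representations with a unitary dilation are completely contractive\<close>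

lemma dilation_poly_matrix_bound:
  fixes F :: "nat \<Rightarrow> nat \<Rightarrow> complex poly" and x :: "nat \<Rightarrow> 'h::complex_hilbert_space"
  assumes rep: "unital_representation \<pi>" and dil: "unitary_dilation scl K ip J U \<pi>"
    and F1: "\<And>j l. j < n \<Longrightarrow> l < n \<Longrightarrow> coeff (F j l) 1 = 0"
    and bound: "\<And>z c. cmod z = 1 \<Longrightarrow>
      (\<Sum>j<n. (cmod (\<Sum>l<n. poly (F j l) z * c l))\<^sup>2) \<le> B * (\<Sum>l<n. (cmod (c l))\<^sup>2)"
  shows "(\<Sum>j<n. (norm (\<Sum>l<n. blinfun_apply (\<pi> (poly (F j l))) (x l)))\<^sup>2) \<le> B * (\<Sum>l<n. (norm (x l))\<^sup>2)"
proof -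
  have K: "hilbert_space_on scl K ip" and J: "isometric_embedding scl K ip J"
    and U: "unitary_on scl K ip U"
    using dil by (auto simp: unitary_dilation_def)
  interpret hilbert_space_on scl K ip by (rule K)
  have JK: "J h \<in> K" for h using J by (auto simp: isometric_embedding_def)
  have JJ: "ip (J h) (J k) = cinner h k" for h k using J by (auto simp: isometric_embedding_def)
  have UJK: "(U ^^ i) (J h) \<in> K" for i h by (rule unitary_on_funpow[OF U JK])
  have moments: "ip ((U ^^ i) (J h)) (J k) = cinner (blinfun_apply (\<pi> (\<lambda>z. z ^ i)) h) k"
    if "i \<noteq> 1" for i h k
    using dil that unfolding unitary_dilation_iff_moments[OF K J U] by blast
  define D where "D = (\<Sum>j<n. \<Sum>l<n. degree (F j l))"
  have deg: "degree (F j l) \<le> D" if "j < n" "l < n" for j l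
  proof -
    have "degree (F j l) \<le> (\<Sum>l<n. degree (F j l))"
      using that by (intro member_le_sum) auto
    also have "\<dots> \<le> D"
      unfolding D_def using that by (intro member_le_sum[where f = "\<lambda>j. \<Sum>l<n. degree (F j l)"]) auto
    finally show ?thesis .
  qed
  define v where "v = (\<lambda>j. \<Sum>l<n. blinfun_apply (\<pi> (poly (F j l))) (x l))"
  define w where "w = (\<lambda>j. \<Sum>l<n. \<Sum>i\<le>D. scl (coeff (F j l) i) ((U ^^ i) (J (x l))))"
  have wK: "w j \<in> K" for j
    unfolding w_def by (intro K_sum K_scale UJK)
  have wJ: "ip (w j) (J k) = cinner (v j) k" if j: "j < n" for j k
  proof -
    have "ip (w j) (J k) = (\<Sum>l<n. \<Sum>i\<le>D. coeff (F j l) i * ip ((U ^^ i) (J (x l))) (J k))"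
      unfolding w_def by (simp add: ip_sum_left ip_scale_left K_sum K_scale UJK JK)
    also have "\<dots> = (\<Sum>l<n. \<Sum>i\<le>D. coeff (F j l) i * cinner (blinfun_apply (\<pi> (\<lambda>z. z ^ i)) (x l)) k)"
      using F1[OF j] moments by (intro sum.cong refl) (metis lessThan_iff mult_zero_left)
    also have "\<dots> = (\<Sum>l<n. cinner (blinfun_apply (\<pi> (poly (F j l))) (x l)) k)"
      using representation_poly[OF rep F1[OF j] deg[OF j]]
      by (intro sum.cong refl) (simp add: hilbert.ip_sum_left hilbert.ip_scale_left)
    finally show ?thesis by (simp add: v_def hilbert.ip_sum_left)
  qed
  have "(norm (v j))\<^sup>2 \<le> Re (ip (w j) (w j))" if j: "j < n" for j
  proof -
    have "((norm (v j))\<^sup>2)\<^sup>2 \<le> Re (ip (w j) (w j)) * (norm (v j))\<^sup>2"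
      using Cauchy_Schwarz[OF wK JK, of j "v j"] unfolding wJ[OF j] JJ cinner_self by (simp add: norm_power)
    then have "(norm (v j))\<^sup>2 * (norm (v j))\<^sup>2 \<le> Re (ip (w j) (w j)) * (norm (v j))\<^sup>2"
      by (simp only: power2_eq_square)
    then have "v j \<noteq> 0 \<Longrightarrow> ?thesis" by (simp only: mult_le_cancel_right) simp
    then show ?thesis using ip_ge_zero[OF wK, of j] by (cases "v j = 0") auto
  qed
  then have "(\<Sum>j<n. (norm (v j))\<^sup>2) \<le> (\<Sum>j<n. Re (ip (w j) (w j)))"
    by (intro sum_mono) auto
  also have "\<dots> \<le> B * (\<Sum>l<n. Re (ip (J (x l)) (J (x l))))"
    unfolding w_def by (rule unitary_matrix_von_Neumann[OF U JK deg bound])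
  finally show ?thesis by (simp add: v_def JJ cinner_self)
qed

lemma L2_set_norm_add:
  "L2_set (\<lambda>j. norm (a j + b j)) A \<le> L2_set (\<lambda>j. norm (a j)) A + L2_set (\<lambda>j. norm (b j)) A"
  by (rule order_trans[OF L2_set_mono L2_set_triangle_ineq]) (auto intro: norm_triangle_ineq)

lemma L2_set_norm_squared: "(L2_set (\<lambda>j. norm (a j)) A)\<^sup>2 = (\<Sum>j\<in>A. (norm (a j))\<^sup>2)"
  by (simp add: L2_set_def sum_nonneg)

lemma L2_set_small_matrix:
  assumes e: "e \<ge> 0" and T: "\<And>j l. j < n \<Longrightarrow> l < n \<Longrightarrow> norm (T j l (x l)) \<le> e * norm (x l)"
  shows "L2_set (\<lambda>j. norm (\<Sum>l<n. T j l (x l))) {..<n} \<le> (real n)\<^sup>2 * e * L2_set (\<lambda>l. norm (x l)) {..<n}"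
proof -
  define r where "r = L2_set (\<lambda>l. norm (x l)) {..<n}"
  have "L2_set (\<lambda>j. norm (\<Sum>l<n. T j l (x l))) {..<n} \<le> (\<Sum>j<n. norm (\<Sum>l<n. T j l (x l)))"
    by (intro L2_set_le_sum) auto
  also have "\<dots> \<le> (\<Sum>j<n. \<Sum>l<n. e * r)"
  proof (intro sum_mono sum_norm_le)
    fix j l assume jl: "j \<in> {..<n}" "l \<in> {..<n}"
    have "norm (x l) \<le> r"
      unfolding r_def using jl by (intro member_le_L2_set[where f = "\<lambda>l. norm (x l)"]) auto
    then show "norm (T j l (x l)) \<le> e * r"
      using T[of j l] jl e by (meson lessThan_iff mult_left_mono order_trans)
  qed
  also have "\<dots> = (real n)\<^sup>2 * e * r" by (simp add: power2_eq_square)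
  finally show ?thesis by (simp add: r_def)
qed

text \<open>The supremum over the open disk also controls the circle, by continuity; the circle is where
von Neumann's inequality uses it.\<close>

lemma matrix_bound_cball:
  assumes F: "\<And>j l. j < n \<Longrightarrow> l < n \<Longrightarrow> F j l \<in> neil_algebra" and z: "z \<in> cball 0 1"
  shows "L2_set (\<lambda>j. cmod (\<Sum>l<n. F j l z * c l)) {..<n}
    \<le> (SUP z\<in>ball 0 1. matrix_norm n (\<lambda>j l w. F j l z * w)) * L2_set (\<lambda>l. cmod (c l)) {..<n}"
proof (rule continuous_le_on_closure[where f = "\<lambda>z. L2_set (\<lambda>j. cmod (\<Sum>l<n. F j l z * c l)) {..<n}"])
  have "continuous_on (cball 0 1) (F j l)" if "j < n" "l < n" for j l
    using disk_algebra_continuous_on F[OF that] by (simp add: neil_algebra_def)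
  then show "continuous_on (closure (ball 0 1)) (\<lambda>z. L2_set (\<lambda>j. cmod (\<Sum>l<n. F j l z * c l)) {..<n})"
    unfolding L2_set_def by (auto intro!: continuous_intros)
  show "z \<in> closure (ball 0 1)" using z by simp
  fix z :: complex assume z: "z \<in> ball 0 1"
  have "L2_set (\<lambda>j. cmod (\<Sum>l<n. F j l z * c l)) {..<n}
      \<le> matrix_norm n (\<lambda>j l w. F j l z * w) * L2_set (\<lambda>l. cmod (c l)) {..<n}"
    by (intro matrix_norm_bound bounded_linear_mult_right)
  also have "\<dots> \<le> (SUP z\<in>ball 0 1. matrix_norm n (\<lambda>j l w. F j l z * w)) * L2_set (\<lambda>l. cmod (c l)) {..<n}"
    by (intro mult_right_mono matrix_norm_le_SUP F z) auto
  finally show "L2_set (\<lambda>j. cmod (\<Sum>l<n. F j l z * c l)) {..<n}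
      \<le> (SUP z\<in>ball 0 1. matrix_norm n (\<lambda>j l w. F j l z * w)) * L2_set (\<lambda>l. cmod (c l)) {..<n}" .
qed

lemma dilation_imp_completely_contractive:
  fixes \<pi> :: "(complex \<Rightarrow> complex) \<Rightarrow> ('h::complex_hilbert_space \<Rightarrow>\<^sub>L 'h)"
  assumes rep: "unital_representation \<pi>" and contr: "contractive \<pi>"
    and dil: "unitary_dilation scl K ip J U \<pi>"
  shows "completely_contractive \<pi>"
  unfolding completely_contractive_def
proof (intro allI impI)
  fix n and F :: "nat \<Rightarrow> nat \<Rightarrow> complex \<Rightarrow> complex"
  assume "\<forall>j<n. \<forall>l<n. F j l \<in> neil_algebra"
  then have F: "\<And>j l. j < n \<Longrightarrow> l < n \<Longrightarrow> F j l \<in> neil_algebra" by blast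
  define S where "S = (SUP z\<in>ball 0 1. matrix_norm n (\<lambda>j l w. F j l z * w))"
  have "0 \<le> matrix_norm n (\<lambda>j l w. F j l 0 * w)"
    using matrix_norm_upper(1)[of n "\<lambda>j l w. F j l 0 * w" "\<lambda>_. 0"]
    by (simp add: bounded_linear_mult_right L2_set_0')
  also have "\<dots> \<le> S" unfolding S_def by (rule matrix_norm_le_SUP[OF F]) auto
  finally have S0: "S \<ge> 0" .
  show "matrix_norm n (\<lambda>j l. blinfun_apply (\<pi> (F j l))) \<le> S"
  proof (rule matrix_norm_least)
    fix x :: "nat \<Rightarrow> 'h" assume x: "L2_set (\<lambda>l. norm (x l)) {..<n} \<le> 1"
    have approx: "L2_set (\<lambda>j. norm (\<Sum>l<n. blinfun_apply (\<pi> (F j l)) (x l))) {..<n} \<le> S + 2 * (real n)\<^sup>2 * e"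
      if e: "e > 0" for e
    proof -
      define E where "E = S + (real n)\<^sup>2 * e"
      have E0: "E \<ge> 0" using S0 e by (simp add: E_def)
      have "\<exists>q. \<forall>j<n. \<forall>l<n. coeff (q j l) 1 = 0 \<and> (\<forall>z\<in>cball 0 1. cmod (F j l z - poly (q j l) z) \<le> e)"
        using neil_algebra_approx[OF F e] by metis
      then obtain q where q1: "\<And>j l. j < n \<Longrightarrow> l < n \<Longrightarrow> coeff (q j l) 1 = 0"
        and qe: "\<And>j l z. j < n \<Longrightarrow> l < n \<Longrightarrow> z \<in> cball 0 1 \<Longrightarrow> cmod (F j l z - poly (q j l) z) \<le> e"
        by blast
      have scalar: "L2_set (\<lambda>j. cmod (\<Sum>l<n. poly (q j l) z * c l)) {..<n} \<le> E * L2_set (\<lambda>l. cmod (c l)) {..<n}"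
        if z: "z \<in> cball 0 1" for z c
      proof -
        have "L2_set (\<lambda>j. cmod (\<Sum>l<n. poly (q j l) z * c l)) {..<n}
            = L2_set (\<lambda>j. cmod ((\<Sum>l<n. F j l z * c l) + (\<Sum>l<n. (poly (q j l) z - F j l z) * c l))) {..<n}"
          by (simp add: algebra_simps flip: sum.distrib)
        also have "\<dots> \<le> L2_set (\<lambda>j. cmod (\<Sum>l<n. F j l z * c l)) {..<n}
            + L2_set (\<lambda>j. cmod (\<Sum>l<n. (poly (q j l) z - F j l z) * c l)) {..<n}"
          by (rule L2_set_norm_add)
        also have "\<dots> \<le> S * L2_set (\<lambda>l. cmod (c l)) {..<n} + (real n)\<^sup>2 * e * L2_set (\<lambda>l. cmod (c l)) {..<n}"
          unfolding S_def using e qe z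
          by (intro add_mono matrix_bound_cball F L2_set_small_matrix[where T = "\<lambda>j l w. (poly (q j l) z - F j l z) * w"])
            (auto simp: norm_mult norm_minus_commute intro!: mult_right_mono)
        finally show ?thesis by (simp add: E_def algebra_simps)
      qed
      have "(\<Sum>j<n. (norm (\<Sum>l<n. blinfun_apply (\<pi> (poly (q j l))) (x l)))\<^sup>2) \<le> E\<^sup>2 * (\<Sum>l<n. (norm (x l))\<^sup>2)"
      proof (rule dilation_poly_matrix_bound[OF rep dil q1])
        fix z :: complex and c :: "nat \<Rightarrow> complex" assume "cmod z = 1"
        then have "(L2_set (\<lambda>j. cmod (\<Sum>l<n. poly (q j l) z * c l)) {..<n})\<^sup>2
            \<le> (E * L2_set (\<lambda>l. cmod (c l)) {..<n})\<^sup>2"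
          by (intro power_mono scalar) auto
        then show "(\<Sum>j<n. (cmod (\<Sum>l<n. poly (q j l) z * c l))\<^sup>2) \<le> E\<^sup>2 * (\<Sum>l<n. (cmod (c l))\<^sup>2)"
          unfolding power_mult_distrib L2_set_norm_squared .
      qed
      then have "(L2_set (\<lambda>j. norm (\<Sum>l<n. blinfun_apply (\<pi> (poly (q j l))) (x l))) {..<n})\<^sup>2
          \<le> (E * L2_set (\<lambda>l. norm (x l)) {..<n})\<^sup>2"
        unfolding power_mult_distrib L2_set_norm_squared .
      then have "L2_set (\<lambda>j. norm (\<Sum>l<n. blinfun_apply (\<pi> (poly (q j l))) (x l))) {..<n}
          \<le> E * L2_set (\<lambda>l. norm (x l)) {..<n}"
        by (rule power2_le_imp_le) (simp add: E0)
      also have "\<dots> \<le> E" using x E0 by (simp add: mult_left_le)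
      finally have 1: "L2_set (\<lambda>j. norm (\<Sum>l<n. blinfun_apply (\<pi> (poly (q j l))) (x l))) {..<n} \<le> E" .
      have "norm (blinfun_apply (\<pi> (F j l) - \<pi> (poly (q j l))) (x l)) \<le> e * norm (x l)"
        if "j < n" "l < n" for j l
      proof -
        have "norm (blinfun_apply (\<pi> (F j l) - \<pi> (poly (q j l))) (x l))
            \<le> norm (\<pi> (F j l) - \<pi> (poly (q j l))) * norm (x l)" by (rule norm_blinfun)
        also have "\<dots> \<le> e * norm (x l)"
          using that by (intro mult_right_mono contractive_norm_diff[OF rep contr F q1 qe]) auto
        finally show ?thesis .
      qed
      then have "L2_set (\<lambda>j. norm (\<Sum>l<n. blinfun_apply (\<pi> (F j l) - \<pi> (poly (q j l))) (x l))) {..<n}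
          \<le> (real n)\<^sup>2 * e * L2_set (\<lambda>l. norm (x l)) {..<n}"
        using e by (intro L2_set_small_matrix[where T = "\<lambda>j l. blinfun_apply (\<pi> (F j l) - \<pi> (poly (q j l)))"]) auto
      also have "\<dots> \<le> (real n)\<^sup>2 * e" using x e by (simp add: mult_left_le)
      finally have 2: "L2_set (\<lambda>j. norm (\<Sum>l<n. blinfun_apply (\<pi> (F j l) - \<pi> (poly (q j l))) (x l))) {..<n}
          \<le> (real n)\<^sup>2 * e" .
      have "L2_set (\<lambda>j. norm (\<Sum>l<n. blinfun_apply (\<pi> (F j l)) (x l))) {..<n}
          = L2_set (\<lambda>j. norm ((\<Sum>l<n. blinfun_apply (\<pi> (poly (q j l))) (x l))
              + (\<Sum>l<n. blinfun_apply (\<pi> (F j l) - \<pi> (poly (q j l))) (x l)))) {..<n}"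
        by (simp add: blinfun.diff_left flip: sum.distrib)
      also have "\<dots> \<le> E + (real n)\<^sup>2 * e"
        by (rule order_trans[OF L2_set_norm_add add_mono[OF 1 2]])
      finally show ?thesis unfolding E_def by (simp add: algebra_simps)
    qed
    show "L2_set (\<lambda>j. norm (\<Sum>l<n. blinfun_apply (\<pi> (F j l)) (x l))) {..<n} \<le> S"
    proof (rule field_le_epsilon)
      fix \<epsilon> :: real assume \<epsilon>: "\<epsilon> > 0"
      \<comment> \<open>The error of the approximation is \<open>2 n\<^sup>2 e\<close>; the \<open>1\<close> keeps the denominator positive for \<open>n = 0\<close>.\<close>
      define e where "e = \<epsilon> / (2 * (real n)\<^sup>2 + 1)"
      have e: "e > 0" "e * (2 * (real n)\<^sup>2 + 1) = \<epsilon>"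
        using \<epsilon> by (auto simp: e_def add_nonneg_pos add_nonneg_eq_0_iff intro!: divide_pos_pos)
      then have "2 * (real n)\<^sup>2 * e \<le> \<epsilon>" by (simp add: algebra_simps)
      then show "L2_set (\<lambda>j. norm (\<Sum>l<n. blinfun_apply (\<pi> (F j l)) (x l))) {..<n} \<le> S + \<epsilon>"
        using approx[OF e(1)] by linarith
    qed
  qed
qed

section \<open>Completely contractive representations preserve nonnegative real parts\<close>

text \<open>If \<open>Re P \<ge> 0\<close> on the disk, then \<open>\<parallel>1 - t P\<parallel>\<^sup>2 \<le> 1 + t\<^sup>2 M\<close> for all \<open>t > 0\<close>, because the first order term in
\<open>t\<close> has the good sign. Complete contractivity gives the same bound for \<open>1 - t \<pi> (P)\<close>, and comparing
first order terms as \<open>t \<rightarrow> 0\<close> gives \<open>Re \<pi> (P) \<ge> 0\<close>. The matrix \<open>F l j\<close> in the proof is \<open>1 - t P\<close> with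
its indices transposed.\<close>

lemma completely_contractive_accretive:
  fixes \<pi> :: "(complex \<Rightarrow> complex) \<Rightarrow> ('h::complex_hilbert_space \<Rightarrow>\<^sub>L 'h)" and p :: "nat \<Rightarrow> nat \<Rightarrow> complex poly"
  assumes rep: "unital_representation \<pi>" and cc: "completely_contractive \<pi>"
    and p1: "\<And>j l. j < n \<Longrightarrow> l < n \<Longrightarrow> coeff (p j l) 1 = 0"
    and pos: "\<And>z c. z \<in> ball 0 1 \<Longrightarrow> 0 \<le> Re (\<Sum>j<n. \<Sum>l<n. poly (p j l) z * (c j * cnj (c l)))"
  shows "0 \<le> Re (\<Sum>j<n. \<Sum>l<n. cinner (blinfun_apply (\<pi> (poly (p j l))) (h j)) (h l))"
proof -
  define b where "b = (\<Sum>j<n. \<Sum>l<n. sup_norm (poly (p j l)))"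
  have neil: "poly (p j l) \<in> neil_algebra" if "j < n" "l < n" for j l
    by (rule poly_in_neil_algebra[OF p1[OF that]])
  then have disk: "poly (p j l) \<in> disk_algebra" if "j < n" "l < n" for j l
    using that by (simp add: neil_algebra_def)
  have sup0: "0 \<le> sup_norm (poly (p j l))" if "j < n" "l < n" for j l
    using disk_algebra_cmod_le_sup_norm[OF disk[OF that], of 0] by (meson centre_in_cball norm_ge_zero order_trans zero_le_one)
  have pb: "cmod (poly (p j l) z) \<le> b" if jl: "j < n" "l < n" and z: "z \<in> ball 0 1" for j l z
  proof -
    have "cmod (poly (p j l) z) \<le> sup_norm (poly (p j l))"
      by (rule disk_algebra_cmod_le_sup_norm[OF disk[OF jl]]) (use z in simp)
    also have "\<dots> \<le> (\<Sum>l<n. sup_norm (poly (p j l)))"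
      using jl sup0 by (intro member_le_sum[where f = "\<lambda>l. sup_norm (poly (p j l))"]) auto
    also have "\<dots> \<le> b"
      unfolding b_def using jl sup0
      by (intro member_le_sum[where f = "\<lambda>j. \<Sum>l<n. sup_norm (poly (p j l))"] sum_nonneg) auto
    finally show ?thesis .
  qed
  have b0: "0 \<le> b" unfolding b_def using sup0 by (intro sum_nonneg) auto
  define M where "M = ((real n)\<^sup>2 * b)\<^sup>2"
  define g where "g = (\<lambda>l. \<Sum>j<n. blinfun_apply (\<pi> (poly (p j l))) (h j))"
  define X where "X = (\<Sum>l<n. (norm (h l))\<^sup>2)"
  define Q where "Q = (\<Sum>l<n. inner (g l) (h l))"
  \<comment> \<open>The comparison of first order terms, before letting \<open>t\<close> tend to \<open>0\<close>.\<close>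
  have step: "- 2 * t * Q \<le> t\<^sup>2 * M * X" if t: "t > 0" for t
  proof -
    define F where "F = (\<lambda>l j. [:of_bool (l = j):] + smult (- of_real t) (p j l))"
    have F1: "coeff (F l j) 1 = 0" if "l < n" "j < n" for l j
      using p1[OF that(2,1)] by (simp add: F_def)
    have piF: "blinfun_apply (\<pi> (poly (F l j))) x = of_bool (l = j) *\<^sub>C x - t *\<^sub>R blinfun_apply (\<pi> (poly (p j l))) x"
      if "l < n" "j < n" for l j x
    proof -
      have "\<pi> (poly (F l j)) = \<pi> (poly (monom (of_bool (l = j)) 0)) + \<pi> (\<lambda>z. - of_real t * poly (p j l) z)"
      proof -
        have F: "poly (F l j) = (\<lambda>z. poly (monom (of_bool (l = j)) 0) z + poly (smult (- of_real t) (p j l)) z)"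
          by (auto simp: F_def monom_0)
        have s: "poly (smult (- of_real t) (p j l)) = (\<lambda>z. - of_real t * poly (p j l) z)"
          by auto
        have "poly (monom (of_bool (l = j)) 0) \<in> neil_algebra"
          "poly (smult (- of_real t) (p j l)) \<in> neil_algebra"
          using p1[OF that(2,1)] by (auto intro!: poly_in_neil_algebra simp: coeff_monom)
        from representation_add[OF rep this] show ?thesis unfolding F s .
      qed
      moreover have "\<pi> (\<lambda>z. z ^ 0) = id_blinfun"
        using rep unfolding unital_representation_def power_0 by blast
      ultimately show ?thesis
        using representation_monom[OF rep, of 0 "of_bool (l = j)" x]
          representation_scale[OF rep neil[OF that(2,1)], of "- of_real t" x]
        by (simp add: blinfun.add_left hilbert.scale_minus_left scaleR_scaleC)
    qed
    have "(SUP z\<in>ball 0 1. matrix_norm n (\<lambda>j l w. poly (F j l) z * w)) \<le> sqrt (1 + t\<^sup>2 * M)"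
    proof (rule cSUP_least[where f = "\<lambda>z. matrix_norm n (\<lambda>j l w. poly (F j l) z * w)"])
      fix z :: complex assume z: "z \<in> ball 0 1"
      show "matrix_norm n (\<lambda>j l w. poly (F j l) z * w) \<le> sqrt (1 + t\<^sup>2 * M)"
      proof (rule matrix_norm_least)
        fix c :: "nat \<Rightarrow> complex" assume c: "L2_set (\<lambda>l. norm (c l)) {..<n} \<le> 1"
        define d where "d = (\<lambda>l. \<Sum>j<n. poly (p j l) z * c j)"
        have Fd: "(\<Sum>j<n. poly (F l j) z * c j) = c l - of_real t * d l" if "l < n" for l
          using that
          by (simp add: F_def d_def algebra_simps sum.distrib sum_subtractf sum_distrib_left of_bool_def
              if_distrib[of "\<lambda>v. _ * v"] sum.delta cong: if_cong)
        have "L2_set (\<lambda>l. cmod (d l)) {..<n} \<le> (real n)\<^sup>2 * b * L2_set (\<lambda>l. cmod (c l)) {..<n}"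
          unfolding d_def using pb z b0
          by (intro L2_set_small_matrix[where T = "\<lambda>l j w. poly (p j l) z * w"]) (auto simp: norm_mult intro!: mult_right_mono)
        also have "\<dots> \<le> (real n)\<^sup>2 * b" using c b0 by (simp add: mult_left_le)
        finally have "(L2_set (\<lambda>l. cmod (d l)) {..<n})\<^sup>2 \<le> M"
          unfolding M_def by (intro power_mono) auto
        then have dM: "(\<Sum>l<n. (cmod (d l))\<^sup>2) \<le> M" unfolding L2_set_norm_squared .
        have "(L2_set (\<lambda>l. cmod (c l)) {..<n})\<^sup>2 \<le> 1" using c by (simp add: power_le_one)
        then have c1: "(\<Sum>l<n. (cmod (c l))\<^sup>2) \<le> 1" unfolding L2_set_norm_squared .
        have "0 \<le> Re (\<Sum>l<n. \<Sum>j<n. poly (p j l) z * (c j * cnj (c l)))"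
          using pos[OF z, of c] by (subst sum.swap)
        also have "(\<Sum>l<n. \<Sum>j<n. poly (p j l) z * (c j * cnj (c l))) = (\<Sum>l<n. d l * cnj (c l))"
          by (simp add: d_def sum_distrib_right mult.assoc)
        finally have dc: "0 \<le> (\<Sum>l<n. inner (d l) (c l))" by (simp add: inner_complex_def)
        have "(\<Sum>l<n. (cmod (\<Sum>j<n. poly (F l j) z * c j))\<^sup>2)
            = (\<Sum>l<n. (cmod (c l))\<^sup>2 - 2 * t * inner (d l) (c l) + t\<^sup>2 * (cmod (d l))\<^sup>2)"
        proof (intro sum.cong refl)
          fix l assume "l \<in> {..<n}"
          then have "l < n" by simp
          show "(cmod (\<Sum>j<n. poly (F l j) z * c j))\<^sup>2
              = (cmod (c l))\<^sup>2 - 2 * t * inner (d l) (c l) + t\<^sup>2 * (cmod (d l))\<^sup>2"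
            unfolding Fd[OF \<open>l < n\<close>] cmod_power2
            by (simp add: inner_complex_def power2_eq_square algebra_simps)
        qed
        also have "\<dots> = (\<Sum>l<n. (cmod (c l))\<^sup>2) - 2 * t * (\<Sum>l<n. inner (d l) (c l)) + t\<^sup>2 * (\<Sum>l<n. (cmod (d l))\<^sup>2)"
          by (simp add: sum.distrib sum_subtractf sum_distrib_left)
        also have "\<dots> \<le> 1 - 0 + t\<^sup>2 * M"
          using c1 dM dc t by (intro add_mono diff_mono mult_left_mono) auto
        finally have "(L2_set (\<lambda>l. cmod (\<Sum>j<n. poly (F l j) z * c j)) {..<n})\<^sup>2 \<le> 1 + t\<^sup>2 * M"
          unfolding L2_set_norm_squared by simp
        then show "L2_set (\<lambda>l. cmod (\<Sum>j<n. poly (F l j) z * c j)) {..<n} \<le> sqrt (1 + t\<^sup>2 * M)"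
          by (simp add: real_le_rsqrt)
      qed
    qed simp
    moreover have "matrix_norm n (\<lambda>j l. blinfun_apply (\<pi> (poly (F j l))))
        \<le> (SUP z\<in>ball 0 1. matrix_norm n (\<lambda>j l w. poly (F j l) z * w))"
    proof -
      have "\<forall>j<n. \<forall>l<n. poly (F j l) \<in> neil_algebra"
        using F1 by (auto intro: poly_in_neil_algebra)
      then show ?thesis
        using cc[unfolded completely_contractive_def, THEN spec, of n, THEN spec, of "\<lambda>j l. poly (F j l)"] by blast
    qed
    ultimately have "matrix_norm n (\<lambda>j l. blinfun_apply (\<pi> (poly (F j l)))) \<le> sqrt (1 + t\<^sup>2 * M)" by linarith
    moreover have "L2_set (\<lambda>l. norm (\<Sum>j<n. blinfun_apply (\<pi> (poly (F l j))) (h j))) {..<n}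
        \<le> matrix_norm n (\<lambda>j l. blinfun_apply (\<pi> (poly (F j l)))) * L2_set (\<lambda>l. norm (h l)) {..<n}"
      by (intro matrix_norm_bound blinfun.bounded_linear_right)
    ultimately have "L2_set (\<lambda>l. norm (\<Sum>j<n. blinfun_apply (\<pi> (poly (F l j))) (h j))) {..<n}
        \<le> sqrt (1 + t\<^sup>2 * M) * L2_set (\<lambda>l. norm (h l)) {..<n}"
      by (meson L2_set_nonneg mult_right_mono order_trans)
    then have "(L2_set (\<lambda>l. norm (\<Sum>j<n. blinfun_apply (\<pi> (poly (F l j))) (h j))) {..<n})\<^sup>2
        \<le> (sqrt (1 + t\<^sup>2 * M) * L2_set (\<lambda>l. norm (h l)) {..<n})\<^sup>2"
      by (intro power_mono) auto
    moreover have "(sqrt (1 + t\<^sup>2 * M))\<^sup>2 = 1 + t\<^sup>2 * M" by (simp add: M_def)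
    ultimately have le: "(\<Sum>l<n. (norm (\<Sum>j<n. blinfun_apply (\<pi> (poly (F l j))) (h j)))\<^sup>2) \<le> (1 + t\<^sup>2 * M) * X"
      unfolding power_mult_distrib L2_set_norm_squared X_def by simp
    have "(\<Sum>l<n. (norm (h l))\<^sup>2 - 2 * t * inner (g l) (h l))
        \<le> (\<Sum>l<n. (norm (\<Sum>j<n. blinfun_apply (\<pi> (poly (F l j))) (h j)))\<^sup>2)"
    proof (rule sum_mono)
      fix l assume l: "l \<in> {..<n}"
      have "(\<Sum>j<n. of_bool (l = j) *\<^sub>C h j) = (\<Sum>j<n. if j = l then h j else 0)"
        by (intro sum.cong) auto
      then have "(\<Sum>j<n. blinfun_apply (\<pi> (poly (F l j))) (h j)) = h l - t *\<^sub>R g l"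
        using l by (simp add: piF g_def sum_subtractf scaleR_sum_right sum.delta)
      moreover have "(norm (h l - t *\<^sub>R g l))\<^sup>2 = (norm (h l))\<^sup>2 - 2 * t * inner (g l) (h l) + t\<^sup>2 * (norm (g l))\<^sup>2"
        unfolding power2_norm_eq_inner
        by (simp add: inner_simps inner_commute[of "h l" "g l"] power2_eq_square algebra_simps)
      ultimately show "(norm (h l))\<^sup>2 - 2 * t * inner (g l) (h l)
          \<le> (norm (\<Sum>j<n. blinfun_apply (\<pi> (poly (F l j))) (h j)))\<^sup>2" by simp
    qed
    moreover have "(\<Sum>l<n. (norm (h l))\<^sup>2 - 2 * t * inner (g l) (h l)) = X - 2 * t * Q"
      by (simp add: X_def Q_def sum_subtractf sum_distrib_left)
    ultimately show ?thesis using le by (simp add: algebra_simps)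
  qed
  have "Q \<ge> 0"
  proof (rule ccontr)
    assume "\<not> Q \<ge> 0"
    then have Q: "Q < 0" by simp
    have MX: "M * X \<ge> 0" by (simp add: M_def X_def sum_nonneg)
    define t where "t = - Q / (M * X + 1)"
    have t: "t > 0" using Q MX by (simp add: t_def field_simps)
    have "t * (- 2 * Q) \<le> t * (t * (M * X))"
      using step[OF t] by (simp add: power2_eq_square algebra_simps)
    then have "- 2 * Q \<le> t * (M * X)" by (rule mult_left_le_imp_le) (rule t)
    also have "\<dots> \<le> t * (M * X + 1)" using t by simp
    also have "\<dots> = - Q" using MX by (simp add: t_def)
    finally show False using Q by simp
  qed
  moreover have "(\<Sum>j<n. \<Sum>l<n. cinner (blinfun_apply (\<pi> (poly (p j l))) (h j)) (h l))
      = (\<Sum>l<n. cinner (g l) (h l))"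
    by (subst sum.swap) (simp add: g_def hilbert.ip_sum_left)
  ultimately show ?thesis by (simp add: Q_def inner_eq_Re_cinner)
qed

section \<open>The Szego kernel of a point of the disk\<close>

definition Szego :: "complex \<Rightarrow> int \<Rightarrow> int \<Rightarrow> complex" where
  "Szego z i j = (if j \<le> i then z ^ nat (i - j) else cnj z ^ nat (j - i))"

text \<open>An explicit Gram representation: with \<open>w = \<bar>z\<bar>\<^sup>2\<close> and \<open>j \<le> i\<close> the right-hand side is
\<open>z ^ (i - j) * (w ^ j + (1 - w) * (1 + w + \<dots> + w ^ (j - 1)))\<close>, which telescopes.\<close>

lemma Szego_Gram:
  fixes z :: complex and i j N :: nat
  assumes "i \<le> N" "j \<le> N"
  defines "u \<equiv> \<lambda>l i. if l \<le> i then z ^ (i - l) else 0 :: complex"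
  shows "Szego z (int i) (int j)
    = u 0 i * cnj (u 0 j) + (1 - z * cnj z) * (\<Sum>l\<in>{1..N}. u l i * cnj (u l j))"
proof -
  have le: "z ^ (i - j) = u 0 i * cnj (u 0 j) + (1 - z * cnj z) * (\<Sum>l\<in>{1..N}. u l i * cnj (u l j))"
    if ij: "j \<le> i" "i \<le> N" for i j
  proof -
    have "(\<Sum>l\<in>{1..N}. u l i * cnj (u l j)) = (\<Sum>k<j. z ^ (i - j) * (z * cnj z) ^ k)"
    proof -
      have "(\<Sum>l\<in>{1..N}. u l i * cnj (u l j)) = (\<Sum>l\<in>{1..j}. z ^ (i - j) * (z * cnj z) ^ (j - l))"
      proof (rule sum.mono_neutral_cong_right)
        fix l assume l: "l \<in> {1..j}"
        have "z ^ (i - l) = z ^ (i - j) * z ^ (j - l)" using l ij by (simp flip: power_add)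
        then show "u l i * cnj (u l j) = z ^ (i - j) * (z * cnj z) ^ (j - l)"
          using l ij by (simp add: u_def power_mult_distrib)
      qed (use ij in \<open>auto simp: u_def\<close>)
      also have "\<dots> = (\<Sum>k<j. z ^ (i - j) * (z * cnj z) ^ k)"
        by (rule sum.reindex_bij_witness[of _ "\<lambda>k. j - k" "\<lambda>l. j - l"]) auto
      finally show ?thesis .
    qed
    then have "(1 - z * cnj z) * (\<Sum>l\<in>{1..N}. u l i * cnj (u l j))
        = z ^ (i - j) * ((1 - z * cnj z) * (\<Sum>k<j. (z * cnj z) ^ k))"
      by (simp only: sum_distrib_left[symmetric] mult.left_commute)
    also have "\<dots> = z ^ (i - j) * (1 - (z * cnj z) ^ j)" by (simp only: one_diff_power_eq)
    also have "\<dots> = z ^ (i - j) - z ^ i * cnj z ^ j"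
      using ij by (simp add: power_mult_distrib right_diff_distrib flip: power_add mult.assoc)
    finally show ?thesis by (simp add: u_def)
  qed
  show ?thesis
  proof (cases "j \<le> i")
    case True
    then show ?thesis using le[of j i] assms(1) by (simp add: Szego_def nat_diff_distrib)
  next
    case False
    then have "cnj (Szego z (int i) (int j)) = z ^ (j - i)" by (simp add: Szego_def nat_diff_distrib)
    also have "\<dots> = cnj (u 0 i * cnj (u 0 j) + (1 - z * cnj z) * (\<Sum>l\<in>{1..N}. u l i * cnj (u l j)))"
      using False assms(2) by (subst le) (auto simp: mult.commute)
    finally show ?thesis by (simp only: complex_cnj_cancel_iff)
  qed
qed

lemma Szego_positive:
  assumes I: "finite I" and z: "cmod z \<le> 1"
  shows "0 \<le> Re (\<Sum>p\<in>I. \<Sum>q\<in>I. c p * cnj (c q) * Szego z (d p) (d q))"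
proof (cases "I = {}")
  case False
  \<comment> \<open>The kernel only depends on differences, so the indices can be shifted to become natural numbers.\<close>
  define L where "L = Min (d ` I)"
  define e where "e = (\<lambda>p. nat (d p - L))"
  have de: "d p = int (e p) + L" if "p \<in> I" for p
    using that I by (simp add: e_def L_def)
  define N where "N = Max (e ` I)"
  have eN: "e p \<le> N" if "p \<in> I" for p using that I by (simp add: N_def)
  define u where "u = (\<lambda>l i. if l \<le> i then z ^ (i - l) else 0 :: complex)"
  define S where "S = (\<lambda>l. \<Sum>p\<in>I. c p * u l (e p))"
  have gram: "(\<Sum>p\<in>I. \<Sum>q\<in>I. c p * cnj (c q) * (u l (e p) * cnj (u l (e q)))) = S l * cnj (S l)" for l
    unfolding S_def cnj_sum sum_product by (intro sum.cong refl) (simp add: mult_ac)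
  have "(\<Sum>p\<in>I. \<Sum>q\<in>I. c p * cnj (c q) * Szego z (d p) (d q))
     = (\<Sum>p\<in>I. \<Sum>q\<in>I. c p * cnj (c q) * (u 0 (e p) * cnj (u 0 (e q)))
         + (1 - z * cnj z) * (\<Sum>l\<in>{1..N}. c p * cnj (c q) * (u l (e p) * cnj (u l (e q)))))"
  proof (intro sum.cong refl)
    fix p q assume pq: "p \<in> I" "q \<in> I"
    have "Szego z (d p) (d q) = Szego z (int (e p)) (int (e q))"
      using pq by (simp add: de Szego_def)
    also have "\<dots> = u 0 (e p) * cnj (u 0 (e q)) + (1 - z * cnj z) * (\<Sum>l\<in>{1..N}. u l (e p) * cnj (u l (e q)))"
      unfolding u_def by (rule Szego_Gram[OF eN[OF pq(1)] eN[OF pq(2)]])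
    finally show "c p * cnj (c q) * Szego z (d p) (d q) = c p * cnj (c q) * (u 0 (e p) * cnj (u 0 (e q)))
         + (1 - z * cnj z) * (\<Sum>l\<in>{1..N}. c p * cnj (c q) * (u l (e p) * cnj (u l (e q))))"
      by (simp add: distrib_left sum_distrib_left mult_ac)
  qed
  also have "\<dots> = S 0 * cnj (S 0)
      + (1 - z * cnj z) * (\<Sum>p\<in>I. \<Sum>q\<in>I. \<Sum>l\<in>{1..N}. c p * cnj (c q) * (u l (e p) * cnj (u l (e q))))"
    by (simp only: sum.distrib gram sum_distrib_left)
  also have "(\<Sum>p\<in>I. \<Sum>q\<in>I. \<Sum>l\<in>{1..N}. c p * cnj (c q) * (u l (e p) * cnj (u l (e q))))
      = (\<Sum>p\<in>I. \<Sum>l\<in>{1..N}. \<Sum>q\<in>I. c p * cnj (c q) * (u l (e p) * cnj (u l (e q))))"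
    by (intro sum.cong refl sum.swap)
  also have "\<dots> = (\<Sum>l\<in>{1..N}. S l * cnj (S l))"
    unfolding gram[symmetric] by (rule sum.swap)
  also have "S 0 * cnj (S 0) + (1 - z * cnj z) * (\<Sum>l\<in>{1..N}. S l * cnj (S l))
      = of_real ((cmod (S 0))\<^sup>2 + (1 - (cmod z)\<^sup>2) * (\<Sum>l\<in>{1..N}. (cmod (S l))\<^sup>2))"
    by (simp only: complex_norm_square of_real_add of_real_mult of_real_sum of_real_diff of_real_1)
  finally have eq: "(\<Sum>p\<in>I. \<Sum>q\<in>I. c p * cnj (c q) * Szego z (d p) (d q))
      = of_real ((cmod (S 0))\<^sup>2 + (1 - (cmod z)\<^sup>2) * (\<Sum>l\<in>{1..N}. (cmod (S l))\<^sup>2))" .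
  have "(cmod z)\<^sup>2 \<le> 1" using z by (simp add: power_le_one)
  then show ?thesis unfolding eq Re_complex_of_real
    by (intro add_nonneg_nonneg mult_nonneg_nonneg sum_nonneg) auto
qed simp

section \<open>Completing the moments to a positive Toeplitz kernel\<close>

text \<open>The formal sum of terms \<open>c z ^ m (a \<otimes> b)\<close> is seen as a family, indexed by \<open>z\<close>, of sesquilinear forms in
the values \<open>\<xi> a\<close>. The function \<open>\<xi>\<close> need not be linear, so distinct vectors count as independent.\<close>

definition symbol :: "(nat \<times> 'h \<times> 'h \<Rightarrow>\<^sub>0 complex) \<Rightarrow> complex \<Rightarrow> ('h \<Rightarrow> complex) \<Rightarrow> complex" where
  "symbol v z \<xi> = lin (\<lambda>(m, a, b). z ^ m * (\<xi> a * cnj (\<xi> b))) v"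

definition positive_symbols :: "(nat \<times> 'h \<times> 'h \<Rightarrow>\<^sub>0 complex) set" where
  "positive_symbols = {v. \<forall>z\<in>ball 0 1. \<forall>\<xi>. 0 \<le> Re (symbol v z \<xi>)}"

definition Neil_symbols :: "(nat \<times> 'h \<times> 'h \<Rightarrow>\<^sub>0 complex) set" where
  "Neil_symbols = {v. \<forall>a b. Poly_Mapping.lookup v (1, a, b) = 0}"

definition moment_functional ::
    "((complex \<Rightarrow> complex) \<Rightarrow> ('h::complex_hilbert_space \<Rightarrow>\<^sub>L 'h)) \<Rightarrow> (nat \<times> 'h \<times> 'h \<Rightarrow>\<^sub>0 complex) \<Rightarrow> real" where
  "moment_functional \<pi> v = Re (lin (\<lambda>(m, a, b). cinner (blinfun_apply (\<pi> (\<lambda>z. z ^ m)) a) b) v)"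

lemma linear_moment_functional: "linear (moment_functional \<pi>)"
  unfolding moment_functional_def
  by (intro linearI) (simp_all add: lin_add lin_scaleR)

lemma symbol_linear: "symbol (v + w) z \<xi> = symbol v z \<xi> + symbol w z \<xi>"
  "symbol (v - w) z \<xi> = symbol v z \<xi> - symbol w z \<xi>"
  "symbol (r *\<^sub>R v) z \<xi> = r *\<^sub>R symbol v z \<xi>"
  "symbol (sum f I) z \<xi> = (\<Sum>i\<in>I. symbol (f i) z \<xi>)"
  by (simp_all add: symbol_def lin_simps)

lemma symbol_single: "symbol (Poly_Mapping.single (m, a, b) c) z \<xi> = c * (z ^ m * (\<xi> a * cnj (\<xi> b)))"
  by (simp add: symbol_def)

lemma convex_cone_positive_symbols: "convex_cone positive_symbols"
  unfolding convex_cone_iff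
  by (auto simp: positive_symbols_def symbol_linear) (simp add: symbol_def)

lemma subspace_Neil_symbols: "subspace Neil_symbols"
  by (auto simp: subspace_def Neil_symbols_def lookup_add lookup_scaleR)

lemma single_Neil_symbols: "m \<noteq> 1 \<Longrightarrow> Poly_Mapping.single (m, a, b) c \<in> Neil_symbols"
  by (simp add: Neil_symbols_def lookup_single)

text \<open>A term \<open>c z ^ m (a \<otimes> b)\<close> is dominated on the disk by the constant \<open>\<bar>c\<bar> / 2 (a \<otimes> a + b \<otimes> b)\<close>.\<close>

lemma Neil_symbols_cofinal:
  fixes v :: "nat \<times> 'h \<times> 'h \<Rightarrow>\<^sub>0 complex"
  shows "\<exists>w\<in>Neil_symbols. w - v \<in> positive_symbols"
proof -
  define r where "r = (\<lambda>k. complex_of_real (cmod (Poly_Mapping.lookup v k) / 2))"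
  \<comment> \<open>Constant terms suffice, and \<open>0 \<noteq> 1\<close> puts them into \<open>Neil_symbols\<close>.\<close>
  define w where "w = (\<Sum>(m, a, b)\<in>Poly_Mapping.keys v.
    Poly_Mapping.single (0::nat, a, a) (r (m, a, b)) + Poly_Mapping.single (0::nat, b, b) (r (m, a, b)))"
  have "w \<in> Neil_symbols"
    unfolding w_def by (intro subspace_sum subspace_Neil_symbols)
      (auto intro!: subspace_add subspace_Neil_symbols single_Neil_symbols)
  moreover have "Re (symbol v z \<xi>) \<le> Re (symbol w z \<xi>)" if z: "z \<in> ball 0 1" for z \<xi>
  proof -
    have "Re (symbol v z \<xi>) = (\<Sum>(m, a, b)\<in>Poly_Mapping.keys v.
        Re (Poly_Mapping.lookup v (m, a, b) * (z ^ m * (\<xi> a * cnj (\<xi> b)))))"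
      by (simp add: symbol_def lin_def case_prod_unfold)
    also have "\<dots> \<le> (\<Sum>(m, a, b)\<in>Poly_Mapping.keys v.
        Re (r (m, a, b) * (\<xi> a * cnj (\<xi> a)) + r (m, a, b) * (\<xi> b * cnj (\<xi> b))))"
    proof (rule sum_mono, clarify)
      fix m a b
      let ?c = "cmod (Poly_Mapping.lookup v (m, a, b))"
      have "cmod (z ^ m) \<le> 1" using z by (simp add: norm_power power_le_one)
      have "Re (Poly_Mapping.lookup v (m, a, b) * (z ^ m * (\<xi> a * cnj (\<xi> b))))
          \<le> ?c * (cmod (z ^ m) * (cmod (\<xi> a) * cmod (\<xi> b)))"
        by (rule order_trans[OF complex_Re_le_cmod]) (simp add: norm_mult)
      also have "\<dots> \<le> ?c * (1 * (cmod (\<xi> a) * cmod (\<xi> b)))"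
        using \<open>cmod (z ^ m) \<le> 1\<close> by (intro mult_left_mono mult_right_mono) auto
      also have "\<dots> \<le> ?c * (((cmod (\<xi> a))\<^sup>2 + (cmod (\<xi> b))\<^sup>2) / 2)"
        using sum_squares_bound[of "cmod (\<xi> a)" "cmod (\<xi> b)"] by (intro mult_left_mono) auto
      also have "\<dots> = Re (r (m, a, b) * (\<xi> a * cnj (\<xi> a)) + r (m, a, b) * (\<xi> b * cnj (\<xi> b)))"
        unfolding r_def complex_norm_square[symmetric] of_real_mult[symmetric] of_real_add[symmetric]
          Re_complex_of_real by (simp add: field_simps)
      finally show "Re (Poly_Mapping.lookup v (m, a, b) * (z ^ m * (\<xi> a * cnj (\<xi> b))))
          \<le> Re (r (m, a, b) * (\<xi> a * cnj (\<xi> a)) + r (m, a, b) * (\<xi> b * cnj (\<xi> b)))" .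
    qed
    also have "\<dots> = Re (symbol w z \<xi>)"
      unfolding w_def symbol_linear Re_sum
      by (intro sum.cong refl) (auto simp: symbol_linear symbol_single)
    finally show ?thesis .
  qed
  ultimately show ?thesis
    by (intro bexI[of _ w]) (auto simp: positive_symbols_def symbol_linear)
qed

text \<open>If \<open>h\<close> enumerates the vectors that occur in \<open>w\<close>, then \<open>w\<close> is a matrix of polynomials without linear
term. As \<open>\<xi>\<close> runs through all functions, \<open>(\<xi> (h j))\<close> runs through all complex tuples, so a positive symbol is
a matrix with nonnegative real part on the disk.\<close>

lemma moment_functional_nonneg:
  fixes \<pi> :: "(complex \<Rightarrow> complex) \<Rightarrow> ('h::complex_hilbert_space \<Rightarrow>\<^sub>L 'h)"
  assumes rep: "unital_representation \<pi>" and cc: "completely_contractive \<pi>"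
    and w: "w \<in> Neil_symbols \<inter> positive_symbols"
  shows "0 \<le> moment_functional \<pi> w"
proof -
  define A where "A = (\<lambda>(m, a, b). a) ` Poly_Mapping.keys w \<union> (\<lambda>(m, a, b). b) ` Poly_Mapping.keys w"
  define D where "D = Max (insert 0 (fst ` Poly_Mapping.keys w))"
  have "finite A" by (simp add: A_def)
  then obtain h where "bij_betw h {0..<card A} A" using ex_bij_betw_nat_finite by blast
  then have h: "bij_betw h {..<card A} A" by (simp add: atLeast0LessThan)
  define n where "n = card A"
  have hn: "bij_betw h {..<n} A" using h by (simp add: n_def)
  have keys: "Poly_Mapping.keys w \<subseteq> {..D} \<times> A \<times> A"
  proof
    fix k assume k: "k \<in> Poly_Mapping.keys w"
    obtain m a b where kk: "k = (m, a, b)" by (cases k)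
    have "m \<le> D" unfolding D_def using k kk by (intro Max_ge) force+
    moreover have "a \<in> A" "b \<in> A" using k kk unfolding A_def by force+
    ultimately show "k \<in> {..D} \<times> A \<times> A" using kk by simp
  qed
  have lin: "lin \<phi> w = (\<Sum>j<n. \<Sum>l<n. \<Sum>m\<le>D. Poly_Mapping.lookup w (m, h j, h l) * \<phi> (m, h j, h l))" for \<phi>
  proof -
    have "lin \<phi> w = (\<Sum>k\<in>{..D} \<times> A \<times> A. Poly_Mapping.lookup w k * \<phi> k)"
      using \<open>finite A\<close> keys by (intro lin_superset) auto
    also have "\<dots> = (\<Sum>m\<le>D. \<Sum>a\<in>A. \<Sum>b\<in>A. Poly_Mapping.lookup w (m, a, b) * \<phi> (m, a, b))"
      by (simp add: sum.cartesian_product')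
    also have "\<dots> = (\<Sum>m\<le>D. \<Sum>j<n. \<Sum>l<n. Poly_Mapping.lookup w (m, h j, h l) * \<phi> (m, h j, h l))"
      unfolding sum.reindex_bij_betw[OF hn, symmetric] ..
    also have "\<dots> = (\<Sum>j<n. \<Sum>m\<le>D. \<Sum>l<n. Poly_Mapping.lookup w (m, h j, h l) * \<phi> (m, h j, h l))"
      by (rule sum.swap)
    also have "\<dots> = (\<Sum>j<n. \<Sum>l<n. \<Sum>m\<le>D. Poly_Mapping.lookup w (m, h j, h l) * \<phi> (m, h j, h l))"
      by (intro sum.cong refl sum.swap)
    finally show ?thesis .
  qed
  define p where "p = (\<lambda>j l. \<Sum>m\<le>D. monom (Poly_Mapping.lookup w (m, h j, h l)) m)"
  have cp: "coeff (p j l) m = (if m \<le> D then Poly_Mapping.lookup w (m, h j, h l) else 0)" for j l m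
    by (simp add: p_def coeff_sum coeff_monom)
  have p1: "coeff (p j l) 1 = 0" for j l
    using w by (simp add: cp Neil_symbols_def)
  have dp: "degree (p j l) \<le> D" for j l
    by (rule degree_le) (simp add: cp)
  have "0 \<le> Re (\<Sum>j<n. \<Sum>l<n. cinner (blinfun_apply (\<pi> (poly (p j l))) (h j)) (h l))"
  proof (rule completely_contractive_accretive[OF rep cc p1])
    fix z :: complex and c :: "nat \<Rightarrow> complex" assume z: "z \<in> ball 0 1"
    define \<xi> where "\<xi> = (\<lambda>a. c (inv_into {..<n} h a))"
    have \<xi>: "\<xi> (h j) = c j" if "j < n" for j
      using hn that by (simp add: \<xi>_def bij_betw_def)
    have "0 \<le> Re (symbol w z \<xi>)" using w z by (simp add: positive_symbols_def)
    also have "symbol w z \<xi> = (\<Sum>j<n. \<Sum>l<n. poly (p j l) z * (c j * cnj (c l)))"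
      unfolding symbol_def lin
      by (intro sum.cong refl) (simp add: p_def poly_sum poly_monom sum_distrib_right sum_distrib_left \<xi> mult_ac)
    finally show "0 \<le> Re (\<Sum>j<n. \<Sum>l<n. poly (p j l) z * (c j * cnj (c l)))" .
  qed
  also have "(\<Sum>j<n. \<Sum>l<n. cinner (blinfun_apply (\<pi> (poly (p j l))) (h j)) (h l))
      = lin (\<lambda>(m, a, b). cinner (blinfun_apply (\<pi> (\<lambda>z. z ^ m)) a) b) w"
    unfolding lin representation_poly[OF rep p1 dp]
    by (intro sum.cong refl) (simp add: hilbert.ip_sum_left hilbert.ip_scale_left cp)
  finally show ?thesis by (simp add: moment_functional_def)
qed

text \<open>The number \<open>\<tau> m a b\<close> is chosen such that the extended functional takes the value \<open>Re (c * \<tau> m a b)\<close> at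
\<open>c z ^ m (a \<otimes> b)\<close>; for this, a real-linear functional has to be evaluated at \<open>c = 1\<close> and \<open>c = \<i>\<close>.\<close>

lemma completely_contractive_imp_Toeplitz_kernel:
  fixes \<pi> :: "(complex \<Rightarrow> complex) \<Rightarrow> ('h::complex_hilbert_space \<Rightarrow>\<^sub>L 'h)"
  assumes rep: "unital_representation \<pi>" and cc: "completely_contractive \<pi>"
  shows "\<exists>\<kappa> :: int \<times> 'h \<Rightarrow> int \<times> 'h \<Rightarrow> complex.
    (\<forall>I. finite I \<longrightarrow> psd_on I \<kappa>) \<and>
    (\<forall>i j a b. \<kappa> (i + 1, a) (j + 1, b) = \<kappa> (i, a) (j, b)) \<and>
    (\<forall>n a b. n \<noteq> 1 \<longrightarrow> \<kappa> (int n, a) (0, b) = cinner (blinfun_apply (\<pi> (\<lambda>z. z ^ n)) a) b)"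
proof -
  obtain f :: "(nat \<times> 'h \<times> 'h \<Rightarrow>\<^sub>0 complex) \<Rightarrow> real" where f: "linear f"
    and f_eq: "\<And>w. w \<in> Neil_symbols \<Longrightarrow> f w = moment_functional \<pi> w"
    and f_pos: "\<And>v. v \<in> positive_symbols \<Longrightarrow> 0 \<le> f v"
    using positive_functional_extension[OF linear_moment_functional subspace_Neil_symbols
        convex_cone_positive_symbols moment_functional_nonneg[OF rep cc] Neil_symbols_cofinal] by blast
  let ?e = "\<lambda>m a b c. Poly_Mapping.single (m, a, b) c :: nat \<times> 'h \<times> 'h \<Rightarrow>\<^sub>0 complex"
  define \<tau> where "\<tau> = (\<lambda>m a b. Complex (f (?e m a b 1)) (- f (?e m a b \<i>)))"
  have f_single: "f (?e m a b c) = Re (c * \<tau> m a b)" for m a b c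
  proof -
    have "?e m a b c = Re c *\<^sub>R ?e m a b 1 + Im c *\<^sub>R ?e m a b \<i>"
      by (rule poly_mapping_eqI)
        (auto simp: lookup_add lookup_scaleR lookup_single when_def complex_eq_iff)
    then show ?thesis by (simp add: linear_add[OF f] linear_scale[OF f] \<tau>_def)
  qed
  have \<tau>_eq: "\<tau> m a b = cinner (blinfun_apply (\<pi> (\<lambda>z. z ^ m)) a) b" if "m \<noteq> 1" for m a b
    unfolding \<tau>_def f_eq[OF single_Neil_symbols[OF that]]
    by (simp add: moment_functional_def complex_eq_iff)
  define \<kappa> where "\<kappa> = (\<lambda>(i, a) (j, b). if j \<le> i then \<tau> (nat (i - j)) a b else cnj (\<tau> (nat (j - i)) b a))"
  have one: "\<tau> 0 a b = cinner a b" for a b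
  proof -
    have "\<pi> (\<lambda>z. z ^ 0) = id_blinfun"
      using rep unfolding unital_representation_def power_0 by blast
    then show ?thesis using \<tau>_eq[of 0 a b] by simp
  qed
  have herm: "\<kappa> p q = cnj (\<kappa> q p)" for p q
  proof (cases "fst p = fst q")
    case True
    then show ?thesis
      using hilbert.ip_commute[of "snd p" "snd q"] by (simp add: \<kappa>_def case_prod_unfold one)
  next
    case False
    then show ?thesis by (auto simp: \<kappa>_def case_prod_unfold)
  qed
  have psd: "psd_on I \<kappa>" if I: "finite I" for I
    unfolding psd_on_def
  proof (intro conjI ballI allI)
    fix x :: "int \<times> 'h \<Rightarrow> complex"
    \<comment> \<open>The formal sum of the \<open>E p q\<close> has the Toeplitz quadratic form at \<open>x\<close> as its value under \<open>f\<close>.\<close>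
    define E where "E = (\<lambda>p q. if fst q \<le> fst p
      then ?e (nat (fst p - fst q)) (snd p) (snd q) (x p * cnj (x q))
      else ?e (nat (fst q - fst p)) (snd q) (snd p) (cnj (x p) * x q))"
    have fE: "f (E p q) = Re (x p * cnj (x q) * \<kappa> p q)" for p q
      by (auto simp: E_def f_single \<kappa>_def case_prod_unfold algebra_simps)
    have sE: "Re (symbol (E p q) z \<xi>)
        = Re ((x p * \<xi> (snd p)) * cnj (x q * \<xi> (snd q)) * Szego z (fst p) (fst q))" for p q z \<xi>
    proof (cases "fst q \<le> fst p")
      case True
      then show ?thesis by (simp add: E_def symbol_single Szego_def mult_ac)
    next
      case False
      then have eq: "symbol (E p q) z \<xi> = cnj ((x p * \<xi> (snd p)) * cnj (x q * \<xi> (snd q)) * Szego z (fst p) (fst q))"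
        by (simp add: E_def symbol_single Szego_def mult_ac)
      show ?thesis unfolding eq by (rule cnj.simps(1))
    qed
    have "(\<Sum>p\<in>I. \<Sum>q\<in>I. E p q) \<in> positive_symbols"
      unfolding positive_symbols_def
    proof (intro CollectI ballI allI)
      fix z :: complex and \<xi> :: "'h \<Rightarrow> complex" assume "z \<in> ball 0 1"
      then have "0 \<le> Re (\<Sum>p\<in>I. \<Sum>q\<in>I. (x p * \<xi> (snd p)) * cnj (x q * \<xi> (snd q)) * Szego z (fst p) (fst q))"
        using I by (intro Szego_positive[where c = "\<lambda>p. x p * \<xi> (snd p)" and d = fst]) auto
      then show "0 \<le> Re (symbol (\<Sum>p\<in>I. \<Sum>q\<in>I. E p q) z \<xi>)"
        by (simp only: symbol_linear Re_sum sE)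
    qed
    from f_pos[OF this] show "0 \<le> Re (\<Sum>p\<in>I. \<Sum>q\<in>I. x p * cnj (x q) * \<kappa> p q)"
      by (simp only: linear_sum[OF f] fE Re_sum)
  qed (rule herm)
  show ?thesis
  proof (intro exI[of _ \<kappa>] conjI allI impI)
    show "\<kappa> (int n, a) (0, b) = cinner (blinfun_apply (\<pi> (\<lambda>z. z ^ n)) a) b" if "n \<noteq> 1" for n a b
      using \<tau>_eq[OF that] by (simp add: \<kappa>_def)
    show "\<kappa> (i + 1, a) (j + 1, b) = \<kappa> (i, a) (j, b)" for i j a b
      by (simp add: \<kappa>_def)
  qed (rule psd)
qed

section \<open>The reproducing kernel Hilbert space of a positive kernel\<close>

lemma (in Metric_space) mcomplete_sequentially:
  "mcomplete \<longleftrightarrow> (\<forall>\<sigma>. (\<forall>n::nat. \<sigma> n \<in> M) \<and> (\<forall>\<epsilon>>0. \<exists>N. \<forall>m\<ge>N. \<forall>n\<ge>N. d (\<sigma> m) (\<sigma> n) < \<epsilon>)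
    \<longrightarrow> (\<exists>x\<in>M. \<forall>\<epsilon>>0. \<exists>N. \<forall>n\<ge>N. d (\<sigma> n) x < \<epsilon>))"
proof -
  have "MCauchy \<sigma> \<longleftrightarrow> (\<forall>n. \<sigma> n \<in> M) \<and> (\<forall>\<epsilon>>0. \<exists>N. \<forall>m\<ge>N. \<forall>n\<ge>N. d (\<sigma> m) (\<sigma> n) < \<epsilon>)" for \<sigma>
    unfolding MCauchy_def by (simp add: image_subset_iff)
  moreover have "limitin mtopology \<sigma> x sequentially \<longleftrightarrow> x \<in> M \<and> (\<forall>\<epsilon>>0. \<exists>N. \<forall>n\<ge>N. d (\<sigma> n) x < \<epsilon>)"
    if "\<forall>n. \<sigma> n \<in> M" for \<sigma> x
    using that by (simp add: limit_metric_sequentially)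
  ultimately show ?thesis unfolding mcomplete_def by (simp add: Bex_def)
qed

lemma lin_scale_function: "lin (\<lambda>p. c * \<phi> p) d = c * lin \<phi> d"
  by (simp add: lin_def sum_distrib_left mult_ac)

lemma lin_add_function: "lin (\<lambda>p. \<phi> p + \<psi> p) d = lin \<phi> d + lin \<psi> d"
  by (simp add: lin_def sum.distrib distrib_left)

lemma lin_diff_function: "lin (\<lambda>p. \<phi> p - \<psi> p) d = lin \<phi> d - lin \<psi> d"
  by (simp add: lin_def sum_subtractf right_diff_distrib)

lemma lin_minus_function: "lin (\<lambda>p. - \<phi> p) d = - lin \<phi> d"
  by (simp add: lin_def sum_negf)

lemma lin_zero_function: "lin (\<lambda>p. 0) d = 0"
  by (simp add: lin_def)

definition scale_pm :: "complex \<Rightarrow> ('x \<Rightarrow>\<^sub>0 complex) \<Rightarrow> ('x \<Rightarrow>\<^sub>0 complex)" where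
  "scale_pm c d = Poly_Mapping.map ((*) c) d"

lemma lookup_scale_pm: "Poly_Mapping.lookup (scale_pm c d) p = c * Poly_Mapping.lookup d p"
  by (simp add: scale_pm_def Poly_Mapping.map.rep_eq when_def)

lemma lin_scale_pm: "lin \<phi> (scale_pm c d) = c * lin \<phi> d"
  by (subst (1 2) lin_superset[of "Poly_Mapping.keys d"])
    (auto simp: lookup_scale_pm sum_distrib_left mult_ac in_keys_iff)

lemma lin_map_key:
  assumes "bij \<beta>"
  shows "lin (\<lambda>p. \<phi> (\<beta> p)) (Poly_Mapping.map_key \<beta> d) = lin \<phi> d"
proof -
  have inj: "inj \<beta>" using assms by (simp add: bij_is_inj)
  have "bij_betw \<beta> (Poly_Mapping.keys (Poly_Mapping.map_key \<beta> d)) (Poly_Mapping.keys d)"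
    using assms by (auto simp: keys_map_key[OF inj] bij_betw_def inj_on_def bij_def surj_image_vimage_eq)
  then show ?thesis
    unfolding lin_def map_key.rep_eq[OF inj] o_def
    by (rule sum.reindex_bij_betw[where g = "\<lambda>p. Poly_Mapping.lookup d p * \<phi> p"])
qed

text \<open>The pairing of a function with a formal sum \<open>d\<close>, conjugate linear in \<open>d\<close>. In the space of a kernel it is the
inner product of \<open>f\<close> with the combination \<open>d\<close> of kernel sections.\<close>

definition ev :: "('x \<Rightarrow> complex) \<Rightarrow> ('x \<Rightarrow>\<^sub>0 complex) \<Rightarrow> complex" where
  "ev f d = cnj (lin (\<lambda>p. cnj (f p)) d)"

lemma ev_simps:
  "ev f 0 = 0" "ev 0 d = 0" "ev f (- d) = - ev f d" "ev (- f) d = - ev f d" "ev f (d + e) = ev f d + ev f e" "ev f (d - e) = ev f d - ev f e"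
  "ev f (scale_pm c d) = cnj c * ev f d" "ev f (Poly_Mapping.single p c) = cnj c * f p"
  "ev (f + g) d = ev f d + ev g d" "ev (f - g) d = ev f d - ev g d" "ev (\<lambda>p. c * f p) d = c * ev f d"
  by (simp_all add: ev_def lin_simps lin_scale_pm lin_add_function lin_diff_function
      lin_scale_function lin_minus_function lin_zero_function)

lemma ev_altdef: "ev f d = (\<Sum>p\<in>Poly_Mapping.keys d. cnj (Poly_Mapping.lookup d p) * f p)"
  by (simp add: ev_def lin_def)

text \<open>The Hilbert space of a positive semidefinite kernel \<open>\<kappa>\<close> consists of the functions \<open>f\<close> that define bounded
functionals \<open>ev f\<close> on formal sums, the latter with the seminorm \<open>sqrt (qf d)\<close> given by \<open>\<kappa>\<close>. The squared
norm is written as \<open>sup\<^bsub>d\<^esub> 2 Re (ev f d) - qf d\<close> because in this form the distance to the combination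
\<open>section_sum d\<close> of kernel sections is read off at once (\<open>defect_le\<close>): a nearly optimal \<open>d\<close> is a good
approximation. So the kernel sections are dense, and inner products are limits of values of the pairing.\<close>

locale positive_kernel =
  fixes \<kappa> :: "'x \<Rightarrow> 'x \<Rightarrow> complex"
  assumes psd: "finite I \<Longrightarrow> psd_on I \<kappa>"
begin

text \<open>The convention is \<open>\<langle>\<kappa> p, \<kappa> q\<rangle> = \<kappa> p q\<close>, where \<open>\<kappa> p\<close> is the section \<open>\<kappa> p = (\<lambda>q. \<kappa> p q)\<close>.\<close>

definition section_sum :: "('x \<Rightarrow>\<^sub>0 complex) \<Rightarrow> 'x \<Rightarrow> complex" where
  "section_sum d = (\<lambda>q. lin (\<lambda>p. \<kappa> p q) d)"

abbreviation form :: "('x \<Rightarrow>\<^sub>0 complex) \<Rightarrow> ('x \<Rightarrow>\<^sub>0 complex) \<Rightarrow> complex" where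
  "form d e \<equiv> ev (section_sum d) e"

definition qf :: "('x \<Rightarrow>\<^sub>0 complex) \<Rightarrow> real" where
  "qf d = Re (form d d)"

definition RKHS :: "('x \<Rightarrow> complex) set" where
  "RKHS = {f. \<exists>B. \<forall>d. cmod (ev f d) \<le> B * sqrt (qf d)}"

definition sqnorm :: "('x \<Rightarrow> complex) \<Rightarrow> real" where
  "sqnorm f = (SUP d. 2 * Re (ev f d) - qf d)"

lemma kernel_hermitian: "\<kappa> p q = cnj (\<kappa> q p)"
  using psd[of "{p, q}"] by (rule psd_on_hermitian) auto

lemma section_sum_simps:
  "section_sum 0 = 0" "section_sum (d + e) = section_sum d + section_sum e"
  "section_sum (d - e) = section_sum d - section_sum e"
  "section_sum (scale_pm c d) = (\<lambda>p. c * section_sum d p)"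
  "section_sum (Poly_Mapping.single p 1) = \<kappa> p"
  by (auto simp: section_sum_def lin_simps lin_scale_pm)

lemma form_eq:
  assumes "finite I" "Poly_Mapping.keys d \<subseteq> I" "Poly_Mapping.keys e \<subseteq> I"
  shows "form d e = (\<Sum>p\<in>I. \<Sum>q\<in>I. Poly_Mapping.lookup d p * cnj (Poly_Mapping.lookup e q) * \<kappa> p q)"
proof -
  have "form d e = (\<Sum>q\<in>I. cnj (Poly_Mapping.lookup e q) * (\<Sum>p\<in>I. Poly_Mapping.lookup d p * \<kappa> p q))"
    unfolding ev_def section_sum_def
    by (simp add: lin_superset[OF assms(1,2)] lin_superset[OF assms(1,3)])
  also have "\<dots> = (\<Sum>q\<in>I. \<Sum>p\<in>I. Poly_Mapping.lookup d p * cnj (Poly_Mapping.lookup e q) * \<kappa> p q)"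
    by (simp add: sum_distrib_left mult_ac)
  finally show ?thesis by (subst sum.swap)
qed

lemma form_commute: "form d e = cnj (form e d)"
proof -
  let ?I = "Poly_Mapping.keys d \<union> Poly_Mapping.keys e"
  have "cnj (form e d)
      = (\<Sum>p\<in>?I. \<Sum>q\<in>?I. Poly_Mapping.lookup d q * cnj (Poly_Mapping.lookup e p) * cnj (\<kappa> p q))"
    by (subst form_eq[of ?I]) (auto simp: mult_ac)
  also have "\<dots> = (\<Sum>p\<in>?I. \<Sum>q\<in>?I. Poly_Mapping.lookup d q * cnj (Poly_Mapping.lookup e p) * \<kappa> q p)"
    by (simp only: kernel_hermitian[symmetric])
  also have "\<dots> = form d e"
    by (subst sum.swap) (subst form_eq[of ?I], auto)
  finally show ?thesis ..
qed

lemma qf_nonneg: "0 \<le> qf d"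
  unfolding qf_def form_eq[OF finite_keys order_refl order_refl]
  by (rule psd_on_form[OF psd[OF finite_keys]])

lemma qf_diff: "qf (d - e) = qf d - 2 * Re (form d e) + qf e"
  using form_commute[of e d] by (simp add: qf_def section_sum_simps ev_simps)

text \<open>Rescaling \<open>d\<close> by \<open>r * ev f d\<close> with \<open>r\<close> real turns the additive bound into a quadratic inequality in \<open>r\<close>,
whose optimum is the Cauchy-Schwarz inequality.\<close>

lemma ev_bound_of_bounded:
  assumes C: "\<And>d. 2 * Re (ev f d) - qf d \<le> C"
  shows "(cmod (ev f d))\<^sup>2 \<le> C * qf d"
proof -
  define w where "w = ev f d"
  have "2 * r * (cmod w)\<^sup>2 - r\<^sup>2 * (cmod w)\<^sup>2 * qf d \<le> C" for r
  proof -
    let ?e = "scale_pm (of_real r * w) d"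
    have "Re (ev f ?e) = r * (cmod w)\<^sup>2"
      unfolding cmod_power2 by (simp add: ev_simps w_def[symmetric] power2_eq_square algebra_simps)
    moreover have "form ?e ?e = of_real (r\<^sup>2 * (cmod w)\<^sup>2) * form d d"
      by (simp only: section_sum_simps ev_simps of_real_mult complex_norm_square)
        (simp add: power2_eq_square mult_ac)
    then have "qf ?e = r\<^sup>2 * (cmod w)\<^sup>2 * qf d" by (simp add: qf_def)
    ultimately show ?thesis using C[of ?e] by simp
  qed
  note quad = this
  show ?thesis
  proof (cases "qf d = 0")
    case True
    have "w = 0"
    proof (rule ccontr)
      assume "w \<noteq> 0"
      then show False
        using quad[of "(C + 1) / (2 * (cmod w)\<^sup>2)"] True by simp
    qed
    then show ?thesis using True by (simp add: w_def)
  next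
    case False
    then have pos: "qf d > 0" using qf_nonneg[of d] by simp
    have "(cmod w)\<^sup>2 / qf d \<le> C"
      using quad[of "1 / qf d"] pos by (simp add: power2_eq_square field_simps)
    then show ?thesis using pos by (simp add: field_simps w_def)
  qed
qed

lemma sqnorm_le_of_bound:
  assumes "\<And>d. cmod (ev f d) \<le> B * sqrt (qf d)"
  shows "2 * Re (ev f d) - qf d \<le> B\<^sup>2"
proof -
  have "2 * Re (ev f d) - qf d \<le> 2 * (B * sqrt (qf d)) - (sqrt (qf d))\<^sup>2"
    using assms[of d] complex_Re_le_cmod[of "ev f d"] qf_nonneg[of d] by simp
  also have "\<dots> = B\<^sup>2 - (B - sqrt (qf d))\<^sup>2" by (simp add: power2_eq_square algebra_simps)
  finally show ?thesis by (smt (verit) zero_le_power2)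
qed

lemma sqnorm_least: "(\<And>d. 2 * Re (ev f d) - qf d \<le> C) \<Longrightarrow> sqnorm f \<le> C"
  unfolding sqnorm_def by (rule cSUP_least) auto

lemma sqnorm_upper:
  assumes "f \<in> RKHS"
  shows "2 * Re (ev f d) - qf d \<le> sqnorm f"
proof -
  obtain B where B: "\<And>d. cmod (ev f d) \<le> B * sqrt (qf d)" using assms by (auto simp: RKHS_def)
  have "bdd_above (range (\<lambda>d. 2 * Re (ev f d) - qf d))"
    using sqnorm_le_of_bound[OF B] by (rule bdd_aboveI2)
  from cSUP_upper[OF UNIV_I this] show ?thesis by (simp add: sqnorm_def)
qed

lemma sqnorm_nonneg: "f \<in> RKHS \<Longrightarrow> 0 \<le> sqnorm f"
  using sqnorm_upper[of f 0] by (simp add: ev_simps qf_def)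

lemma ev_bound:
  assumes "f \<in> RKHS"
  shows "cmod (ev f d) \<le> sqrt (sqnorm f) * sqrt (qf d)"
proof -
  have "(cmod (ev f d))\<^sup>2 \<le> sqnorm f * qf d"
    by (rule ev_bound_of_bounded[OF sqnorm_upper[OF assms]])
  then show ?thesis by (simp add: real_le_rsqrt real_sqrt_mult[symmetric])
qed

lemma RKHS_I:
  assumes "\<And>d. 2 * Re (ev f d) - qf d \<le> C"
  shows "f \<in> RKHS"
proof -
  have "cmod (ev f d) \<le> sqrt C * sqrt (qf d)" for d
    using ev_bound_of_bounded[OF assms, of d] by (simp add: real_le_rsqrt real_sqrt_mult[symmetric])
  then show ?thesis by (auto simp: RKHS_def)
qed

lemma norm_le:
  assumes "\<And>d. cmod (ev f d) \<le> B * sqrt (qf d)" "0 \<le> B"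
  shows "f \<in> RKHS" "sqrt (sqnorm f) \<le> B"
proof -
  show "f \<in> RKHS" using assms by (auto simp: RKHS_def)
  have "sqnorm f \<le> B\<^sup>2" by (rule sqnorm_least[OF sqnorm_le_of_bound[OF assms(1)]])
  then show "sqrt (sqnorm f) \<le> B" using assms(2) by (simp add: real_le_lsqrt)
qed

lemma section_sum_RKHS: "section_sum d \<in> RKHS" and sqnorm_section_sum: "sqnorm (section_sum d) = qf d"
proof -
  have le: "2 * Re (form d e) - qf e \<le> qf d" for e
    using qf_nonneg[of "d - e"] unfolding qf_diff by linarith
  show mem: "section_sum d \<in> RKHS" using le by (rule RKHS_I)
  have "qf d \<le> sqnorm (section_sum d)" using sqnorm_upper[OF mem, of d] by (simp add: qf_def)
  then show "sqnorm (section_sum d) = qf d" using sqnorm_least[of "section_sum d", OF le] by linarith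
qed

lemma norm_triangle:
  assumes "f \<in> RKHS" "g \<in> RKHS"
  shows "f + g \<in> RKHS" "sqrt (sqnorm (f + g)) \<le> sqrt (sqnorm f) + sqrt (sqnorm g)"
proof -
  have le: "cmod (ev (f + g) d) \<le> (sqrt (sqnorm f) + sqrt (sqnorm g)) * sqrt (qf d)" for d
  proof -
    have "cmod (ev (f + g) d) \<le> cmod (ev f d) + cmod (ev g d)"
      unfolding ev_simps by (rule norm_triangle_ineq)
    then show ?thesis using ev_bound[OF assms(1), of d] ev_bound[OF assms(2), of d]
      by (simp add: distrib_right)
  qed
  show "f + g \<in> RKHS" "sqrt (sqnorm (f + g)) \<le> sqrt (sqnorm f) + sqrt (sqnorm g)"
    using norm_le[OF le] sqnorm_nonneg assms by auto
qed

lemma RKHS_scale: "f \<in> RKHS \<Longrightarrow> (\<lambda>p. c * f p) \<in> RKHS"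
proof -
  assume f: "f \<in> RKHS"
  have "cmod (ev (\<lambda>p. c * f p) d) \<le> (cmod c * sqrt (sqnorm f)) * sqrt (qf d)" for d
    using ev_bound[OF f, of d] by (simp add: ev_simps norm_mult mult.assoc mult_left_mono)
  then show ?thesis unfolding RKHS_def by blast
qed

lemma RKHS_minus: "f \<in> RKHS \<Longrightarrow> - f \<in> RKHS"
  using RKHS_scale[of f "-1"] by (simp add: fun_Compl_def)

lemma sqnorm_minus:
  assumes f: "f \<in> RKHS"
  shows "sqnorm (- f) = sqnorm f"
proof -
  have le: "sqnorm (- g) \<le> sqnorm g" if g: "g \<in> RKHS" for g
  proof (rule sqnorm_least)
    fix d
    have "qf (- d) = qf d"
      using section_sum_simps(3)[of 0 d] by (simp add: ev_simps section_sum_simps qf_def)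
    then show "2 * Re (ev (- g) d) - qf d \<le> sqnorm g"
      using sqnorm_upper[OF g, of "- d"] by (simp add: ev_simps)
  qed
  show ?thesis using le[OF f] le[OF RKHS_minus[OF f]] by simp
qed

lemma RKHS_diff: "f \<in> RKHS \<Longrightarrow> g \<in> RKHS \<Longrightarrow> f - g \<in> RKHS"
  using norm_triangle(1)[of f "- g"] RKHS_minus[of g] by simp

lemma norm_diff: "f \<in> RKHS \<Longrightarrow> g \<in> RKHS \<Longrightarrow> sqrt (sqnorm (f - g)) \<le> sqrt (sqnorm f) + sqrt (sqnorm g)"
  using norm_triangle(2)[of f "- g"] RKHS_minus[of g] by (simp add: sqnorm_minus)

lemma sqnorm_zero: "sqnorm 0 = 0"
  using sqnorm_section_sum[of 0] by (simp add: section_sum_simps qf_def ev_simps)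

text \<open>The distance of \<open>f\<close> from a combination of kernel sections.\<close>

definition defect :: "('x \<Rightarrow> complex) \<Rightarrow> ('x \<Rightarrow>\<^sub>0 complex) \<Rightarrow> real" where
  "defect f d = sqrt (sqnorm (f - section_sum d))"

lemma defect_le:
  assumes f: "f \<in> RKHS"
  shows "(defect f d)\<^sup>2 \<le> sqnorm f - (2 * Re (ev f d) - qf d)"
proof -
  have "sqnorm (f - section_sum d) \<le> sqnorm f - (2 * Re (ev f d) - qf d)"
  proof (rule sqnorm_least)
    fix e
    have "qf (e + d) = qf e + 2 * Re (form d e) + qf d"
      using form_commute[of e d] by (simp add: qf_def section_sum_simps ev_simps)
    then show "2 * Re (ev (f - section_sum d) e) - qf e \<le> sqnorm f - (2 * Re (ev f d) - qf d)"
      using sqnorm_upper[OF f, of "e + d"] by (simp add: ev_simps)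
  qed
  then show ?thesis
    using sqnorm_nonneg[OF RKHS_diff[OF f section_sum_RKHS]] by (simp add: defect_def)
qed

lemma section_sums_dense:
  assumes f: "f \<in> RKHS"
  shows "\<exists>a. (\<lambda>k::nat. defect f (a k)) \<longlonglongrightarrow> 0"
proof -
  have bdd: "bdd_above (range (\<lambda>d. 2 * Re (ev f d) - qf d))"
    using sqnorm_upper[OF f] by (rule bdd_aboveI2)
  have "\<exists>d. sqnorm f - 1 / real (Suc k) < 2 * Re (ev f d) - qf d" for k
    using less_cSUP_iff[OF _ bdd, of "sqnorm f - 1 / real (Suc k)"] by (simp add: sqnorm_def)
  then obtain a where a: "\<And>k. sqnorm f - 1 / real (Suc k) < 2 * Re (ev f (a k)) - qf (a k)" by metis
  have "(\<lambda>k. (defect f (a k))\<^sup>2) \<longlonglongrightarrow> 0"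
  proof (rule tendsto_sandwich[OF _ _ tendsto_const])
    show "\<forall>\<^sub>F k in sequentially. (defect f (a k))\<^sup>2 \<le> inverse (real (Suc k))"
    proof (intro always_eventually allI)
      show "(defect f (a k))\<^sup>2 \<le> inverse (real (Suc k))" for k
        using defect_le[OF f, of "a k"] a[of k] by (simp add: inverse_eq_divide)
    qed
  qed (use LIMSEQ_inverse_real_of_nat in auto)
  then have "(\<lambda>k. sqrt ((defect f (a k))\<^sup>2)) \<longlonglongrightarrow> sqrt 0" by (intro tendsto_intros)
  then have "(\<lambda>k. defect f (a k)) \<longlonglongrightarrow> 0"
    using sqnorm_nonneg[OF RKHS_diff[OF f section_sum_RKHS]] by (simp add: defect_def)
  then show ?thesis by blast
qed

lemma ev_defect_bound:
  assumes f: "f \<in> RKHS" and g: "g \<in> RKHS"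
  shows "cmod (ev f d - ev f e) \<le> sqrt (sqnorm f) * (defect g d + defect g e)"
proof -
  have "section_sum (d - e) = (g - section_sum e) - (g - section_sum d)"
    by (simp add: section_sum_simps)
  then have "sqrt (qf (d - e)) = sqrt (sqnorm ((g - section_sum e) - (g - section_sum d)))"
    by (metis sqnorm_section_sum)
  also have "\<dots> \<le> defect g d + defect g e"
    unfolding defect_def using norm_diff[OF RKHS_diff[OF g section_sum_RKHS] RKHS_diff[OF g section_sum_RKHS], of e d]
    by (simp add: add.commute)
  finally have le: "sqrt (qf (d - e)) \<le> defect g d + defect g e" .
  have "cmod (ev f d - ev f e) \<le> sqrt (sqnorm f) * sqrt (qf (d - e))"
    using ev_bound[OF f, of "d - e"] by (simp add: ev_simps)
  also have "\<dots> \<le> sqrt (sqnorm f) * (defect g d + defect g e)"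
    using le sqnorm_nonneg[OF f] by (intro mult_left_mono) auto
  finally show ?thesis .
qed

text \<open>The limit of the pairing along sections converging to \<open>g\<close>. The value \<open>0\<close> outside the space is chosen because
the locale \<open>Metric_space\<close> wants a symmetric, nonnegative distance on the whole type, and completeness of a
Hilbert space on a carrier is expressed by that locale.\<close>

definition ip :: "('x \<Rightarrow> complex) \<Rightarrow> ('x \<Rightarrow> complex) \<Rightarrow> complex" where
  "ip f g = (if f \<in> RKHS \<and> g \<in> RKHS
    then lim (\<lambda>k. ev f ((SOME a. (\<lambda>k::nat. defect g (a k)) \<longlonglongrightarrow> 0) k)) else 0)"

lemma ip_limit:
  assumes f: "f \<in> RKHS" and g: "g \<in> RKHS" and a: "(\<lambda>k. defect g (a k)) \<longlonglongrightarrow> 0"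
  shows "(\<lambda>k. ev f (a k)) \<longlonglongrightarrow> ip f g"
proof -
  define b where "b = (SOME a. (\<lambda>k::nat. defect g (a k)) \<longlonglongrightarrow> 0)"
  have b: "(\<lambda>k. defect g (b k)) \<longlonglongrightarrow> 0"
    unfolding b_def using section_sums_dense[OF g] by (rule someI_ex)
  have conv: "(\<lambda>k. sqrt (sqnorm f) * (defect g (u k) + defect g (v k))) \<longlonglongrightarrow> 0"
    if "(\<lambda>k. defect g (u k)) \<longlonglongrightarrow> 0" "(\<lambda>k. defect g (v k)) \<longlonglongrightarrow> 0" for u v :: "nat \<Rightarrow> 'x \<Rightarrow>\<^sub>0 complex"
    using tendsto_mult_right_zero[OF tendsto_add_zero[OF that]] .
  have "Cauchy (\<lambda>k. ev f (b k))"
  proof (rule metric_CauchyI)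
    fix e :: real assume e: "e > 0"
    have "\<forall>\<^sub>F k in sequentially. sqrt (sqnorm f) * (defect g (b k) + defect g (b k)) < e"
      using conv[OF b b] e by (rule order_tendstoD)
    then obtain M where M: "\<And>k. k \<ge> M \<Longrightarrow> sqrt (sqnorm f) * (defect g (b k) + defect g (b k)) < e"
      by (auto simp: eventually_sequentially)
    have "dist (ev f (b k)) (ev f (b l)) < e" if "k \<ge> M" "l \<ge> M" for k l
      using ev_defect_bound[OF f g, of "b k" "b l"] M[OF that(1)] M[OF that(2)]
      by (simp add: dist_norm distrib_left)
    then show "\<exists>M. \<forall>k\<ge>M. \<forall>l\<ge>M. dist (ev f (b k)) (ev f (b l)) < e" by blast
  qed
  then have "(\<lambda>k. ev f (b k)) \<longlonglongrightarrow> ip f g"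
    unfolding ip_def b_def[symmetric] using f g by (simp add: Cauchy_convergent convergent_LIMSEQ_iff[symmetric])
  moreover have "(\<lambda>k. ev f (a k) - ev f (b k)) \<longlonglongrightarrow> 0"
    by (rule Lim_null_comparison[OF _ conv[OF a b]]) (simp add: ev_defect_bound[OF f g])
  ultimately have "(\<lambda>k. (ev f (a k) - ev f (b k)) + ev f (b k)) \<longlonglongrightarrow> 0 + ip f g"
    by (intro tendsto_add)
  then show ?thesis by simp
qed

lemma ip_section_sum: "f \<in> RKHS \<Longrightarrow> ip f (section_sum d) = ev f d"
  using ip_limit[of f "section_sum d" "\<lambda>_. d"] section_sum_RKHS
  by (simp add: defect_def sqnorm_zero LIMSEQ_const_iff)

lemma ip_kernel: "f \<in> RKHS \<Longrightarrow> ip f (\<kappa> p) = f p"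
  using ip_section_sum[of f "Poly_Mapping.single p 1"] by (simp add: section_sum_simps ev_simps)

lemma kernel_RKHS: "\<kappa> p \<in> RKHS"
  using section_sum_RKHS[of "Poly_Mapping.single p 1"] by (simp add: section_sum_simps)

lemma norm_section_sum_approx:
  assumes g: "g \<in> RKHS"
  shows "\<bar>sqrt (qf d) - sqrt (sqnorm g)\<bar> \<le> defect g d"
proof -
  have "sqrt (sqnorm (section_sum d)) \<le> sqrt (sqnorm g) + defect g d"
    using norm_diff[OF g RKHS_diff[OF g section_sum_RKHS], of d] by (simp add: defect_def)
  moreover have "sqrt (sqnorm g) \<le> defect g d + sqrt (sqnorm (section_sum d))"
    using norm_triangle(2)[OF RKHS_diff[OF g section_sum_RKHS] section_sum_RKHS, of d d]
    by (simp add: defect_def)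
  ultimately show ?thesis unfolding sqnorm_section_sum by linarith
qed

lemma form_limit:
  assumes f: "f \<in> RKHS" and g: "g \<in> RKHS"
    and a: "(\<lambda>k. defect f (a k)) \<longlonglongrightarrow> 0" and b: "(\<lambda>k. defect g (b k)) \<longlonglongrightarrow> 0"
  shows "(\<lambda>k. form (a k) (b k)) \<longlonglongrightarrow> ip f g"
proof -
  have "(\<lambda>k. defect f (a k) * (sqrt (sqnorm g) + defect g (b k))) \<longlonglongrightarrow> 0 * (sqrt (sqnorm g) + 0)"
    by (intro tendsto_intros a b)
  then have lim: "(\<lambda>k. defect f (a k) * (sqrt (sqnorm g) + defect g (b k))) \<longlonglongrightarrow> 0" by simp
  have "(\<lambda>k. ev f (b k) - form (a k) (b k)) \<longlonglongrightarrow> 0"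
  proof (rule Lim_null_comparison[OF _ lim], intro always_eventually allI)
    fix k
    have "cmod (ev f (b k) - form (a k) (b k)) \<le> defect f (a k) * sqrt (qf (b k))"
      using ev_bound[OF RKHS_diff[OF f section_sum_RKHS], of "a k" "b k"] by (simp add: ev_simps defect_def)
    also have "\<dots> \<le> defect f (a k) * (sqrt (sqnorm g) + defect g (b k))"
      using norm_section_sum_approx[OF g, of "b k"] sqnorm_nonneg[OF RKHS_diff[OF f section_sum_RKHS]]
      by (intro mult_left_mono) (auto simp: defect_def)
    finally show "cmod (ev f (b k) - form (a k) (b k)) \<le> defect f (a k) * (sqrt (sqnorm g) + defect g (b k))" .
  qed
  from tendsto_diff[OF ip_limit[OF f g b] this] show ?thesis by simp
qed

lemma ip_commute: "f \<in> RKHS \<Longrightarrow> g \<in> RKHS \<Longrightarrow> ip f g = cnj (ip g f)"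
proof -
  assume f: "f \<in> RKHS" and g: "g \<in> RKHS"
  obtain a b where a: "(\<lambda>k. defect f (a k)) \<longlonglongrightarrow> 0" and b: "(\<lambda>k. defect g (b k)) \<longlonglongrightarrow> 0"
    using section_sums_dense f g by blast
  have "(\<lambda>k. cnj (form (b k) (a k))) \<longlonglongrightarrow> cnj (ip g f)"
    by (intro tendsto_cnj form_limit f g a b)
  moreover have "(\<lambda>k. cnj (form (b k) (a k))) \<longlonglongrightarrow> ip f g"
    unfolding form_commute[symmetric] by (rule form_limit[OF f g a b])
  ultimately show ?thesis using LIMSEQ_unique by blast
qed

lemma Re_ip_self: "f \<in> RKHS \<Longrightarrow> Re (ip f f) = sqnorm f"
proof -
  assume f: "f \<in> RKHS"
  obtain a where a: "(\<lambda>k. defect f (a k)) \<longlonglongrightarrow> 0" using section_sums_dense f by blast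
  have "(\<lambda>k. qf (a k)) \<longlonglongrightarrow> Re (ip f f)"
    unfolding qf_def by (intro tendsto_Re form_limit f a)
  moreover have "(\<lambda>k. sqrt (qf (a k)) - sqrt (sqnorm f)) \<longlonglongrightarrow> 0"
    by (rule Lim_null_comparison[OF _ a]) (simp add: norm_section_sum_approx[OF f])
  then have "(\<lambda>k. sqrt (qf (a k))) \<longlonglongrightarrow> sqrt (sqnorm f)" by (simp add: LIM_zero_iff)
  then have "(\<lambda>k. (sqrt (qf (a k)))\<^sup>2) \<longlonglongrightarrow> (sqrt (sqnorm f))\<^sup>2" by (rule tendsto_power)
  then have "(\<lambda>k. qf (a k)) \<longlonglongrightarrow> sqnorm f"
    by (simp only: real_sqrt_pow2[OF qf_nonneg] real_sqrt_pow2[OF sqnorm_nonneg[OF f]])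
  ultimately show ?thesis using LIMSEQ_unique by blast
qed

lemma ip_add_left:
  assumes "f \<in> RKHS" "g \<in> RKHS" "h \<in> RKHS"
  shows "ip (f + g) h = ip f h + ip g h"
proof -
  obtain a where a: "(\<lambda>k. defect h (a k)) \<longlonglongrightarrow> 0" using section_sums_dense assms by blast
  have "(\<lambda>k. ev (f + g) (a k)) \<longlonglongrightarrow> ip f h + ip g h"
    unfolding ev_simps by (intro tendsto_add ip_limit assms a)
  then show ?thesis
    using ip_limit[OF norm_triangle(1)[OF assms(1,2)] assms(3) a] LIMSEQ_unique by blast
qed

lemma ip_scale_left:
  assumes "f \<in> RKHS" "h \<in> RKHS"
  shows "ip (\<lambda>p. c * f p) h = c * ip f h"
proof -
  obtain a where a: "(\<lambda>k. defect h (a k)) \<longlonglongrightarrow> 0" using section_sums_dense assms by blast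
  have "(\<lambda>k. ev (\<lambda>p. c * f p) (a k)) \<longlonglongrightarrow> c * ip f h"
    unfolding ev_simps by (intro tendsto_mult tendsto_const ip_limit assms a)
  then show ?thesis
    using ip_limit[OF RKHS_scale[OF assms(1)] assms(2) a] LIMSEQ_unique by blast
qed

lemma value_bound:
  assumes "f \<in> RKHS"
  shows "cmod (f p) \<le> sqrt (sqnorm f) * sqrt (qf (Poly_Mapping.single p 1))"
  using ev_bound[OF assms, of "Poly_Mapping.single p 1"] by (simp add: ev_simps)

text \<open>Convergence in norm implies pointwise convergence by \<open>value_bound\<close>; the pointwise limit of a Cauchy
sequence is its limit in norm because the bounds for the pairing pass to the limit.\<close>

lemma RKHS_complete:
  fixes \<sigma> :: "nat \<Rightarrow> 'x \<Rightarrow> complex"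
  assumes \<sigma>: "\<And>n. \<sigma> n \<in> RKHS"
    and Cauchy: "\<And>\<epsilon>. \<epsilon> > 0 \<Longrightarrow> \<exists>N. \<forall>m\<ge>N. \<forall>n\<ge>N. sqrt (sqnorm (\<sigma> m - \<sigma> n)) < \<epsilon>"
  shows "\<exists>f\<in>RKHS. \<forall>\<epsilon>>0. \<exists>N. \<forall>n\<ge>N. sqrt (sqnorm (\<sigma> n - f)) < \<epsilon>"
proof -
  have "Cauchy (\<lambda>n. \<sigma> n p)" for p
  proof (rule metric_CauchyI)
    fix e :: real assume e: "e > 0"
    define b where "b = sqrt (qf (Poly_Mapping.single p 1))"
    have b: "b \<ge> 0" by (simp add: b_def qf_nonneg)
    obtain N where N: "\<And>m n. m \<ge> N \<Longrightarrow> n \<ge> N \<Longrightarrow> sqrt (sqnorm (\<sigma> m - \<sigma> n)) < e / (b + 1)"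
      using Cauchy[of "e / (b + 1)"] e b by (auto simp: add_nonneg_pos)
    have "dist (\<sigma> m p) (\<sigma> n p) < e" if "m \<ge> N" "n \<ge> N" for m n
    proof -
      have "dist (\<sigma> m p) (\<sigma> n p) \<le> sqrt (sqnorm (\<sigma> m - \<sigma> n)) * b"
        using value_bound[OF RKHS_diff[OF \<sigma> \<sigma>], of m n p] by (simp add: dist_norm b_def)
      also have "\<dots> \<le> e / (b + 1) * b" using N[OF that] b by (intro mult_right_mono) auto
      also have "\<dots> < e" using e b by (simp add: field_simps)
      finally show ?thesis .
    qed
    then show "\<exists>N. \<forall>m\<ge>N. \<forall>n\<ge>N. dist (\<sigma> m p) (\<sigma> n p) < e" by blast
  qed
  then have "\<forall>p. \<exists>l. (\<lambda>n. \<sigma> n p) \<longlonglongrightarrow> l" using Cauchy_convergent convergent_def by blast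
  then obtain f where f: "\<And>p. (\<lambda>n. \<sigma> n p) \<longlonglongrightarrow> f p" by metis
  have ev: "(\<lambda>n. ev (\<sigma> n) d) \<longlonglongrightarrow> ev f d" for d
    unfolding ev_altdef by (intro tendsto_intros f)
  have close: "\<sigma> m - f \<in> RKHS \<and> sqrt (sqnorm (\<sigma> m - f)) \<le> \<epsilon>"
    if \<epsilon>: "\<epsilon> > 0" and N: "\<And>m n. m \<ge> N \<Longrightarrow> n \<ge> N \<Longrightarrow> sqrt (sqnorm (\<sigma> m - \<sigma> n)) < \<epsilon>" and m: "m \<ge> N" for \<epsilon> N m
  proof -
    have "cmod (ev (\<sigma> m - f) d) \<le> \<epsilon> * sqrt (qf d)" for d
    proof (rule LIMSEQ_le_const2)
      show "(\<lambda>n. cmod (ev (\<sigma> m - \<sigma> n) d)) \<longlonglongrightarrow> cmod (ev (\<sigma> m - f) d)"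
        unfolding ev_simps by (intro tendsto_intros ev)
      show "\<exists>N. \<forall>n\<ge>N. cmod (ev (\<sigma> m - \<sigma> n) d) \<le> \<epsilon> * sqrt (qf d)"
      proof (intro exI[of _ N] allI impI)
        fix n assume n: "n \<ge> N"
        have "cmod (ev (\<sigma> m - \<sigma> n) d) \<le> sqrt (sqnorm (\<sigma> m - \<sigma> n)) * sqrt (qf d)"
          by (rule ev_bound[OF RKHS_diff[OF \<sigma> \<sigma>]])
        also have "\<dots> \<le> \<epsilon> * sqrt (qf d)"
          using N[OF m n] qf_nonneg by (intro mult_right_mono) auto
        finally show "cmod (ev (\<sigma> m - \<sigma> n) d) \<le> \<epsilon> * sqrt (qf d)" .
      qed
    qed
    then show ?thesis using norm_le[of "\<sigma> m - f" \<epsilon>] \<epsilon> by auto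
  qed
  obtain N1 where N1: "\<And>m n. m \<ge> N1 \<Longrightarrow> n \<ge> N1 \<Longrightarrow> sqrt (sqnorm (\<sigma> m - \<sigma> n)) < 1"
    using Cauchy[of 1] by auto
  have "\<sigma> N1 - f \<in> RKHS"
    using close[of 1 N1 N1] N1 by auto
  from RKHS_diff[OF \<sigma>[of N1] this] have "f \<in> RKHS" by simp
  moreover have "\<exists>N. \<forall>n\<ge>N. sqrt (sqnorm (\<sigma> n - f)) < \<epsilon>" if \<epsilon>: "\<epsilon> > 0" for \<epsilon>
  proof -
    obtain N where N: "\<And>m n. m \<ge> N \<Longrightarrow> n \<ge> N \<Longrightarrow> sqrt (sqnorm (\<sigma> m - \<sigma> n)) < \<epsilon> / 2"
      using Cauchy[of "\<epsilon> / 2"] \<epsilon> by auto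
    have "sqrt (sqnorm (\<sigma> n - f)) < \<epsilon>" if "n \<ge> N" for n
      using close[of "\<epsilon> / 2" N n] N that \<epsilon> by fastforce
    then show ?thesis by blast
  qed
  ultimately show ?thesis by blast
qed

lemma norm_RKHS_zero:
  assumes "f \<in> RKHS" "sqnorm f = 0"
  shows "f = 0"
proof
  show "f p = 0 p" for p using value_bound[OF assms(1), of p] assms(2) by simp
qed

lemma dist_RKHS:
  "sqrt (Re (ip (f - g) (f - g))) = (if f - g \<in> RKHS then sqrt (sqnorm (f - g)) else 0)"
  by (simp add: Re_ip_self) (simp add: ip_def)

lemma Metric_space_RKHS: "Metric_space RKHS (\<lambda>f g. sqrt (Re (ip (f - g) (f - g))))"
  unfolding dist_RKHS
proof
  fix f g :: "'x \<Rightarrow> complex"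
  show "0 \<le> (if f - g \<in> RKHS then sqrt (sqnorm (f - g)) else 0)" by (simp add: sqnorm_nonneg)
  have "f - g \<in> RKHS \<longleftrightarrow> g - f \<in> RKHS" using RKHS_minus[of "f - g"] RKHS_minus[of "g - f"] by auto
  then show "(if f - g \<in> RKHS then sqrt (sqnorm (f - g)) else 0)
      = (if g - f \<in> RKHS then sqrt (sqnorm (g - f)) else 0)"
    using sqnorm_minus[of "f - g"] by auto
next
  fix f g assume fg: "f \<in> RKHS" "g \<in> RKHS"
  show "(if f - g \<in> RKHS then sqrt (sqnorm (f - g)) else 0) = 0 \<longleftrightarrow> f = g"
    using norm_RKHS_zero[OF RKHS_diff[OF fg]] RKHS_diff[OF fg] by (auto simp: sqnorm_zero)
next
  fix f g h assume fgh: "f \<in> RKHS" "g \<in> RKHS" "h \<in> RKHS"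
  show "(if f - h \<in> RKHS then sqrt (sqnorm (f - h)) else 0)
      \<le> (if f - g \<in> RKHS then sqrt (sqnorm (f - g)) else 0) + (if g - h \<in> RKHS then sqrt (sqnorm (g - h)) else 0)"
    using norm_triangle(2)[OF RKHS_diff[OF fgh(1,2)] RKHS_diff[OF fgh(2,3)]] fgh by (simp add: RKHS_diff)
qed

lemma hilbert_space_on_RKHS: "hilbert_space_on (\<lambda>c f p. c * f p) RKHS ip"
proof -
  interpret vector_space "\<lambda>(c::complex) (f::'x \<Rightarrow> complex) p. c * f p"
    by standard (auto simp: fun_eq_iff algebra_simps)
  have zero: "0 \<in> RKHS" using section_sum_RKHS[of 0] by (simp add: section_sum_simps)
  show ?thesis
  proof
    show "subspace RKHS"
      unfolding subspace_def by (intro conjI ballI allI zero norm_triangle(1) RKHS_scale)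
    show "Metric_space.mcomplete RKHS (\<lambda>f g. sqrt (Re (ip (f - g) (f - g))))"
      unfolding Metric_space.mcomplete_sequentially[OF Metric_space_RKHS]
    proof (intro allI impI, elim conjE)
      fix \<sigma> :: "nat \<Rightarrow> 'x \<Rightarrow> complex"
      assume \<sigma>: "\<forall>n. \<sigma> n \<in> RKHS"
        and C: "\<forall>\<epsilon>>0. \<exists>N. \<forall>m\<ge>N. \<forall>n\<ge>N. sqrt (Re (ip (\<sigma> m - \<sigma> n) (\<sigma> m - \<sigma> n))) < \<epsilon>"
      have "\<exists>f\<in>RKHS. \<forall>\<epsilon>>0. \<exists>N. \<forall>n\<ge>N. sqrt (sqnorm (\<sigma> n - f)) < \<epsilon>"
        using \<sigma> C by (intro RKHS_complete) (simp_all add: dist_RKHS RKHS_diff)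
      then show "\<exists>f\<in>RKHS. \<forall>\<epsilon>>0. \<exists>N. \<forall>n\<ge>N. sqrt (Re (ip (\<sigma> n - f) (\<sigma> n - f))) < \<epsilon>"
        using \<sigma> by (simp add: dist_RKHS RKHS_diff)
    qed
    show "ip f g = cnj (ip g f)" if "f \<in> RKHS" "g \<in> RKHS" for f g
      using that by (rule ip_commute)
    show "f = 0" if "f \<in> RKHS" "ip f f = 0" for f
      using that Re_ip_self[of f] norm_RKHS_zero[of f] by simp
    show "0 \<le> Re (ip f f)" if "f \<in> RKHS" for f
      using that Re_ip_self sqnorm_nonneg by simp
  qed (use ip_add_left ip_scale_left in auto)
qed

text \<open>A symmetry of the kernel acts on its Hilbert space by a unitary, since it permutes the formal sums and
preserves their seminorm.\<close>

lemma
  assumes \<beta>: "bij \<beta>" and inv: "\<And>p q. \<kappa> (\<beta> p) (\<beta> q) = \<kappa> p q"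
  shows RKHS_reindex: "f \<in> RKHS \<Longrightarrow> (\<lambda>p. f (\<beta> p)) \<in> RKHS"
    and ip_reindex: "f \<in> RKHS \<Longrightarrow> g \<in> RKHS \<Longrightarrow> ip (\<lambda>p. f (\<beta> p)) (\<lambda>p. g (\<beta> p)) = ip f g"
proof -
  let ?m = "Poly_Mapping.map_key \<beta>"
  have ev: "ev (\<lambda>p. f (\<beta> p)) (?m d) = ev f d" for f d
    unfolding ev_def using lin_map_key[OF \<beta>, of "\<lambda>p. cnj (f p)"] by simp
  have sec: "section_sum (?m d) = (\<lambda>p. section_sum d (\<beta> p))" for d
  proof
    fix q
    have "section_sum (?m d) q = lin (\<lambda>p. \<kappa> (\<beta> p) (\<beta> q)) (?m d)"
      by (simp add: section_sum_def inv)
    also have "\<dots> = section_sum d (\<beta> q)"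
      unfolding section_sum_def by (rule lin_map_key[OF \<beta>])
    finally show "section_sum (?m d) q = section_sum d (\<beta> q)" .
  qed
  have qf: "qf (?m d) = qf d" for d by (simp add: qf_def sec ev)
  have surj: "\<exists>d. e = ?m d" for e
  proof
    have "?m (Poly_Mapping.map_key (inv_into UNIV \<beta>) e) = e"
      using \<beta> by (subst map_key_compose)
        (auto simp: bij_is_inj bij_imp_bij_inv bij_is_surj o_def map_key_id)
    then show "e = ?m (Poly_Mapping.map_key (inv_into UNIV \<beta>) e)" by simp
  qed
  have bound: "cmod (ev (\<lambda>p. f (\<beta> p)) e) \<le> sqrt (sqnorm f) * sqrt (qf e)" if f: "f \<in> RKHS" for f e
  proof -
    obtain d where "e = ?m d" using surj by blast
    then show ?thesis using ev_bound[OF f, of d] by (simp add: ev qf)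
  qed
  show mem: "(\<lambda>p. f (\<beta> p)) \<in> RKHS" if f: "f \<in> RKHS" for f
    using norm_le(1)[OF bound[OF f]] sqnorm_nonneg[OF f] by simp
  have small: "sqrt (sqnorm (\<lambda>p. f (\<beta> p))) \<le> sqrt (sqnorm f)" if f: "f \<in> RKHS" for f
    using norm_le(2)[OF bound[OF f]] sqnorm_nonneg[OF f] by simp
  show "ip (\<lambda>p. f (\<beta> p)) (\<lambda>p. g (\<beta> p)) = ip f g" if f: "f \<in> RKHS" and g: "g \<in> RKHS"
  proof -
    obtain a where a: "(\<lambda>k. defect g (a k)) \<longlonglongrightarrow> 0" using section_sums_dense g by blast
    have "(\<lambda>k. defect (\<lambda>p. g (\<beta> p)) (?m (a k))) \<longlonglongrightarrow> 0"
    proof (rule tendsto_sandwich[OF _ _ tendsto_const a])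
      show "\<forall>\<^sub>F k in sequentially. defect (\<lambda>p. g (\<beta> p)) (?m (a k)) \<le> defect g (a k)"
        using small[OF RKHS_diff[OF g section_sum_RKHS]]
        by (intro always_eventually allI) (simp add: defect_def sec fun_diff_def)
      show "\<forall>\<^sub>F k in sequentially. 0 \<le> defect (\<lambda>p. g (\<beta> p)) (?m (a k))"
        unfolding defect_def by (simp add: sqnorm_nonneg RKHS_diff section_sum_RKHS mem g)
    qed
    from ip_limit[OF mem[OF f] mem[OF g] this] show ?thesis
      unfolding ev using ip_limit[OF f g a] LIMSEQ_unique by blast
  qed
qed

end

section \<open>The dilation space\<close>

text \<open>A map that preserves inner products is linear: the squared norm of \<open>J (a + b) - (J a + J b)\<close> expands into inner
products of values of \<open>J\<close>, and these are the terms in the expansion of \<open>\<parallel>(a + b) - (a + b)\<parallel>\<^sup>2 = 0\<close>.\<close>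

lemma (in hilbert_space_on) isometric_imp_embedding:
  fixes J :: "'h::complex_hilbert_space \<Rightarrow> 'k"
  assumes JK: "\<And>a. J a \<in> K" and J: "\<And>a b. ip (J a) (J b) = cinner a b"
  shows "isometric_embedding scl K ip J"
proof -
  have "J (a + b) - (J a + J b) = 0" for a b
  proof (rule ip_eq_zero)
    show "ip (J (a + b) - (J a + J b)) (J (a + b) - (J a + J b)) = 0"
      by (simp add: JK J K_add K_diff ip_diff_left ip_diff_right ip_add_left ip_add_right
          hilbert.ip_add_left hilbert.ip_add_right)
  qed (intro K_diff K_add JK)
  moreover have "J (c *\<^sub>C a) - scl c (J a) = 0" for c a
  proof (rule ip_eq_zero)
    show "ip (J (c *\<^sub>C a) - scl c (J a)) (J (c *\<^sub>C a) - scl c (J a)) = 0"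
      by (simp add: JK J K_scale K_diff ip_diff_left ip_diff_right ip_scale_left ip_scale_right
          hilbert.ip_scale_left hilbert.ip_scale_right)
  qed (intro K_diff K_scale JK)
  ultimately show ?thesis using JK J by (auto simp: isometric_embedding_def)
qed

text \<open>A dilation can be moved along an injective linear map of its carrier. The hypothesis on the metric is needed
because \<open>hilbert_space_on\<close> leaves the inner product unrestricted outside the carrier, whereas
\<open>Metric_space\<close> also constrains distances there; for the same reason the new inner product is set to \<open>0\<close> outside
the new carrier.\<close>

lemma unitary_dilation_transport:
  fixes \<pi> :: "(complex \<Rightarrow> complex) \<Rightarrow> ('h::complex_hilbert_space \<Rightarrow>\<^sub>L 'h)"
    and \<rho> :: "'k::ab_group_add \<Rightarrow> 'l::ab_group_add"
  assumes dil: "unitary_dilation scl K ip J U \<pi>"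
    and M: "Metric_space K (\<lambda>x y. sqrt (Re (ip (x - y) (x - y))))"
    and vs: "vector_space scl'"
    and add: "\<And>x y. x \<in> K \<Longrightarrow> y \<in> K \<Longrightarrow> \<rho> (x + y) = \<rho> x + \<rho> y"
    and scale: "\<And>c x. x \<in> K \<Longrightarrow> \<rho> (scl c x) = scl' c (\<rho> x)"
    and inj: "inj_on \<rho> K"
  shows "\<exists>ip' J' U'. unitary_dilation scl' (\<rho> ` K) ip' J' U' \<pi>"
proof -
  have K: "hilbert_space_on scl K ip" and J: "isometric_embedding scl K ip J"
    and U: "unitary_on scl K ip U"
    using dil by (auto simp: unitary_dilation_def)
  interpret hilbert_space_on scl K ip by (rule K)
  interpret V: vector_space scl' by (rule vs)
  define \<sigma> where "\<sigma> = inv_into K \<rho>"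
  have \<sigma>: "\<sigma> (\<rho> x) = x" if "x \<in> K" for x using inj that by (simp add: \<sigma>_def)
  have diff: "\<rho> x - \<rho> y = \<rho> (x - y)" if "x \<in> K" "y \<in> K" for x y
    using add[of "x - y" y] that K_diff by simp
  have zero: "\<rho> 0 = 0" using diff[OF K_0 K_0] by simp
  define ip' where "ip' = (\<lambda>x y. if x \<in> \<rho> ` K \<and> y \<in> \<rho> ` K then ip (\<sigma> x) (\<sigma> y) else 0)"
  have ip': "ip' (\<rho> x) (\<rho> y) = ip x y" if "x \<in> K" "y \<in> K" for x y
    using that by (simp add: ip'_def \<sigma>)
  have dist: "ip' (\<rho> x - \<rho> y) (\<rho> x - \<rho> y) = ip (x - y) (x - y)" if "x \<in> K" "y \<in> K" for x y
    using that by (simp add: diff ip' K_diff)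
  have neg: "- w \<in> \<rho> ` K \<and> ip' (- w) (- w) = ip' w w" if w: "w \<in> \<rho> ` K" for w
  proof -
    obtain x where x: "w = \<rho> x" "x \<in> K" using w by blast
    have "- w = \<rho> 0 - \<rho> x" by (simp add: x zero)
    then show ?thesis using dist[OF K_0 x(2)] dist[OF x(2) K_0] diff[OF K_0 x(2)] K_diff[OF K_0 x(2)]
      using ip_diff_left[OF K_0 x(2)] ip_diff_right[OF K_0 x(2)] x
      by (simp add: zero ip_zero_left ip_zero_right)
  qed
  have M': "Metric_space (\<rho> ` K) (\<lambda>x y. sqrt (Re (ip' (x - y) (x - y))))"
  proof
    fix x y :: 'l
    show "0 \<le> sqrt (Re (ip' (x - y) (x - y)))"
      using ip_ge_zero by (auto simp: ip'_def \<sigma>)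
    have "ip' (- w) (- w) = ip' w w" for w
      using neg[of w] neg[of "- w"] by (cases "w \<in> \<rho> ` K") (auto simp: ip'_def)
    from this[of "x - y"] show "sqrt (Re (ip' (x - y) (x - y))) = sqrt (Re (ip' (y - x) (y - x)))" by simp
  next
    fix x y assume "x \<in> \<rho> ` K" "y \<in> \<rho> ` K"
    then obtain u v where uv: "x = \<rho> u" "y = \<rho> v" and K: "u \<in> K" "v \<in> K" by blast
    show "sqrt (Re (ip' (x - y) (x - y))) = 0 \<longleftrightarrow> x = y"
      unfolding uv dist[OF K] Metric_space.zero[OF M K] using inj_on_eq_iff[OF inj K] by simp
  next
    fix x y z assume "x \<in> \<rho> ` K" "y \<in> \<rho> ` K" "z \<in> \<rho> ` K"
    then obtain u v w where uvw: "x = \<rho> u" "y = \<rho> v" "z = \<rho> w" and K: "u \<in> K" "v \<in> K" "w \<in> K"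
      by blast
    show "sqrt (Re (ip' (x - z) (x - z))) \<le> sqrt (Re (ip' (x - y) (x - y))) + sqrt (Re (ip' (y - z) (y - z)))"
      unfolding uvw dist[OF K(1,3)] dist[OF K(1,2)] dist[OF K(2,3)] by (rule Metric_space.triangle[OF M K])
  qed
  have complete: "Metric_space.mcomplete (\<rho> ` K) (\<lambda>x y. sqrt (Re (ip' (x - y) (x - y))))"
    unfolding Metric_space.mcomplete_sequentially[OF M']
  proof (intro allI impI, elim conjE)
    fix s :: "nat \<Rightarrow> 'l"
    assume s: "\<forall>n. s n \<in> \<rho> ` K"
      and C: "\<forall>\<epsilon>>0. \<exists>N. \<forall>m\<ge>N. \<forall>n\<ge>N. sqrt (Re (ip' (s m - s n) (s m - s n))) < \<epsilon>"
    have "\<forall>n. \<exists>u. u \<in> K \<and> s n = \<rho> u" using s by blast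
    then obtain u where u: "\<And>n. u n \<in> K" "\<And>n. s n = \<rho> (u n)" by metis
    have "\<exists>x\<in>K. \<forall>\<epsilon>>0. \<exists>N. \<forall>n\<ge>N. sqrt (Re (ip (u n - x) (u n - x))) < \<epsilon>"
      using mcomplete_K[unfolded Metric_space.mcomplete_sequentially[OF M], THEN spec, of u] u C
      by (simp add: dist)
    then show "\<exists>x\<in>\<rho> ` K. \<forall>\<epsilon>>0. \<exists>N. \<forall>n\<ge>N. sqrt (Re (ip' (s n - x) (s n - x))) < \<epsilon>"
      using u by (auto simp: dist)
  qed
  have K': "hilbert_space_on scl' (\<rho> ` K) ip'"
  proof
    show "V.subspace (\<rho> ` K)"
      unfolding V.subspace_def
    proof (intro conjI ballI allI)
      show "0 \<in> \<rho> ` K" using imageI[OF K_0, of \<rho>] by (simp add: zero)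
      show "x + y \<in> \<rho> ` K" if "x \<in> \<rho> ` K" "y \<in> \<rho> ` K" for x y
      proof -
        obtain u v where uv: "x = \<rho> u" "y = \<rho> v" and K: "u \<in> K" "v \<in> K"
          using \<open>x \<in> \<rho> ` K\<close> \<open>y \<in> \<rho> ` K\<close> by blast
        show ?thesis unfolding uv add[OF K, symmetric] by (rule imageI[OF K_add[OF K]])
      qed
      show "scl' c x \<in> \<rho> ` K" if "x \<in> \<rho> ` K" for c x
      proof -
        obtain u where u: "x = \<rho> u" "u \<in> K" using \<open>x \<in> \<rho> ` K\<close> by blast
        show ?thesis unfolding u(1) scale[OF u(2), symmetric] by (rule imageI[OF K_scale[OF u(2)]])
      qed
    qed
    show "ip' x y = cnj (ip' y x)" if "x \<in> \<rho> ` K" "y \<in> \<rho> ` K" for x y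
    proof -
      obtain u v where uv: "x = \<rho> u" "u \<in> K" "y = \<rho> v" "v \<in> K" using \<open>x \<in> \<rho> ` K\<close> \<open>y \<in> \<rho> ` K\<close> by blast
      show ?thesis unfolding uv ip'[OF uv(2,4)] ip'[OF uv(4,2)] by (rule ip_commute[OF uv(2,4)])
    qed
    show "ip' (x + y) z = ip' x z + ip' y z" if "x \<in> \<rho> ` K" "y \<in> \<rho> ` K" "z \<in> \<rho> ` K" for x y z
    proof -
      obtain u v w where uvw: "x = \<rho> u" "u \<in> K" "y = \<rho> v" "v \<in> K" "z = \<rho> w" "w \<in> K"
        using \<open>x \<in> \<rho> ` K\<close> \<open>y \<in> \<rho> ` K\<close> \<open>z \<in> \<rho> ` K\<close> by blast
      show ?thesis using uvw by (simp add: add[symmetric] ip' K_add ip_add_left)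
    qed
    show "ip' (scl' c x) y = c * ip' x y" if "x \<in> \<rho> ` K" "y \<in> \<rho> ` K" for c x y
      using that by (auto simp: scale[symmetric] ip' K_scale ip_scale_left)
    show "0 \<le> Re (ip' x x)" if "x \<in> \<rho> ` K" for x using that by (auto simp: ip' ip_ge_zero)
    show "x = 0" if "x \<in> \<rho> ` K" "ip' x x = 0" for x
    proof -
      obtain u where u: "x = \<rho> u" "u \<in> K" using \<open>x \<in> \<rho> ` K\<close> by blast
      have "u = 0" using that(2) ip_eq_zero[OF u(2)] ip'[OF u(2) u(2)] u(1) by simp
      then show ?thesis using u(1) zero by simp
    qed
  qed (rule complete)
  have JK: "J h \<in> K" for h using J by (auto simp: isometric_embedding_def)
  have J': "isometric_embedding scl' (\<rho> ` K) ip' (\<rho> \<circ> J)"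
    using J JK by (auto simp: isometric_embedding_def ip' add scale)
  have UK: "U x \<in> K" if "x \<in> K" for x using U that by (auto simp: unitary_on_def bij_betw_def)
  define U' where "U' = \<rho> \<circ> U \<circ> \<sigma>"
  have U'\<rho>: "U' (\<rho> x) = \<rho> (U x)" if "x \<in> K" for x using that by (simp add: U'_def \<sigma>)
  have U': "unitary_on scl' (\<rho> ` K) ip' U'"
    unfolding unitary_on_def
  proof (intro conjI ballI allI)
    have \<rho>: "bij_betw \<rho> K (\<rho> ` K)" using inj by (rule inj_on_imp_bij_betw)
    have "bij_betw U K K" using U unfolding unitary_on_def by (rule conjunct1)
    from bij_betw_trans[OF bij_betw_inv_into[OF \<rho>] bij_betw_trans[OF this \<rho>]]
    show "bij_betw U' (\<rho> ` K) (\<rho> ` K)" by (simp add: U'_def \<sigma>_def o_assoc)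
  next
    fix x y assume "x \<in> \<rho> ` K" "y \<in> \<rho> ` K"
    then obtain u v where uv: "x = \<rho> u" "u \<in> K" "y = \<rho> v" "v \<in> K" by blast
    show "U' (x + y) = U' x + U' y"
      using uv U by (simp add: add[symmetric] U'\<rho> K_add UK unitary_on_def)
    show "ip' (U' x) (U' y) = ip' x y"
      using uv U by (simp add: U'\<rho> ip' UK unitary_on_def)
  next
    fix c x assume "x \<in> \<rho> ` K"
    then show "U' (scl' c x) = scl' c (U' x)"
      using U by (auto simp: scale[symmetric] U'\<rho> K_scale UK unitary_on_def)
  qed
  have pow: "(U' ^^ n) (\<rho> x) = \<rho> ((U ^^ n) x)" if "x \<in> K" for n x
    using unitary_on_funpow[OF U that] by (induction n) (simp_all add: U'\<rho>)
  have "unitary_dilation scl' (\<rho> ` K) ip' (\<rho> \<circ> J) U' \<pi>"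
    unfolding unitary_dilation_iff_moments[OF K' J' U']
    using dil unfolding unitary_dilation_iff_moments[OF K J U]
    by (simp add: pow JK ip' unitary_on_funpow[OF U])
  then show ?thesis by blast
qed

lemma vector_space_pointwise:
  "vector_space (\<lambda>c (g :: 'i \<Rightarrow> 'h::complex_hilbert_space) n. c *\<^sub>C g n)"
  by standard (simp_all add: fun_eq_iff hilbert.scale_right_distrib hilbert.scale_left_distrib)

lemma cinner_ext:
  assumes "\<And>h. cinner x h = cinner y h"
  shows "x = y"
proof -
  have "cinner (x - y) (x - y) = 0" using assms by (simp add: hilbert.ip_diff_left)
  then show ?thesis by (simp add: cinner_self)
qed

text \<open>In the Hilbert space of the kernel, the translation of \<open>\<int>\<close> is a unitary with \<open>U ^ n \<kappa> (0, h) = \<kappa> (n, h)\<close>,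
and \<open>h \<mapsto> \<kappa> (0, h)\<close> embeds \<open>H\<close>. An element \<open>f\<close> satisfies \<open>f (n, h) = \<langle>f, U ^ n \<kappa> (0, h)\<rangle>\<close>, so for
each \<open>n\<close> it has a representing vector \<open>\<rho> f n\<close> in \<open>H\<close>, and \<open>\<rho>\<close> identifies the space with one of
functions \<open>int \<Rightarrow> 'h\<close>.\<close>

lemma Toeplitz_kernel_imp_dilation:
  fixes \<pi> :: "(complex \<Rightarrow> complex) \<Rightarrow> ('h::complex_hilbert_space \<Rightarrow>\<^sub>L 'h)"
    and \<kappa> :: "int \<times> 'h \<Rightarrow> int \<times> 'h \<Rightarrow> complex"
  assumes rep: "unital_representation \<pi>"
    and psd: "\<And>I. finite I \<Longrightarrow> psd_on I \<kappa>"
    and shift: "\<And>i j a b. \<kappa> (i + 1, a) (j + 1, b) = \<kappa> (i, a) (j, b)"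
    and moments: "\<And>n a b. n \<noteq> 1 \<Longrightarrow> \<kappa> (int n, a) (0, b) = cinner (blinfun_apply (\<pi> (\<lambda>z. z ^ n)) a) b"
  shows "\<exists>scl (K :: (int \<Rightarrow> 'h) set) ip J U. unitary_dilation scl K ip J U \<pi>"
proof -
  interpret positive_kernel \<kappa> by standard (rule psd)
  interpret R: hilbert_space_on "\<lambda>c f p. c * f p" RKHS ip by (rule hilbert_space_on_RKHS)
  have diag: "\<kappa> (n, a) (n, b) = cinner a b" for n a b
  proof -
    have "\<kappa> (0, a) (0, b) = cinner a b"
    proof -
      have "\<pi> (\<lambda>z. z ^ 0) = id_blinfun"
        using rep unfolding unital_representation_def power_0 by blast
      then show ?thesis using moments[of 0 a b] by simp
    qed
    moreover have "\<kappa> (n, a) (n, b) = \<kappa> (0, a) (0, b)"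
    proof (induction n rule: int_induct[of _ 0])
      case (step1 i) then show ?case using shift[of i a i b] by simp
    next
      case (step2 i) then show ?case using shift[of "i - 1" a "i - 1" b] by simp
    qed simp
    ultimately show ?thesis by simp
  qed
  have emb: "isometric_embedding (\<lambda>c f p. c * f p) RKHS ip (\<lambda>a. \<kappa> (n, a))" for n
    by (rule R.isometric_imp_embedding) (simp_all add: kernel_RKHS ip_kernel diag)
  define up where "up = (\<lambda>(n::int, h::'h). (n + 1, h))"
  define down where "down = (\<lambda>(n::int, h::'h). (n - 1, h))"
  have bij: "bij up" "bij down"
    by (auto simp: up_def down_def intro!: bij_betw_byWitness[of UNIV "\<lambda>(n, h). (n - 1, h)"]
        bij_betw_byWitness[of UNIV "\<lambda>(n, h). (n + 1, h)" "\<lambda>(n, h). (n - 1, h)" UNIV])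
  have inv: "\<kappa> (up p) (up q) = \<kappa> p q" "\<kappa> (down p) (down q) = \<kappa> p q" for p q
    using shift[of "fst p" "snd p" "fst q" "snd q"] shift[of "fst p - 1" "snd p" "fst q - 1" "snd q"]
    by (simp_all add: up_def down_def case_prod_unfold)
  have ud: "up (down p) = p" "down (up p) = p" for p
    by (simp_all add: up_def down_def case_prod_unfold)
  define U where "U = (\<lambda>f :: int \<times> 'h \<Rightarrow> complex. \<lambda>p. f (down p))"
  have U: "unitary_on (\<lambda>c f p. c * f p) RKHS ip U"
    unfolding unitary_on_def
  proof (intro conjI ballI allI)
    show "bij_betw U RKHS RKHS"
      by (rule bij_betw_byWitness[of _ "\<lambda>f p. f (up p)"])
        (auto simp: U_def ud intro: RKHS_reindex[OF bij(1)] RKHS_reindex[OF bij(2)] inv)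
    show "ip (U f) (U g) = ip f g" if "f \<in> RKHS" "g \<in> RKHS" for f g
      unfolding U_def by (rule ip_reindex[OF bij(2) inv(2) that])
  qed (auto simp: U_def)
  have shift_kernel: "(U ^^ n) (\<kappa> (0, h)) = \<kappa> (int n, h)" for n h
  proof (induction n)
    case (Suc n)
    have "U (\<kappa> (int n, h)) = \<kappa> (int (Suc n), h)"
    proof
      fix q
      show "U (\<kappa> (int n, h)) q = \<kappa> (int (Suc n), h) q"
        using shift[of "int n" h "fst (down q)" "snd (down q)"]
        by (simp add: U_def down_def case_prod_unfold add.commute)
    qed
    then show ?case using Suc by simp
  qed simp
  have dil: "unitary_dilation (\<lambda>c f p. c * f p) RKHS ip (\<lambda>a. \<kappa> (0, a)) U \<pi>"
    unfolding unitary_dilation_iff_moments[OF hilbert_space_on_RKHS emb U]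
    by (simp add: shift_kernel ip_kernel kernel_RKHS moments)
  have "\<exists>y. \<forall>h. f (n, h) = cinner y h" if f: "f \<in> RKHS" for f n
    using compression_exists[OF hilbert_space_on_RKHS emb f, of n] by (simp add: ip_kernel f)
  then obtain \<rho> where \<rho>: "\<And>f n h. f \<in> RKHS \<Longrightarrow> f (n, h) = cinner (\<rho> f n) h" by metis
  have "\<exists>ip' J' U'. unitary_dilation (\<lambda>c g n. c *\<^sub>C g n) (\<rho> ` RKHS) ip' J' U' \<pi>"
  proof (rule unitary_dilation_transport[OF dil Metric_space_RKHS vector_space_pointwise])
    show "\<rho> (f + g) = \<rho> f + \<rho> g" if "f \<in> RKHS" "g \<in> RKHS" for f g
    proof
      fix n
      have "cinner (\<rho> (f + g) n) h = cinner (\<rho> f n + \<rho> g n) h" for h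
        using \<rho>[OF R.K_add[OF that], of n h] \<rho>[OF that(1), of n h] \<rho>[OF that(2), of n h]
        by (simp add: hilbert.ip_add_left)
      then show "\<rho> (f + g) n = (\<rho> f + \<rho> g) n" by (simp add: cinner_ext)
    qed
    show "\<rho> (\<lambda>p. c * f p) = (\<lambda>n. c *\<^sub>C \<rho> f n)" if "f \<in> RKHS" for c f
    proof
      fix n
      show "\<rho> (\<lambda>p. c * f p) n = c *\<^sub>C \<rho> f n"
      proof (rule cinner_ext)
        fix h
        show "cinner (\<rho> (\<lambda>p. c * f p) n) h = cinner (c *\<^sub>C \<rho> f n) h"
          unfolding hilbert.ip_scale_left[OF UNIV_I UNIV_I] \<rho>[OF that, symmetric]
          by (rule \<rho>[OF R.K_scale[OF that], symmetric])
      qed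
    qed
    show "inj_on \<rho> RKHS"
    proof (rule inj_onI, rule ext)
      fix f g p assume "f \<in> RKHS" "g \<in> RKHS" "\<rho> f = \<rho> g"
      then show "f p = g p" using \<rho>[of f "fst p" "snd p"] \<rho>[of g "fst p" "snd p"] by simp
    qed
  qed
  then show ?thesis by blast
qed

section \<open>Complete contractivity and unitary dilations\<close>

theorem theorem2p1:
  fixes \<pi> :: "(complex \<Rightarrow> complex) \<Rightarrow> ('h::complex_hilbert_space \<Rightarrow>\<^sub>L 'h)"
  assumes "unital_representation \<pi>" and "contractive \<pi>"
  shows "(completely_contractive \<pi> \<longleftrightarrow>
      (\<exists>scl (K :: (int \<Rightarrow> 'h) set) ip J U. unitary_dilation scl K ip J U \<pi>))
    \<and> ((\<exists>scl (K :: 'k::ab_group_add set) ip J U. unitary_dilation scl K ip J U \<pi>)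
      \<longrightarrow> completely_contractive \<pi>)"
proof (intro conjI iffI impI)
  assume "completely_contractive \<pi>"
  from completely_contractive_imp_Toeplitz_kernel[OF assms(1) this]
  show "\<exists>scl (K :: (int \<Rightarrow> 'h) set) ip J U. unitary_dilation scl K ip J U \<pi>"
    using Toeplitz_kernel_imp_dilation[OF assms(1)] by blast
qed (use dilation_imp_completely_contractive[OF assms] in blast)+

end
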